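(* Let $\mathbf A$ be a finite supernilpotent algebra of prime power order belonging to a congruence modular variety. Then there exists a linear time Monte Carlo algorithm solving $\mathrm{CSAT}(\mathbf A)$.
   Context: A circuit over an algebra $\mathbf A$ is a directed acyclic graph whose source nodes (input gates) are variables (or constants from $A$) and whose other gates are labeled by basic operations of $\mathbf A$; each gate computes a function of the input variables. $\mathrm{CSAT}(\mathbf A)$ is the problem: given a circuit over $\mathbf A$ with two output gates $g_1,g_2$, decide whether there is a valuation $\bar x$ of the input gates with $g_1(\bar x)=g_2(\bar x)$. A Monte Carlo algorithm here is a randomized algorithm that always answers "no" on unsatisfiable instances and answers "yes" on satisfiable instances with probability at least some constant $c>0$ depending only on $\mathbf A$; linear time means time linear in the input size. Supernilpotency: for congruences $\alpha_1,\dots,\alpha_k,\beta,\gamma$ of $\mathbf A$, $C(\alpha_1,\dots,\alpha_k,\beta;\gamma)$ holds if for every polynomial $f$ of $\mathbf A$ and all $\bar a_i\equiv_{\alpha_i}\bar b_i$, $\bar u\equiv_\beta\bar v$ with $f(\bar x_1,\dots,\bar x_k,\bar u)\equiv_\gamma f(\bar x_1,\dots,\bar x_k,\bar v)$ for all $(\bar x_i)\in\prod\{\bar a_i,\bar b_i\}$ except $(\bar b_1,\dots,\bar b_k)$, also $f(\bar b_1,\dots,\bar b_k,\bar u)\equiv_\gamma f(\bar b_1,\dots,\bar b_k,\bar v)$; the $(k+1)$-ary commutator $[\alpha_1,\dots,\alpha_{k+1}]$ is the least such $\gamma$ for $\beta=\alpha_{k+1}$; $\mathbf A$ is supernilpotent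 if $[1_A,\dots,1_A]=0_A$ ($k+1$ entries) for some $k$. *)

theory Defs
  imports "HOL-Probability.Probability_Mass_Function" "HOL-Number_Theory.Prime_Powers"
begin

section \<open>Algebras, terms and polynomials\<close>

text \<open>
  A signature is the list that gives the arity of each of the (finitely many) basic operations,
  which are named by their positions in that list.
\<close>

record 'a alg =
  signature :: "nat list"
  univ :: "'a set"
  oper :: "nat \<Rightarrow> 'a list \<Rightarrow> 'a"

definition is_algebra :: "'a alg \<Rightarrow> bool" where
  "is_algebra A \<longleftrightarrow>
     univ A \<noteq> {} \<and>
     (\<forall>f < length (signature A). \<forall>xs. length xs = signature A ! f \<and> set xs \<subseteq> univ A \<longrightarrow>
        oper A f xs \<in> univ A)"

datatype trm = Var nat | App nat "trm list"

fun wf_trm :: "nat list \<Rightarrow> trm \<Rightarrow> bool" where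
  "wf_trm sig (Var i) = True"
| "wf_trm sig (App f ts) = (f < length sig \<and> length ts = sig ! f \<and> (\<forall>t \<in> set ts. wf_trm sig t))"

fun eval :: "'a alg \<Rightarrow> (nat \<Rightarrow> 'a) \<Rightarrow> trm \<Rightarrow> 'a" where
  "eval A \<rho> (Var i) = \<rho> i"
| "eval A \<rho> (App f ts) = oper A f (map (eval A \<rho>) ts)"

text \<open>
  An \<open>n\<close>-ary polynomial is a term operation in which all variables other than the first \<open>n\<close> are
  replaced by constants of the algebra; it is applied to argument lists of length \<open>n\<close>.
\<close>

definition polynomial :: "'a alg \<Rightarrow> nat \<Rightarrow> ('a list \<Rightarrow> 'a) \<Rightarrow> bool" where
  "polynomial A n p \<longleftrightarrow>
     (\<exists>t c. wf_trm (signature A) t \<and> range c \<subseteq> univ A \<and>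
        p = (\<lambda>xs. eval A (\<lambda>i. if i < n then xs ! i else c i) t))"


section \<open>Congruences and congruence modular varieties\<close>

definition congruence :: "'a alg \<Rightarrow> 'a rel \<Rightarrow> bool" where
  "congruence A \<theta> \<longleftrightarrow>
     equiv (univ A) \<theta> \<and>
     (\<forall>f < length (signature A). \<forall>xs ys.
        length xs = signature A ! f \<and> list_all2 (\<lambda>x y. (x, y) \<in> \<theta>) xs ys \<longrightarrow>
        (oper A f xs, oper A f ys) \<in> \<theta>)"

definition con_join :: "'a alg \<Rightarrow> 'a rel \<Rightarrow> 'a rel \<Rightarrow> 'a rel" where
  "con_join A \<alpha> \<beta> = \<Inter>{\<theta>. congruence A \<theta> \<and> \<alpha> \<union> \<beta> \<subseteq> \<theta>}"

definition congruence_modular :: "'a alg \<Rightarrow> bool" where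
  "congruence_modular A \<longleftrightarrow>
     (\<forall>\<alpha> \<beta> \<gamma>. congruence A \<alpha> \<and> congruence A \<beta> \<and> congruence A \<gamma> \<and> \<alpha> \<subseteq> \<gamma> \<longrightarrow>
        con_join A \<alpha> \<beta> \<inter> \<gamma> = con_join A \<alpha> (\<beta> \<inter> \<gamma>))"

text \<open>A variety is the class of all algebras satisfying a given set of identities.\<close>

definition variety :: "nat list \<Rightarrow> (trm \<times> trm) set \<Rightarrow> 'a alg set" where
  "variety sig \<Sigma> =
     {A. is_algebra A \<and> signature A = sig \<and>
         (\<forall>(s, t) \<in> \<Sigma>. \<forall>\<rho>. range \<rho> \<subseteq> univ A \<longrightarrow> eval A \<rho> s = eval A \<rho> t)}"

text \<open>
  HOL cannot quantify over algebras on arbitrary types inside a formula, so modularity is demanded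
  of those members of the variety whose universe is a set of natural numbers, that is (up to
  isomorphism) of its countable members. A hypothesis of this form is implied by the one that
  speaks about all members.
\<close>

definition in_congruence_modular_variety :: "'a alg \<Rightarrow> bool" where
  "in_congruence_modular_variety A \<longleftrightarrow>
     (\<exists>\<Sigma>. (\<forall>(s, t) \<in> \<Sigma>. wf_trm (signature A) s \<and> wf_trm (signature A) t) \<and>
          A \<in> variety (signature A) \<Sigma> \<and>
          (\<forall>B :: nat alg. B \<in> variety (signature A) \<Sigma> \<longrightarrow> congruence_modular B))"


section \<open>Higher commutators and supernilpotency\<close>

text \<open>
  \<open>centralizes A [\<alpha>\<^sub>1, \<dots>, \<alpha>\<^sub>k] \<beta> \<gamma>\<close> is the relation \<open>C(\<alpha>\<^sub>1, \<dots>, \<alpha>\<^sub>k, \<beta>; \<gamma>)\<close>.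
  The tuples in the product of the \<open>{a\<^sub>i, b\<^sub>i}\<close> are indexed by the set \<open>S\<close> of positions at which \<open>b\<^sub>i\<close>
  is chosen, so the excluded tuple is the choice of \<open>b\<^sub>i\<close> at every position, even if some \<open>a\<^sub>i\<close> and
  \<open>b\<^sub>i\<close> coincide.
\<close>

definition centralizes :: "'a alg \<Rightarrow> 'a rel list \<Rightarrow> 'a rel \<Rightarrow> 'a rel \<Rightarrow> bool" where
  "centralizes A \<alpha>s \<beta> \<gamma> \<longleftrightarrow>
     (let k = length \<alpha>s in
      \<forall>as bs u v f.
        length as = k \<and> length bs = k \<and>
        (\<forall>i < k. list_all2 (\<lambda>x y. (x, y) \<in> \<alpha>s ! i) (as ! i) (bs ! i)) \<and>
        list_all2 (\<lambda>x y. (x, y) \<in> \<beta>) u v \<and>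
        polynomial A (length (concat as) + length u) f \<and>
        (\<forall>S. S \<subset> {..<k} \<longrightarrow>
           (let x = concat (map (\<lambda>i. if i \<in> S then bs ! i else as ! i) [0..<k])
            in (f (x @ u), f (x @ v)) \<in> \<gamma>)) \<longrightarrow>
        (f (concat bs @ u), f (concat bs @ v)) \<in> \<gamma>)"

text \<open>\<open>commutator A [\<alpha>\<^sub>1, \<dots>, \<alpha>\<^sub>k] \<beta>\<close> is \<open>[\<alpha>\<^sub>1, \<dots>, \<alpha>\<^sub>k, \<beta>]\<close>.\<close>

definition commutator :: "'a alg \<Rightarrow> 'a rel list \<Rightarrow> 'a rel \<Rightarrow> 'a rel" where
  "commutator A \<alpha>s \<beta> = \<Inter>{\<gamma>. congruence A \<gamma> \<and> centralizes A \<alpha>s \<beta> \<gamma>}"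

definition one_con :: "'a alg \<Rightarrow> 'a rel" where
  "one_con A = univ A \<times> univ A"

definition zero_con :: "'a alg \<Rightarrow> 'a rel" where
  "zero_con A = Id_on (univ A)"

definition supernilpotent :: "'a alg \<Rightarrow> bool" where
  "supernilpotent A \<longleftrightarrow>
     (\<exists>k \<ge> 1. commutator A (replicate k (one_con A)) (one_con A) = zero_con A)"

lemma eval_closed:
  assumes "is_algebra A" "wf_trm (signature A) t" "range \<rho> \<subseteq> univ A"
  shows "eval A \<rho> t \<in> univ A"
  using assms(2)
proof (induction t)
  case (Var i)
  then show ?case using assms(3) by auto
next
  case (App f ts)
  then have "set (map (eval A \<rho>) ts) \<subseteq> univ A" by auto
  then show ?case using assms(1) App.prems by (simp add: is_algebra_def)
qed

lemma polynomial_closed: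
  assumes "is_algebra A" "polynomial A n p" "length xs = n" "set xs \<subseteq> univ A"
  shows "p xs \<in> univ A"
proof -
  obtain t c where t: "wf_trm (signature A) t" "range c \<subseteq> univ A"
    and p: "p = (\<lambda>xs. eval A (\<lambda>i. if i < n then xs ! i else c i) t)"
    using assms(2) by (auto simp: polynomial_def)
  have "range (\<lambda>i. if i < n then xs ! i else c i) \<subseteq> univ A"
    using t(2) assms(3,4) by (auto simp: subset_iff)
  then show ?thesis unfolding p using eval_closed[OF assms(1) t(1)] by blast
qed

text \<open>The intersection defining the commutator is indeed the least congruence of its kind.\<close>

lemma commutator_least:
  assumes A: "is_algebra A" and "\<forall>\<alpha> \<in> set \<alpha>s. congruence A \<alpha>" and "congruence A \<beta>"
  shows "congruence A (commutator A \<alpha>s \<beta>)"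
    and "centralizes A \<alpha>s \<beta> (commutator A \<alpha>s \<beta>)"
    and "congruence A \<gamma> \<Longrightarrow> centralizes A \<alpha>s \<beta> \<gamma> \<Longrightarrow> commutator A \<alpha>s \<beta> \<subseteq> \<gamma>"
proof -
  let ?G = "{\<gamma>. congruence A \<gamma> \<and> centralizes A \<alpha>s \<beta> \<gamma>}"
  have in_univ: "set xs \<subseteq> univ A \<and> set ys \<subseteq> univ A"
    if "list_all2 (\<lambda>x y. (x, y) \<in> \<theta>) xs ys" "congruence A \<theta>" for \<theta> xs ys
  proof -
    have "\<theta> \<subseteq> univ A \<times> univ A"
      using that(2) by (auto simp: congruence_def equiv_def)
    then show ?thesis
      using that(1) by (fastforce simp: list_all2_conv_all_nth in_set_conv_nth)
  qed
  have "congruence A (one_con A)"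
    unfolding congruence_def
  proof (intro conjI allI impI)
    show "equiv (univ A) (one_con A)"
      by (auto simp: one_con_def equiv_def refl_on_def sym_def trans_def)
  next
    fix f xs ys
    assume f: "f < length (signature A)"
      and h: "length xs = signature A ! f \<and> list_all2 (\<lambda>x y. (x, y) \<in> one_con A) xs ys"
    then have "set xs \<subseteq> univ A \<and> set ys \<subseteq> univ A"
      by (fastforce simp: one_con_def list_all2_conv_all_nth in_set_conv_nth)
    moreover have "length ys = signature A ! f" using h list_all2_lengthD by metis
    ultimately show "(oper A f xs, oper A f ys) \<in> one_con A"
      using A f h by (auto simp: is_algebra_def one_con_def)
  qed
  moreover have "centralizes A \<alpha>s \<beta> (one_con A)"
    unfolding centralizes_def Let_def
  proof (intro allI impI, elim conjE)
    fix as bs u v f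
    assume len: "length as = length \<alpha>s" "length bs = length \<alpha>s"
      and ab: "\<forall>i<length \<alpha>s. list_all2 (\<lambda>x y. (x, y) \<in> \<alpha>s ! i) (as ! i) (bs ! i)"
      and uv: "list_all2 (\<lambda>x y. (x, y) \<in> \<beta>) u v"
      and f: "polynomial A (length (concat as) + length u) f"
    have "map length as = map length bs"
      using len ab by (intro nth_equalityI) (auto simp: list_all2_conv_all_nth)
    then have "length (concat bs) = length (concat as)" by (simp add: length_concat)
    moreover have "length v = length u" using uv list_all2_lengthD by metis
    moreover have "set (concat bs) \<subseteq> univ A"
    proof -
      have "set (bs ! i) \<subseteq> univ A" if "i < length \<alpha>s" for i
        using in_univ[of "\<alpha>s ! i" "as ! i" "bs ! i"] ab that assms(2) by simp
      then have "\<forall>b \<in> set bs. set b \<subseteq> univ A"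
        using len by (metis in_set_conv_nth)
      then show ?thesis by auto
    qed
    ultimately show "(f (concat bs @ u), f (concat bs @ v)) \<in> one_con A"
      using in_univ[OF uv assms(3)] polynomial_closed[OF A f]
      by (simp add: one_con_def)
  qed
  ultimately have ne: "?G \<noteq> {}" by blast
  show "congruence A (commutator A \<alpha>s \<beta>)"
    unfolding congruence_def
  proof (intro conjI allI impI)
    have eq: "equiv (univ A) \<gamma>" if "\<gamma> \<in> ?G" for \<gamma>
      using that by (simp add: congruence_def)
    have "\<Inter>?G \<subseteq> univ A \<times> univ A"
    proof -
      obtain \<gamma> where "\<gamma> \<in> ?G" using ne by blast
      then show ?thesis using eq[of \<gamma>] unfolding equiv_def by blast
    qed
    moreover have "refl_on (univ A) (\<Inter>?G)"
      using eq unfolding equiv_def refl_on_def by blast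
    moreover have "sym (\<Inter>?G)"
      using eq unfolding equiv_def sym_def by blast
    moreover have "trans (\<Inter>?G)"
      using eq unfolding equiv_def trans_def by blast
    ultimately show "equiv (univ A) (commutator A \<alpha>s \<beta>)"
      by (simp add: equiv_def commutator_def)
  next
    fix f xs ys
    assume f: "f < length (signature A)"
      and h: "length xs = signature A ! f \<and> list_all2 (\<lambda>x y. (x, y) \<in> commutator A \<alpha>s \<beta>) xs ys"
    show "(oper A f xs, oper A f ys) \<in> commutator A \<alpha>s \<beta>"
      unfolding commutator_def
    proof
      fix \<gamma> assume "\<gamma> \<in> ?G"
      moreover from this have "list_all2 (\<lambda>x y. (x, y) \<in> \<gamma>) xs ys"
        using h by (auto simp: commutator_def elim: list_all2_mono)
      ultimately show "(oper A f xs, oper A f ys) \<in> \<gamma>"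
        using f h by (auto simp: congruence_def)
    qed
  qed
  show "centralizes A \<alpha>s \<beta> (commutator A \<alpha>s \<beta>)"
    unfolding centralizes_def Let_def
  proof (intro allI impI, elim conjE)
    fix as bs :: "'a list list" and u v f
    let ?x = "\<lambda>S. concat (map (\<lambda>i. if i \<in> S then bs ! i else as ! i) [0..<length \<alpha>s])"
    assume hyps: "length as = length \<alpha>s" "length bs = length \<alpha>s"
        "\<forall>i<length \<alpha>s. list_all2 (\<lambda>x y. (x, y) \<in> \<alpha>s ! i) (as ! i) (bs ! i)"
        "list_all2 (\<lambda>x y. (x, y) \<in> \<beta>) u v"
        "polynomial A (length (concat as) + length u) f"
      and S: "\<forall>S. S \<subset> {..<length \<alpha>s} \<longrightarrow> (f (?x S @ u), f (?x S @ v)) \<in> commutator A \<alpha>s \<beta>"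
    show "(f (concat bs @ u), f (concat bs @ v)) \<in> commutator A \<alpha>s \<beta>"
      unfolding commutator_def
    proof
      fix \<gamma> assume \<gamma>: "\<gamma> \<in> ?G"
      then have "\<forall>S. S \<subset> {..<length \<alpha>s} \<longrightarrow> (f (?x S @ u), f (?x S @ v)) \<in> \<gamma>"
        using S by (simp add: commutator_def)
      moreover have "centralizes A \<alpha>s \<beta> \<gamma>" using \<gamma> by simp
      ultimately show "(f (concat bs @ u), f (concat bs @ v)) \<in> \<gamma>"
        using hyps unfolding centralizes_def Let_def by presburger
    qed
  qed
  show "congruence A \<gamma> \<Longrightarrow> centralizes A \<alpha>s \<beta> \<gamma> \<Longrightarrow> commutator A \<alpha>s \<beta> \<subseteq> \<gamma>"
    by (auto simp: commutator_def)
qed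


section \<open>Circuits\<close>

text \<open>
  A gate is named by its position in the circuit; \<open>OpGate f js\<close> applies the basic operation \<open>f\<close> to
  the gates \<open>js\<close>. The order of the gates is arbitrary: it need not be a topological order of the
  underlying directed acyclic graph. Every \<open>InGate\<close> is a variable of its own (a variable is reused
  by letting several edges leave its gate).
\<close>

datatype 'a gate = InGate | ConstGate 'a | OpGate nat "nat list"

type_synonym 'a circuit = "'a gate list"

definition edges :: "'a circuit \<Rightarrow> nat rel" where
  "edges C = {(j, i). i < length C \<and> (\<exists>f js. C ! i = OpGate f js \<and> j \<in> set js)}"

fun valid_gate :: "'a alg \<Rightarrow> nat \<Rightarrow> 'a gate \<Rightarrow> bool" where
  "valid_gate A n InGate = True"
| "valid_gate A n (ConstGate a) = (a \<in> univ A)"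
| "valid_gate A n (OpGate f js) =
     (f < length (signature A) \<and> length js = signature A ! f \<and> (\<forall>j \<in> set js. j < n))"

definition is_circuit :: "'a alg \<Rightarrow> 'a circuit \<Rightarrow> bool" where
  "is_circuit A C \<longleftrightarrow> (\<forall>g \<in> set C. valid_gate A (length C) g) \<and> acyclic (edges C)"

text \<open>\<open>computes A C x i a\<close>: under the valuation \<open>x\<close> of the input gates, gate \<open>i\<close> has value \<open>a\<close>.\<close>

inductive computes :: "'a alg \<Rightarrow> 'a circuit \<Rightarrow> (nat \<Rightarrow> 'a) \<Rightarrow> nat \<Rightarrow> 'a \<Rightarrow> bool"
  for A C x where
  InGate: "i < length C \<Longrightarrow> C ! i = InGate \<Longrightarrow> computes A C x i (x i)"
| ConstGate: "i < length C \<Longrightarrow> C ! i = ConstGate a \<Longrightarrow> computes A C x i a"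
| OpGate: "i < length C \<Longrightarrow> C ! i = OpGate f js \<Longrightarrow> list_all2 (computes A C x) js as \<Longrightarrow>
    computes A C x i (oper A f as)"

lemma computes_unique:
  "computes A C x i a \<Longrightarrow> computes A C x i b \<Longrightarrow> a = b"
proof (induction arbitrary: b rule: computes.induct)
  case (OpGate i f js as)
  from OpGate.prems OpGate.hyps(2) obtain bs
    where b: "b = oper A f bs" and bs: "list_all2 (computes A C x) js bs"
    by (auto elim: computes.cases)
  have "as = bs"
    using OpGate.IH bs by (auto simp: list_all2_conv_all_nth intro!: nth_equalityI)
  then show ?case using b by simp
qed (auto elim: computes.cases)

lemma computes_exists:
  assumes A: "is_algebra A" and C: "is_circuit A C" and x: "range x \<subseteq> univ A"
  shows "i < length C \<Longrightarrow> \<exists>a \<in> univ A. computes A C x i a"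
proof -
  have valid: "valid_gate A (length C) (C ! i)" if "i < length C" for i
    using C that by (auto simp: is_circuit_def)
  have "edges C \<subseteq> {..<length C} \<times> {..<length C}"
  proof
    fix p assume "p \<in> edges C"
    then obtain j i f js where "p = (j, i)" "i < length C" "C ! i = OpGate f js" "j \<in> set js"
      by (auto simp: edges_def)
    then show "p \<in> {..<length C} \<times> {..<length C}" using valid[of i] by auto
  qed
  then have "finite (edges C)" by (rule finite_subset) simp
  then have "wf (edges C)" using C by (simp add: finite_acyclic_wf is_circuit_def)
  then show "i < length C \<Longrightarrow> \<exists>a \<in> univ A. computes A C x i a"
  proof (induction i rule: wf_induct_rule)
    case (less i)
    show ?case
    proof (cases "C ! i")
      case InGate
      then show ?thesis using less.prems x by (auto intro: computes.InGate)
    next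
      case (ConstGate a)
      then show ?thesis using less.prems valid[of i] by (auto intro: computes.ConstGate)
    next
      case (OpGate f js)
      then have f: "f < length (signature A)" "length js = signature A ! f"
        and js: "\<forall>j \<in> set js. j < length C"
        using valid[OF less.prems] by auto
      have "\<forall>j \<in> set js. \<exists>a. a \<in> univ A \<and> computes A C x j a"
        using less.IH js OpGate less.prems by (auto simp: edges_def)
      then obtain v where v: "\<forall>j \<in> set js. v j \<in> univ A \<and> computes A C x j (v j)"
        by metis
      then have "list_all2 (computes A C x) js (map v js)"
        by (simp add: list_all2_conv_all_nth)
      then have "computes A C x i (oper A f (map v js))"
        using OpGate less.prems by (intro computes.OpGate)
      moreover have "oper A f (map v js) \<in> univ A"
      proof -
        have "length (map v js) = signature A ! f" "set (map v js) \<subseteq> univ A"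
          using f v by auto
        then show ?thesis using A f(1) unfolding is_algebra_def by blast
      qed
      ultimately show ?thesis by blast
    qed
  qed
qed

type_synonym 'a csat_instance = "'a circuit \<times> nat \<times> nat"

definition csat_instance :: "'a alg \<Rightarrow> 'a csat_instance \<Rightarrow> bool" where
  "csat_instance A = (\<lambda>(C, g\<^sub>1, g\<^sub>2). is_circuit A C \<and> g\<^sub>1 < length C \<and> g\<^sub>2 < length C)"

definition csat_satisfiable :: "'a alg \<Rightarrow> 'a csat_instance \<Rightarrow> bool" where
  "csat_satisfiable A = (\<lambda>(C, g\<^sub>1, g\<^sub>2).
     \<exists>x a. range x \<subseteq> univ A \<and> computes A C x g\<^sub>1 a \<and> computes A C x g\<^sub>2 a)"

text \<open>
  Instances are presented to a machine as lists of numbers, where \<open>e\<close> numbers the elements of the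
  algebra. As the arity of each operation is fixed, the length of the list is linear in the number of gates.
\<close>

fun encode_gate :: "('a \<Rightarrow> nat) \<Rightarrow> 'a gate \<Rightarrow> nat list" where
  "encode_gate e InGate = [0]"
| "encode_gate e (ConstGate a) = [1, e a]"
| "encode_gate e (OpGate f js) = 2 # f # js"

definition encode_csat :: "('a \<Rightarrow> nat) \<Rightarrow> 'a csat_instance \<Rightarrow> nat list" where
  "encode_csat e = (\<lambda>(C, g\<^sub>1, g\<^sub>2). [length C, g\<^sub>1, g\<^sub>2] @ concat (map (encode_gate e) C))"


section \<open>Linear time Monte Carlo algorithms\<close>

text \<open>
  The machine model is a probabilistic random access machine: a fixed program, a bank of registers
  (of which a program can name only finitely many), and a memory addressed through registers.
  Every instruction takes unit time, and \<open>Flip r\<close> puts a fair random bit into register \<open>r\<close>. A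
  program that runs past its end halts with the answer ``no''.
\<close>

datatype instr =
    Const nat nat  \<comment> \<open>\<open>Const r n\<close>: \<open>r := n\<close>\<close>
  | Move nat nat  \<comment> \<open>\<open>Move r s\<close>: \<open>r := s\<close>\<close>
  | Add nat nat nat  \<comment> \<open>\<open>Add r s t\<close>: \<open>r := s + t\<close>\<close>
  | Sub nat nat nat  \<comment> \<open>\<open>Sub r s t\<close>: \<open>r := s - t\<close> (truncated)\<close>
  | Load nat nat  \<comment> \<open>\<open>Load r s\<close>: \<open>r := memory[s]\<close>\<close>
  | Store nat nat  \<comment> \<open>\<open>Store r s\<close>: \<open>memory[r] := s\<close>\<close>
  | Flip nat
  | Jump nat
  | JumpZero nat nat  \<comment> \<open>\<open>JumpZero r l\<close>: go to instruction \<open>l\<close> if \<open>r = 0\<close>\<close>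
  | Halt bool

datatype config =
    Running (pc: nat) (regs: "nat \<Rightarrow> nat") (memory: "nat \<Rightarrow> nat")
  | Halted (answer: bool)

fun exec :: "instr \<Rightarrow> nat \<Rightarrow> (nat \<Rightarrow> nat) \<Rightarrow> (nat \<Rightarrow> nat) \<Rightarrow> config pmf" where
  "exec (Const r n) i R M = return_pmf (Running (Suc i) (R(r := n)) M)"
| "exec (Move r s) i R M = return_pmf (Running (Suc i) (R(r := R s)) M)"
| "exec (Add r s t) i R M = return_pmf (Running (Suc i) (R(r := R s + R t)) M)"
| "exec (Sub r s t) i R M = return_pmf (Running (Suc i) (R(r := R s - R t)) M)"
| "exec (Load r s) i R M = return_pmf (Running (Suc i) (R(r := M (R s))) M)"
| "exec (Store r s) i R M = return_pmf (Running (Suc i) R (M(R r := R s)))"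
| "exec (Flip r) i R M =
     map_pmf (\<lambda>b. Running (Suc i) (R(r := of_bool b)) M) (bernoulli_pmf (1 / 2))"
| "exec (Jump l) i R M = return_pmf (Running l R M)"
| "exec (JumpZero r l) i R M = return_pmf (Running (if R r = 0 then l else Suc i) R M)"
| "exec (Halt b) i R M = return_pmf (Halted b)"

fun step :: "instr list \<Rightarrow> config \<Rightarrow> config pmf" where
  "step P (Running i R M) =
     (if i < length P then exec (P ! i) i R M else return_pmf (Halted False))"
| "step P (Halted b) = return_pmf (Halted b)"

text \<open>The input is placed in the first memory cells and its length in register \<open>0\<close>.\<close>

definition init_config :: "nat list \<Rightarrow> config" where
  "init_config w =
     Running 0 ((\<lambda>_. 0)(0 := length w)) (\<lambda>i. if i < length w then w ! i else 0)"

definition run :: "instr list \<Rightarrow> nat list \<Rightarrow> nat \<Rightarrow> config pmf" where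
  "run P w t = ((\<lambda>\<mu>. bind_pmf \<mu> (step P)) ^^ t) (return_pmf (init_config w))"

fun bounded_config :: "nat \<Rightarrow> config \<Rightarrow> bool" where
  "bounded_config m (Running i R M) = ((\<forall>r. R r \<le> m) \<and> (\<forall>j. M j \<le> m))"
| "bounded_config m (Halted b) = True"

text \<open>
  Program \<open>P\<close> is a linear time Monte Carlo algorithm with success probability \<open>c\<close> for the decision
  problem with the given instances, yes-instances and encoding of instances. On an input of \<open>n\<close>
  words every run halts within \<open>K n\<close> steps. So that the unit cost measure is realistic, no run
  may produce numbers above \<open>K n\<close>, that is, words have \<open>O(log n)\<close> bits.
\<close>

definition linear_time_monte_carlo ::
  "instr list \<Rightarrow> real \<Rightarrow> ('i \<Rightarrow> bool) \<Rightarrow> ('i \<Rightarrow> bool) \<Rightarrow> ('i \<Rightarrow> nat list) \<Rightarrow> bool" where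
  "linear_time_monte_carlo P c inst yes enc \<longleftrightarrow>
     (\<exists>K :: nat. \<forall>I. inst I \<longrightarrow>
        (let w = enc I; T = K * length w in
           (\<forall>t. \<forall>cfg \<in> set_pmf (run P w t). bounded_config T cfg) \<and>
           set_pmf (run P w T) \<subseteq> range Halted \<and>
           (yes I \<longrightarrow> pmf (run P w T) (Halted True) \<ge> c) \<and>
           (\<not> yes I \<longrightarrow> pmf (run P w T) (Halted True) = 0)))"

end

(*
  Let q be the order of the algebra, a power of a prime p. The algorithm draws a random valuation and
  evaluates the circuit. It has to be shown that satisfiable equations f = g have a constant fraction
  of solutions, for a product distribution that gives each element a positive probability.

  Congruence modularity provides Day operations and, from them, links between Gumm's operation
  p(x, z, z) and the constant x. If the map z -> p(x, z, z) had an orbit avoiding x, the links would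
  yield polynomial cubes of all dimensions with a single deviating corner, against supernilpotence.
  So iteration leads to a Maltsev operation m. The term condition shows likewise that a unary
  polynomial that arises from the identity by a change of constants is a permutation, and that these
  permutations form a nilpotent group. By m it is transitive, and as q is a power of p, the augmentation
  ideal of its group ring acts nilpotently on the functions with values in the integers modulo p.

  Now f(x) = M(x)(f(o)) with M(x)(z) = m(z, f(o), f(x)), and M(x) splits into a product of
  permutations each of which is trivial as soon as one of its variables agrees with o. By supernilpotence
  those factors depend on boundedly many variables each, and by nilpotence of the augmentation ideal the
  indicator function of f = g, modulo p, is a sum of functions of at most D variables, with D
  independent of f and g. If such a sum is not zero, then there is a set of at most D variables such
  that every valuation can be changed on this set to one where the sum does not vanish, that is, to a
  solution.
*)

theory Submission
  imports Defs "HOL-Combinatorics.Permutations" "HOL-Probability.Product_PMF"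
begin

section \<open>Polynomials and the term condition\<close>

text \<open>Supernilpotence is used in two forms only: a polynomial that takes one value on all
  corners of a cube but the top one takes it there too, and a chain of k polynomial steps cannot
  keep a pair apart if every step collapses it for some other parameters. The order of the algebra
  matters only when classes are counted: a central permutation of prime order acts freely on them,
  which forces this prime to be p, and then (w - 1)^p = w^p - 1 modulo p.

  Unless q is a power of 2, no bounded number of fair bits yields a uniform element. Density is
  therefore phrased as a change of at most D coordinates, which suits every product distribution:
  the program counts the ones among q - 1 bits, so at most D (q - 1) bits have to come out right,
  whatever the others are.

  Gates need not be listed in topological order, so evaluation is a depth first search with an
  explicit stack. The machine has no computed jumps; hence the operation tables become decision
  trees in the program text.\<close>

locale finite_algebra =
  fixes A :: "'a alg"
  assumes alg: "is_algebra A" and fin: "finite (univ A)"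
begin

definition vals :: "(nat \<Rightarrow> 'a) set" where
  "vals = {\<rho>. range \<rho> \<subseteq> univ A}"

text \<open>Valuations of infinitely many variables make substitution and renaming free of arities;
  \<open>pol_finite_support\<close> and \<open>pol_polynomial\<close> lead back to polynomials of a
  fixed arity.\<close>

inductive_set pol :: "((nat \<Rightarrow> 'a) \<Rightarrow> 'a) set" where
  var: "(\<lambda>\<rho>. \<rho> i) \<in> pol"
| const: "a \<in> univ A \<Longrightarrow> (\<lambda>\<rho>. a) \<in> pol"
| op: "f < length (signature A) \<Longrightarrow> length Fs = signature A ! f \<Longrightarrow> \<forall>F \<in> set Fs. F \<in> pol \<Longrightarrow>
    (\<lambda>\<rho>. oper A f (map (\<lambda>F. F \<rho>) Fs)) \<in> pol"

lemma ne: "univ A \<noteq> {}"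
  using alg by (simp add: is_algebra_def)

lemma vals_nth: "\<rho> \<in> vals \<Longrightarrow> \<rho> i \<in> univ A"
  by (auto simp: vals_def)

lemma valsI: "(\<And>i. \<rho> i \<in> univ A) \<Longrightarrow> \<rho> \<in> vals"
  by (auto simp: vals_def)

lemma vals_upd: "\<rho> \<in> vals \<Longrightarrow> a \<in> univ A \<Longrightarrow> \<rho>(i := a) \<in> vals"
  by (auto simp: vals_def)

lemma pol_closed: "F \<in> pol \<Longrightarrow> \<rho> \<in> vals \<Longrightarrow> F \<rho> \<in> univ A"
proof (induction rule: pol.induct)
  case (op f Fs)
  have "set (map (\<lambda>F. F \<rho>) Fs) \<subseteq> univ A" using op by auto
  moreover have "length (map (\<lambda>F. F \<rho>) Fs) = signature A ! f" using op by simp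
  ultimately show ?case using alg op(1) unfolding is_algebra_def by blast
qed (auto simp: vals_nth)

lemma pol_subst:
  assumes "F \<in> pol" "\<And>i. G i \<in> pol"
  shows "(\<lambda>\<rho>. F (\<lambda>i. G i \<rho>)) \<in> pol"
  using assms(1)
proof (induction rule: pol.induct)
  case (op f Fs)
  have "(\<lambda>\<rho>. oper A f (map (\<lambda>F. F \<rho>) (map (\<lambda>F \<rho>. F (\<lambda>i. G i \<rho>)) Fs))) \<in> pol"
    by (rule pol.op) (use op in auto)
  then show ?case by (simp add: comp_def)
qed (auto intro: pol.intros assms)

lemma pol_finite_support:
  assumes "F \<in> pol"
  shows "\<exists>n. \<forall>\<rho> \<rho>'. (\<forall>i<n. \<rho> i = \<rho>' i) \<longrightarrow> F \<rho> = F \<rho>'"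
  using assms
proof (induction rule: pol.induct)
  case (var i)
  then show ?case by (intro exI[of _ "Suc i"]) auto
next
  case (op f Fs)
  then obtain n where n: "\<forall>F \<in> set Fs. \<forall>\<rho> \<rho>'. (\<forall>i<n F. \<rho> i = \<rho>' i) \<longrightarrow> F \<rho> = F \<rho>'"
    by metis
  show ?case
  proof (intro exI[of _ "sum_list (map n Fs)"] allI impI)
    fix \<rho> \<rho>' :: "nat \<Rightarrow> 'a"
    assume h: "\<forall>i<sum_list (map n Fs). \<rho> i = \<rho>' i"
    have "F \<rho> = F \<rho>'" if "F \<in> set Fs" for F
    proof -
      have "n F \<le> sum_list (map n Fs)" using that by (simp add: member_le_sum_list)
      then show ?thesis using n that h by auto
    qed
    then have "map (\<lambda>F. F \<rho>) Fs = map (\<lambda>F. F \<rho>') Fs" by simp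
    then show "oper A f (map (\<lambda>F. F \<rho>) Fs) = oper A f (map (\<lambda>F. F \<rho>') Fs)"
      by (rule arg_cong)
  qed
qed simp

text \<open>All constants are drawn from one fixed enumeration, so that they need no renaming.\<close>

lemma pol_eval:
  assumes "F \<in> pol" "range en = univ A" "a0 \<in> univ A"
  shows "\<exists>t. wf_trm (signature A) t \<and>
    (\<forall>\<rho>. eval A (\<lambda>i. if i < n then \<rho> i else en (i - n)) t = F (\<lambda>i. if i < n then \<rho> i else a0))"
  using assms(1)
proof (induction rule: pol.induct)
  case (var i)
  \<comment> \<open>On the right-hand side a variable from n on reads the default a0, so its term
    has to be one with this constant value.\<close>
  obtain j where "en j = a0" using assms by (metis rangeE)
  then show ?case
    by (intro exI[of _ "if i < n then Var i else Var (n + j)"]) auto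
next
  case (const a)
  then obtain j where "en j = a" using assms by (metis rangeE)
  then show ?case by (auto intro!: exI[of _ "Var (n + j)"])
next
  case (op f Fs)
  then obtain T where T: "\<forall>F \<in> set Fs. wf_trm (signature A) (T F) \<and>
    (\<forall>\<rho>. eval A (\<lambda>i. if i < n then \<rho> i else en (i - n)) (T F) = F (\<lambda>i. if i < n then \<rho> i else a0))"
    by metis
  show ?case
    by (rule exI[of _ "App f (map T Fs)"]) (use op T in \<open>auto simp: comp_def cong: map_cong\<close>)
qed

lemma pol_polynomial:
  assumes "F \<in> pol" "a0 \<in> univ A"
  shows "\<exists>f. polynomial A n f \<and> (\<forall>xs. f xs = F (\<lambda>i. if i < n then xs ! i else a0))"
proof -
  obtain en :: "nat \<Rightarrow> 'a" where en: "range en = univ A"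
    using fin ne by (metis countable_finite uncountable_def)
  obtain t where t: "wf_trm (signature A) t"
    "\<And>\<rho>. eval A (\<lambda>i. if i < n then \<rho> i else en (i - n)) t = F (\<lambda>i. if i < n then \<rho> i else a0)"
    using pol_eval[OF assms(1) en assms(2)] by blast
  have "polynomial A n (\<lambda>xs. eval A (\<lambda>i. if i < n then xs ! i else en (i - n)) t)"
    unfolding polynomial_def by (rule exI[of _ t], rule exI[of _ "\<lambda>i. en (i - n)"]) (use t en in auto)
  then show ?thesis using t(2) by (intro exI[of _ "\<lambda>xs. eval A (\<lambda>i. if i < n then xs ! i else en (i - n)) t"]) simp
qed

end

section \<open>The term condition on coloured cubes\<close>

lemma concat_equal_length_nth:
  assumes "\<And>j. j < k \<Longrightarrow> length (g j) = n" "j < k" "i < n"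
  shows "concat (map g [0..<k]) ! (j * n + i) = g j ! i"
  using assms
proof (induction k)
  case (Suc k)
  have len: "length (concat (map g [0..<k])) = k * n"
    using Suc.prems(1) by (induction k) (auto simp: length_concat)
  show ?case
  proof (cases "j < k")
    case True
    have "j * n + i < Suc j * n" using Suc.prems by simp
    also have "\<dots> \<le> k * n" using True by (meson Suc_leI mult_le_mono1)
    finally show ?thesis using Suc True len by (simp add: nth_append)
  next
    case False
    then show ?thesis using Suc.prems len by (auto simp: nth_append less_Suc_eq)
  qed
qed simp

text \<open>Colours replace the argument blocks of the commutator condition: the blocks in S are
  moved from a to b. A variable whose colour never enters S stays at a.\<close>

definition mix :: "(nat \<Rightarrow> nat) \<Rightarrow> (nat \<Rightarrow> 'a) \<Rightarrow> (nat \<Rightarrow> 'a) \<Rightarrow> nat set \<Rightarrow> nat \<Rightarrow> 'a" where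
  "mix col a b S i = (if col i \<in> S then b i else a i)"

locale supernilpotent_algebra = finite_algebra +
  fixes k :: nat
  assumes k: "k \<ge> 1"
    and cent: "centralizes A (replicate k (one_con A)) (one_con A) (zero_con A)"
begin

lemma mix_vals: "a \<in> vals \<Longrightarrow> b \<in> vals \<Longrightarrow> mix col a b S \<in> vals"
  by (auto simp: vals_def mix_def)

text \<open>Colours below k are the blocks of parameters, colour k is the pair of tuples whose
  images coincide; modulo the zero congruence related means equal.\<close>

lemma term_condition:
  assumes F: "F \<in> pol" and a: "a \<in> vals" and b: "b \<in> vals"
    and S: "\<And>S. S \<subset> {..<k} \<Longrightarrow> F (mix col a b S) = F (mix col a b (insert k S))"
  shows "F (mix col a b {..<k}) = F (mix col a b {..k})"
proof -
  obtain n where n: "\<And>\<rho> \<rho>'. (\<forall>i<n. \<rho> i = \<rho>' i) \<Longrightarrow> F \<rho> = F \<rho>'"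
    using pol_finite_support[OF F] by blast
  \<comment> \<open>Every block carries a copy of all n relevant variables, so that the blocks are
    equally long; variable i reads the copy in the block of its colour. Colours above k are frozen
    at a.\<close>
  define F' where "F' \<rho> = F (\<lambda>i. if i < n \<and> col i \<le> k then \<rho> (col i * n + i) else a i)" for \<rho>
  have "(\<lambda>\<rho>. F (\<lambda>i. (if i < n \<and> col i \<le> k then (\<lambda>\<rho>. \<rho> (col i * n + i)) else (\<lambda>\<rho>. a i)) \<rho>)) \<in> pol"
    by (rule pol_subst[OF F]) (auto intro: pol.intros vals_nth[OF a])
  also have "(\<lambda>\<rho>. F (\<lambda>i. (if i < n \<and> col i \<le> k then (\<lambda>\<rho>. \<rho> (col i * n + i)) else (\<lambda>\<rho>. a i)) \<rho>)) = F'"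
    unfolding F'_def by (intro ext arg_cong[where f = F]) auto
  finally have F': "F' \<in> pol" .
  define N where "N = k * n + n"
  obtain f where f: "polynomial A N f" "\<And>xs. f xs = F' (\<lambda>i. if i < N then xs ! i else a 0)"
    using pol_polynomial[OF F' vals_nth[OF a, of 0]] by blast
  define as bs where "as = replicate k (map a [0..<n])" and "bs = replicate k (map b [0..<n])"
  define row where "row S j = (if j \<in> S then map b [0..<n] else map a [0..<n])" for S and j :: nat
  have val: "f (concat (map (row S) [0..<k]) @ row S k) = F (mix col a b S)" if S: "S \<subseteq> {..k}" for S
  proof -
    have "f (concat (map (row S) [0..<Suc k])) = F (mix col a b S)"
      unfolding f(2) F'_def
    proof (rule n, intro allI impI)
      fix i assume i: "i < n"
      show "(if i < n \<and> col i \<le> k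
          then if col i * n + i < N then concat (map (row S) [0..<Suc k]) ! (col i * n + i) else a 0
          else a i) = mix col a b S i"
      proof (cases "col i \<le> k")
        case True
        have "concat (map (row S) [0..<Suc k]) ! (col i * n + i) = row S (col i) ! i"
          by (rule concat_equal_length_nth) (use i True in \<open>auto simp: row_def\<close>)
        moreover have "col i * n + i < N"
          using i True by (metis N_def add_le_less_mono mult_le_mono1)
        ultimately show ?thesis using i True by (simp add: row_def mix_def)
      qed (use S in \<open>auto simp: mix_def\<close>)
    qed
    then show ?thesis by simp
  qed
  have rowU: "list_all2 (\<lambda>x y. (x, y) \<in> one_con A) (map a [0..<n]) (map b [0..<n])"
    using a b by (auto simp: list_all2_conv_all_nth one_con_def vals_nth)
  have ab: "length as = k" "length bs = k"
    "\<forall>i<k. list_all2 (\<lambda>x y. (x, y) \<in> replicate k (one_con A) ! i) (as ! i) (bs ! i)"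
    using rowU by (auto simp: as_def bs_def)
  have pf: "polynomial A (length (concat as) + length (map a [0..<n])) f"
    using f(1) by (simp add: as_def N_def length_concat sum_list_replicate)
  have rows: "map (\<lambda>i. if i \<in> S then bs ! i else as ! i) [0..<k] = map (row S) [0..<k]" for S
    by (auto simp: as_def bs_def row_def)
  have Sx: "(f (concat (map (\<lambda>i. if i \<in> S then bs ! i else as ! i) [0..<k]) @ map a [0..<n]),
      f (concat (map (\<lambda>i. if i \<in> S then bs ! i else as ! i) [0..<k]) @ map b [0..<n])) \<in> zero_con A"
    if S': "S \<subset> {..<k}" for S
  proof -
    have "map (row (insert k S)) [0..<k] = map (row S) [0..<k]" by (auto simp: row_def)
    moreover have "row S k = map a [0..<n]" "row (insert k S) k = map b [0..<n]"
      using S' by (auto simp: row_def)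
    moreover have "S \<subseteq> {..k}" "insert k S \<subseteq> {..k}" using S' by auto
    ultimately have "f (concat (map (row S) [0..<k]) @ map a [0..<n]) = F (mix col a b S)"
      "f (concat (map (row S) [0..<k]) @ map b [0..<n]) = F (mix col a b S)"
      using val[of S] val[of "insert k S"] S[OF S'] by metis+
    then show ?thesis
      using pol_closed[OF F mix_vals[OF a b]] unfolding rows by (simp add: zero_con_def Id_on_def)
  qed
  have cc: "(f (concat bs @ map a [0..<n]), f (concat bs @ map b [0..<n])) \<in> zero_con A"
    using cent unfolding centralizes_def Let_def length_replicate
    using ab rowU pf Sx by blast
  have bsr: "concat bs = concat (map (row {..<k}) [0..<k])" "concat bs = concat (map (row {..k}) [0..<k])"
    unfolding bs_def by (rule arg_cong[where f = concat], rule nth_equalityI; simp add: row_def)+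
  have less_imp_le_set: "{..<k} \<subseteq> {..k}" by auto
  have "row {..<k} k = map a [0..<n]" "row {..k} k = map b [0..<n]" by (auto simp: row_def)
  then show ?thesis
    using cc val[of "{..<k}", OF less_imp_le_set] val[of "{..k}"] bsr by (auto simp: zero_con_def Id_on_def)
qed

text \<open>Two corners that differ only in colour k both lie below the top one, except for the last
  such pair. The term condition transfers equality to that pair, whose lower member has value
  c.\<close>

lemma absorbing_trivial:
  assumes F: "F \<in> pol" and a: "a \<in> vals" and b: "b \<in> vals"
    and S: "\<And>S. S \<subset> {..k} \<Longrightarrow> F (mix col a b S) = c"
  shows "F (mix col a b {..k}) = c"
proof -
  have "F (mix col a b {..<k}) = F (mix col a b {..k})"
  proof (rule term_condition[OF F a b])
    fix S assume S': "S \<subset> {..<k}"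
    then obtain j where "j < k" "j \<notin> S" by auto
    then have "S \<subset> {..k}" "insert k S \<subset> {..k}" using S' by auto
    then show "F (mix col a b S) = F (mix col a b (insert k S))" using S by metis
  qed
  moreover have "{..<k} \<subset> {..k}" by auto
  ultimately show ?thesis using S by metis
qed

text \<open>The composite of the steps collapses the pair \<open>(u 0, v 0)\<close> unless all parameters take their
  values in \<open>y1\<close>, so the term condition makes it collapse there as well.\<close>

lemma no_separating_chain:
  assumes g: "\<And>j. j < k \<Longrightarrow> g j \<in> pol"
    and y: "\<And>j. y0 j \<in> vals" "\<And>j. y1 j \<in> vals"
    and uv: "u 0 \<in> univ A" "v 0 \<in> univ A"
    and eq: "\<And>j. j < k \<Longrightarrow> g j ((y0 j)(0 := u j)) = g j ((y0 j)(0 := v j))"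
    and u: "\<And>j. j < k \<Longrightarrow> g j ((y1 j)(0 := u j)) = u (Suc j)"
    and v: "\<And>j. j < k \<Longrightarrow> g j ((y1 j)(0 := v j)) = v (Suc j)"
  shows "u k = v k"
proof -
  define w where "w = Suc k"
  have kw: "k < w" by (simp add: w_def)
  \<comment> \<open>Step j takes the result of the previous step as variable 0 and reads its
    parameter i at position \<open>i * w + j\<close>, so colours are residues modulo w. Position k
    has colour k and is nobody's parameter; it holds the pair.\<close>
  define H where "H = rec_nat (\<lambda>\<rho>. \<rho> k)
    (\<lambda>j h \<rho>. g j (\<lambda>i. if i = 0 then h \<rho> else \<rho> (i * w + j)))"
  have H0: "H 0 = (\<lambda>\<rho>. \<rho> k)" and HS: "H (Suc j) = (\<lambda>\<rho>. g j (\<lambda>i. if i = 0 then H j \<rho> else \<rho> (i * w + j)))" for j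
    unfolding H_def by simp_all
  have H: "j \<le> k \<Longrightarrow> H j \<in> pol" for j
  proof (induction j)
    case (Suc j)
    then have "(\<lambda>\<rho>. g j (\<lambda>i. (if i = 0 then H j else (\<lambda>\<rho>. \<rho> (i * w + j))) \<rho>)) \<in> pol"
      by (intro pol_subst[OF g]) (auto intro: pol.var)
    then show ?case by (simp add: HS if_distrib[where f = "\<lambda>h. h _"] cong: if_cong)
  qed (simp add: H0 pol.var)
  define col where "col i = i mod w" for i
  define a where "a i = (if i = k then u 0 else y0 (i mod w) (i div w))" for i
  define b where "b i = (if i = k then v 0 else y1 (i mod w) (i div w))" for i
  have ab: "a \<in> vals" "b \<in> vals"
    using y uv by (auto intro!: valsI simp: a_def b_def vals_nth)
  have step: "(\<lambda>i. if i = 0 then h else mix col a b S (i * w + j)) = (if j \<in> S then y1 j else y0 j)(0 := h)"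
    if "j < k" for h S j
  proof
    fix i
    have "i * w + j \<noteq> k"
    proof (cases i)
      case (Suc i')
      have "w \<le> i * w" by (simp add: Suc)
      then show ?thesis using kw by linarith
    qed (use that in simp)
    moreover have "(i * w + j) mod w = j" "(i * w + j) div w = i"
      using that kw by auto
    ultimately show "(if i = 0 then h else mix col a b S (i * w + j)) = ((if j \<in> S then y1 j else y0 j)(0 := h)) i"
      by (auto simp: mix_def col_def a_def b_def)
  qed
  \<comment> \<open>While all steps so far have parameters from \<open>y1\<close>, the two values
    are \<open>u j\<close> and \<open>v j\<close>; a single step with \<open>y0\<close> makes them
    equal for good.\<close>
  have val: "(if {..<j} \<subseteq> S then H j (mix col a b S) = u j \<and> H j (mix col a b (insert k S)) = v j
      else H j (mix col a b S) = H j (mix col a b (insert k S)))" if "j \<le> k" "S \<subseteq> {..<k}" for j S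
    using that(1)
  proof (induction j)
    case 0
    then show ?case using that(2) by (auto simp: H0 mix_def col_def a_def b_def w_def)
  next
    case (Suc j)
    then have j: "j < k" by simp
    have IH: "if {..<j} \<subseteq> S then H j (mix col a b S) = u j \<and> H j (mix col a b (insert k S)) = v j
        else H j (mix col a b S) = H j (mix col a b (insert k S))"
      using Suc by simp
    have HS': "H (Suc j) (mix col a b S) = g j ((if j \<in> S then y1 j else y0 j)(0 := H j (mix col a b S)))"
      "H (Suc j) (mix col a b (insert k S)) =
        g j ((if j \<in> S then y1 j else y0 j)(0 := H j (mix col a b (insert k S))))"
      unfolding HS step[OF j] using j by simp_all
    show ?case
    proof (cases "{..<j} \<subseteq> S")
      case True
      then have "{..<Suc j} \<subseteq> S \<longleftrightarrow> j \<in> S" by (auto simp: lessThan_Suc)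
      then show ?thesis using True IH eq[OF j] u[OF j] v[OF j] unfolding HS' by auto
    next
      case False
      then have "\<not> {..<Suc j} \<subseteq> S" by (auto simp: lessThan_Suc)
      then show ?thesis using False IH unfolding HS' by simp
    qed
  qed
  have "H k (mix col a b {..<k}) = H k (mix col a b {..k})"
  proof (rule term_condition[OF H ab])
    fix S assume "S \<subset> {..<k}"
    then show "H k (mix col a b S) = H k (mix col a b (insert k S))"
      using val[of k S] by (auto split: if_splits)
  qed simp
  moreover have "insert k {..<k} = {..k}" by auto
  ultimately show ?thesis using val[of k "{..<k}"] by auto
qed

end

section \<open>Day and Maltsev operations\<close>

lemma list_all2_relcomp:
  assumes "list_all2 (\<lambda>x y. (x, y) \<in> R O S) xs ys"
  shows "\<exists>zs. list_all2 (\<lambda>x y. (x, y) \<in> R) xs zs \<and> list_all2 (\<lambda>x y. (x, y) \<in> S) zs ys"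
  using assms
proof (induction rule: list_all2_induct)
  case (Cons x xs y ys)
  then obtain z zs where "(x, z) \<in> R" "(z, y) \<in> S"
    "list_all2 (\<lambda>x y. (x, y) \<in> R) xs zs" "list_all2 (\<lambda>x y. (x, y) \<in> S) zs ys"
    by blast
  then show ?case by (intro exI[of _ "z # zs"]) simp
qed simp

definition compatible :: "'a alg \<Rightarrow> 'a rel \<Rightarrow> bool" where
  "compatible A R \<longleftrightarrow> (\<forall>f < length (signature A). \<forall>xs ys.
     length xs = signature A ! f \<and> list_all2 (\<lambda>x y. (x, y) \<in> R) xs ys \<longrightarrow>
     (oper A f xs, oper A f ys) \<in> R)"

lemma congruence_iff: "congruence A \<theta> \<longleftrightarrow> equiv (univ A) \<theta> \<and> compatible A \<theta>"
  by (simp add: congruence_def compatible_def)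

lemma compatible_relcomp:
  assumes "compatible A R" "compatible A S"
  shows "compatible A (R O S)"
  unfolding compatible_def
proof (intro allI impI, elim conjE)
  fix f xs ys
  assume f: "f < length (signature A)" and xs: "length xs = signature A ! f"
    and "list_all2 (\<lambda>x y. (x, y) \<in> R O S) xs ys"
  then obtain zs where zs: "list_all2 (\<lambda>x y. (x, y) \<in> R) xs zs" "list_all2 (\<lambda>x y. (x, y) \<in> S) zs ys"
    using list_all2_relcomp by blast
  moreover have "length zs = signature A ! f" using zs(1) xs list_all2_lengthD by metis
  ultimately have "(oper A f xs, oper A f zs) \<in> R" "(oper A f zs, oper A f ys) \<in> S"
    using assms f xs unfolding compatible_def by blast+
  then show "(oper A f xs, oper A f ys) \<in> R O S" by blast
qed

text \<open>The positive powers of \<open>\<alpha> O \<beta>\<close> increase by reflexivity, and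
  their union is a congruence above both relations, so it contains the join.\<close>

lemma con_join_chain:
  assumes \<alpha>: "congruence A \<alpha>" and \<beta>: "congruence A \<beta>" and xy: "(x, y) \<in> con_join A \<alpha> \<beta>"
  shows "\<exists>n. (x, y) \<in> (\<alpha> O \<beta>) ^^ n"
proof -
  let ?R = "\<alpha> O \<beta>"
  define \<theta> where "\<theta> = (\<Union>n. ?R ^^ Suc n)"
  have ea: "equiv (univ A) \<alpha>" and eb: "equiv (univ A) \<beta>" using assms by (auto simp: congruence_iff)
  have sub: "\<alpha> \<subseteq> univ A \<times> univ A" "\<beta> \<subseteq> univ A \<times> univ A" using ea eb by (auto simp: equiv_def)
  have ra: "x \<in> univ A \<Longrightarrow> (x, x) \<in> \<alpha>" and rb: "x \<in> univ A \<Longrightarrow> (x, x) \<in> \<beta>" for x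
    using ea eb by (auto simp: equiv_def refl_on_def)
  have pow_sub: "?R ^^ Suc n \<subseteq> univ A \<times> univ A" for n
    using sub by (induction n) auto
  have step: "?R ^^ Suc n \<subseteq> ?R ^^ Suc (Suc n)" for n
  proof
    fix p assume p: "p \<in> ?R ^^ Suc n"
    obtain x y where [simp]: "p = (x, y)" by force
    have "(y, y) \<in> ?R" using p pow_sub[of n] ra[of y] rb[of y] by auto
    then show "p \<in> ?R ^^ Suc (Suc n)" using p by auto
  qed
  have mono: "n \<le> m \<Longrightarrow> ?R ^^ Suc n \<subseteq> ?R ^^ Suc m" for n m
    by (induction m rule: dec_induct) (use step in blast)+
  have "refl_on (univ A) \<theta>"
    unfolding refl_on_def
  proof
    fix x assume "x \<in> univ A"
    then have "(x, x) \<in> ?R ^^ Suc 0" using ra rb by auto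
    then show "(x, x) \<in> \<theta>" unfolding \<theta>_def by blast
  qed
  moreover have "sym \<theta>"
  proof (rule symI)
    fix x y assume "(x, y) \<in> \<theta>"
    then obtain n where n: "(x, y) \<in> ?R ^^ Suc n" unfolding \<theta>_def by blast
    have sa: "\<alpha>\<inverse> = \<alpha>" "\<beta>\<inverse> = \<beta>" using ea eb by (auto simp: equiv_def sym_conv_converse_eq)
    have conv: "(y, x) \<in> (\<beta> O \<alpha>) ^^ Suc n" if "(x, y) \<in> ?R ^^ Suc n" for x y n
    proof -
      have "(?R ^^ m)\<inverse> = (\<beta> O \<alpha>) ^^ m" for m
        by (induction m) (auto simp: converse_relcomp sa relpow_commute)
      then show ?thesis using that by blast
    qed
    \<comment> \<open>Converses of the powers are powers of \<open>\<beta> O \<alpha>\<close>.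
      Padding with \<alpha> on the left and \<beta> on the right, which reflexivity allows, turns
      them back into powers of \<open>\<alpha> O \<beta>\<close>.\<close>
    have shift: "\<alpha> O ((\<beta> O \<alpha>) ^^ m) O \<beta> \<subseteq> ?R ^^ Suc m" for m
    proof (induction m)
      case (Suc m)
      have "\<alpha> O ((\<beta> O \<alpha>) ^^ Suc m) O \<beta> = (\<alpha> O ((\<beta> O \<alpha>) ^^ m) O \<beta>) O ?R" by (auto simp: O_assoc)
      also have "\<dots> \<subseteq> ?R ^^ Suc m O ?R" using Suc by blast
      finally show ?case by simp
    qed auto
    have "(y, x) \<in> (\<beta> O \<alpha>) ^^ Suc n" using conv n by blast
    moreover have "x \<in> univ A" "y \<in> univ A" using n pow_sub by blast+
    ultimately have "(y, x) \<in> \<alpha> O ((\<beta> O \<alpha>) ^^ Suc n) O \<beta>" using ra rb by blast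
    then show "(y, x) \<in> \<theta>" using shift[of "Suc n"] unfolding \<theta>_def by blast
  qed
  moreover have "trans \<theta>"
  proof (rule transI)
    fix x y z assume "(x, y) \<in> \<theta>" "(y, z) \<in> \<theta>"
    then obtain n m where "(x, y) \<in> ?R ^^ Suc n" "(y, z) \<in> ?R ^^ Suc m" unfolding \<theta>_def by blast
    then have "(x, z) \<in> ?R ^^ (Suc n + Suc m)" unfolding relpow_add by blast
    then show "(x, z) \<in> \<theta>" unfolding \<theta>_def by (simp del: relpow.simps) blast
  qed
  moreover have "\<theta> \<subseteq> univ A \<times> univ A" unfolding \<theta>_def using pow_sub by blast
  ultimately have eq: "equiv (univ A) \<theta>" by (simp add: equiv_def)
  have cpow: "compatible A (?R ^^ Suc n)" for n
  proof (induction n)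
    case 0
    then show ?case using assms by (auto simp: congruence_iff intro: compatible_relcomp)
  next
    case (Suc n)
    then have "compatible A (?R ^^ Suc n O ?R)"
      using assms by (intro compatible_relcomp) (auto simp: congruence_iff)
    then show ?case by simp
  qed
  have "compatible A \<theta>"
    unfolding compatible_def
  proof (intro allI impI, elim conjE)
    fix f xs ys
    assume f: "f < length (signature A)" and xs: "length xs = signature A ! f"
      and h: "list_all2 (\<lambda>x y. (x, y) \<in> \<theta>) xs ys"
    \<comment> \<open>There are only finitely many arguments and the powers increase, so one power
      serves all of them.\<close>
    from h have "\<exists>n. list_all2 (\<lambda>x y. (x, y) \<in> ?R ^^ Suc n) xs ys"
    proof (induction rule: list_all2_induct)
      case (Cons x xs y ys)
      then obtain n m where nm: "(x, y) \<in> ?R ^^ Suc n" "list_all2 (\<lambda>x y. (x, y) \<in> ?R ^^ Suc m) xs ys"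
        unfolding \<theta>_def by blast
      then have "(x, y) \<in> ?R ^^ Suc (max n m)" using mono[of n "max n m"] by auto
      moreover have "list_all2 (\<lambda>x y. (x, y) \<in> ?R ^^ Suc (max n m)) xs ys"
        using nm(2) by (rule list_all2_mono) (use mono[of m "max n m"] in auto)
      ultimately show ?case by blast
    qed simp
    then obtain n where "list_all2 (\<lambda>x y. (x, y) \<in> ?R ^^ Suc n) xs ys" by blast
    then have "(oper A f xs, oper A f ys) \<in> ?R ^^ Suc n"
      using cpow f xs unfolding compatible_def by blast
    then show "(oper A f xs, oper A f ys) \<in> \<theta>" unfolding \<theta>_def by blast
  qed
  then have "congruence A \<theta>" using eq by (simp add: congruence_iff)
  moreover have "\<alpha> \<union> \<beta> \<subseteq> \<theta>"
  proof -
    have "\<alpha> \<union> \<beta> \<subseteq> ?R" using sub ra rb by blast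
    then have "\<alpha> \<union> \<beta> \<subseteq> ?R ^^ Suc 0" by simp
    then show ?thesis unfolding \<theta>_def by blast
  qed
  ultimately have "(x, y) \<in> \<theta>" using xy by (auto simp: con_join_def)
  then show ?thesis unfolding \<theta>_def by blast
qed

section \<open>Day operations from modularity\<close>

definition pt :: "'a \<Rightarrow> 'a \<Rightarrow> 'a \<Rightarrow> 'a \<Rightarrow> nat \<Rightarrow> 'a" where
  "pt a b c d i = (if i = 0 then a else if i = 1 then b else if i = 2 then c else d)"

context finite_algebra
begin

definition op4 :: "('a \<Rightarrow> 'a \<Rightarrow> 'a \<Rightarrow> 'a \<Rightarrow> 'a) \<Rightarrow> bool" where
  "op4 f \<longleftrightarrow> (\<exists>t. wf_trm (signature A) t \<and> f = (\<lambda>a b c d. eval A (pt a b c d) t))"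

text \<open>Day terms: modularity is applied to the clone of quaternary term operations, seen as a
  subalgebra of a finite power of the algebra, and to the kernels of the restrictions to the
  tuples of the forms \<open>(x, x, u, u)\<close>, \<open>(x, y, y, x)\<close> and \<open>(x, y, y, u)\<close>.\<close>

lemma day_operations:
  assumes "in_congruence_modular_variety A"
  shows "\<exists>n c d. (\<forall>i\<le>n. op4 (c i) \<and> op4 (d i)) \<and>
    (\<forall>x\<in>univ A. \<forall>y\<in>univ A. \<forall>z\<in>univ A. \<forall>u\<in>univ A.
      c 0 x y z u = x \<and> c n x y z u = u \<and>
      (\<forall>i\<le>n. c i x y y x = x \<and> d i x y y x = x) \<and>
      (\<forall>i<n. c i x x u u = d i x x u u \<and> d i x y y u = c (Suc i) x y y u))"
proof -
  let ?U = "univ A" and ?sg = "signature A"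
  obtain \<Sigma> where \<Sigma>: "\<forall>(s, t) \<in> \<Sigma>. wf_trm ?sg s \<and> wf_trm ?sg t" "A \<in> variety ?sg \<Sigma>"
    "\<And>B :: nat alg. B \<in> variety ?sg \<Sigma> \<Longrightarrow> congruence_modular B"
    using assms by (auto simp: in_congruence_modular_variety_def)
  define T where "T = ?U \<times> ?U \<times> ?U \<times> ?U"
  define tf where "tf t = (\<lambda>(a, b, c, d)\<in>T. eval A (pt a b c d) t)" for t
  define Cl where "Cl = tf ` {t. wf_trm ?sg t}"
  have ptU: "range (pt a b c d) \<subseteq> ?U" if "(a, b, c, d) \<in> T" for a b c d
    using that by (auto simp: pt_def T_def)
  have tfU: "tf t \<in> T \<rightarrow>\<^sub>E ?U" if "wf_trm ?sg t" for t
    using eval_closed[OF alg that ptU] by (auto simp: tf_def)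
  have "finite T" using fin by (simp add: T_def)
  then have "finite (T \<rightarrow>\<^sub>E ?U)" using fin by (intro finite_PiE) auto
  moreover have "Cl \<subseteq> T \<rightarrow>\<^sub>E ?U" unfolding Cl_def using tfU by blast
  ultimately have finCl: "finite Cl" by (rule finite_subset[rotated])
  \<comment> \<open>Modularity is assumed for algebras on natural numbers only, so the finite clone
    is transported along an injection into them.\<close>
  obtain \<phi> :: "('a \<times> 'a \<times> 'a \<times> 'a \<Rightarrow> 'a) \<Rightarrow> nat" where \<phi>: "inj_on \<phi> Cl"
    using finite_imp_inj_to_nat_seg[OF finCl] by blast
  define \<psi> where "\<psi> = inv_into Cl \<phi>"
  have \<psi>\<phi>: "h \<in> Cl \<Longrightarrow> \<psi> (\<phi> h) = h" for h using \<phi> by (simp add: \<psi>_def)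
  define B :: "nat alg" where "B = \<lparr>signature = ?sg, univ = \<phi> ` Cl,
    oper = (\<lambda>f xs. \<phi> (\<lambda>\<tau>\<in>T. oper A f (map (\<lambda>x. \<psi> x \<tau>) xs)))\<rparr>"
  have B: "signature B = ?sg" "univ B = \<phi> ` Cl" by (simp_all add: B_def)
  have \<psi>Cl: "x \<in> univ B \<Longrightarrow> \<psi> x \<in> Cl" for x using \<psi>\<phi> by (auto simp: B)
  have \<phi>\<psi>: "x \<in> univ B \<Longrightarrow> \<phi> (\<psi> x) = x" for x using \<psi>\<phi> by (auto simp: B)
  have opCl: "(\<lambda>\<tau>\<in>T. oper A f (map (\<lambda>x. \<psi> x \<tau>) xs)) \<in> Cl"
    if f: "f < length ?sg" and xs: "length xs = ?sg ! f" "set xs \<subseteq> univ B" for f xs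
  proof -
    have "\<forall>x \<in> set xs. \<exists>t. wf_trm ?sg t \<and> \<psi> x = tf t"
      using xs(2) \<psi>Cl by (fastforce simp: Cl_def)
    then obtain t where t: "\<forall>x \<in> set xs. wf_trm ?sg (t x) \<and> \<psi> x = tf (t x)" by metis
    have "(\<lambda>\<tau>\<in>T. oper A f (map (\<lambda>x. \<psi> x \<tau>) xs)) = tf (App f (map t xs))"
      unfolding tf_def
    proof (rule restrict_ext)
      fix \<tau> assume \<tau>: "\<tau> \<in> T"
      obtain a b c d where [simp]: "\<tau> = (a, b, c, d)" by (metis prod_cases4)
      have "map (\<lambda>x. \<psi> x \<tau>) xs = map (eval A (pt a b c d) \<circ> t) xs"
        using t \<tau> by (auto simp: tf_def)
      then show "oper A f (map (\<lambda>x. \<psi> x \<tau>) xs) = (case \<tau> of (a, b, c, d) \<Rightarrow> eval A (pt a b c d) (App f (map t xs)))"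
        by (simp del: map_eq_conv)
    qed
    moreover have "wf_trm ?sg (App f (map t xs))" using f xs t by auto
    ultimately show ?thesis unfolding Cl_def by blast
  qed
  have operB: "oper B f xs \<in> univ B" "\<tau> \<in> T \<Longrightarrow> \<psi> (oper B f xs) \<tau> = oper A f (map (\<lambda>x. \<psi> x \<tau>) xs)"
    if "f < length ?sg" "length xs = ?sg ! f" "set xs \<subseteq> univ B" for f xs \<tau>
    using opCl[OF that] \<psi>\<phi>[OF opCl[OF that]] by (auto simp: B_def)
  have Var: "tf (Var i) \<in> Cl" for i by (auto simp: Cl_def)
  have algB: "is_algebra B"
    using operB(1) Var[of 0] by (auto simp: is_algebra_def B)
  have evalB: "\<psi> (eval B \<rho> t) \<tau> = eval A (\<lambda>i. \<psi> (\<rho> i) \<tau>) t"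
    if "wf_trm ?sg t" "range \<rho> \<subseteq> univ B" "\<tau> \<in> T" for \<rho> t \<tau>
    using that(1)
  proof (induction t)
    case (App f ts)
    have "set (map (eval B \<rho>) ts) \<subseteq> univ B"
      using App.prems eval_closed[OF algB _ that(2)] by (auto simp: B(1))
    then have "\<psi> (eval B \<rho> (App f ts)) \<tau> = oper A f (map (\<lambda>x. \<psi> x \<tau>) (map (eval B \<rho>) ts))"
      unfolding eval.simps using App.prems that(3) by (intro operB) auto
    moreover have "map (\<lambda>x. \<psi> x \<tau>) (map (eval B \<rho>) ts) = map (eval A (\<lambda>i. \<psi> (\<rho> i) \<tau>)) ts"
      using App by auto
    ultimately show ?case by (simp del: map_eq_conv)
  qed simp
  have Clext: "h \<in> Cl \<Longrightarrow> h \<in> extensional T" for h by (auto simp: Cl_def tf_def)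
  have extB: "x = y" if "x \<in> univ B" "y \<in> univ B" "\<And>\<tau>. \<tau> \<in> T \<Longrightarrow> \<psi> x \<tau> = \<psi> y \<tau>" for x y
  proof -
    have "\<psi> x = \<psi> y" using that Clext \<psi>Cl by (intro extensionalityI[of _ T]) auto
    then show ?thesis using that \<phi>\<psi> by metis
  qed
  have "B \<in> variety ?sg \<Sigma>"
    unfolding variety_def
  proof (intro CollectI conjI algB B(1) ballI, clarify)
    fix s t and \<rho> :: "nat \<Rightarrow> nat" assume st: "(s, t) \<in> \<Sigma>" and \<rho>: "range \<rho> \<subseteq> univ B"
    then have wf: "wf_trm ?sg s" "wf_trm ?sg t" using \<Sigma>(1) by auto
    show "eval B \<rho> s = eval B \<rho> t"
    proof (rule extB)
      fix \<tau> assume \<tau>: "\<tau> \<in> T"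
      have "\<psi> (\<rho> i) \<in> T \<rightarrow>\<^sub>E ?U" for i
      proof -
        have "\<rho> i \<in> univ B" using \<rho> by auto
        then obtain t where "wf_trm ?sg t" "\<psi> (\<rho> i) = tf t" using \<psi>Cl unfolding Cl_def by blast
        then show ?thesis using tfU by simp
      qed
      then have "range (\<lambda>i. \<psi> (\<rho> i) \<tau>) \<subseteq> ?U" using \<tau> by (auto simp: PiE_iff)
      then show "\<psi> (eval B \<rho> s) \<tau> = \<psi> (eval B \<rho> t) \<tau>"
        using \<Sigma>(2) st \<tau> by (auto simp: evalB[OF wf(1) \<rho>] evalB[OF wf(2) \<rho>] variety_def)
    qed (use eval_closed[OF algB _ \<rho>] wf B in auto)
  qed
  then have mod: "congruence_modular B" by (rule \<Sigma>(3))
  define ker where "ker S = {(x, y). x \<in> univ B \<and> y \<in> univ B \<and> (\<forall>\<tau>\<in>S. \<psi> x \<tau> = \<psi> y \<tau>)}" for S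
  have ker: "congruence B (ker S)" if S: "S \<subseteq> T" for S
    unfolding congruence_iff
  proof
    show "equiv (univ B) (ker S)"
      by (auto simp: ker_def equiv_def refl_on_def sym_def trans_def)
    show "compatible B (ker S)"
      unfolding compatible_def
    proof (intro allI impI, elim conjE)
      fix f xs ys
      assume f: "f < length (signature B)" and xs: "length xs = signature B ! f"
        and h: "list_all2 (\<lambda>x y. (x, y) \<in> ker S) xs ys"
      have ys: "length ys = signature B ! f" using h xs list_all2_lengthD by metis
      have sub: "set xs \<subseteq> univ B" "set ys \<subseteq> univ B"
        using h by (fastforce simp: ker_def list_all2_conv_all_nth in_set_conv_nth)+
      have "map (\<lambda>x. \<psi> x \<tau>) xs = map (\<lambda>x. \<psi> x \<tau>) ys" if "\<tau> \<in> S" for \<tau>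
        using h that by (intro nth_equalityI) (auto simp: ker_def list_all2_conv_all_nth)
      then show "(oper B f xs, oper B f ys) \<in> ker S"
        using f xs ys sub operB S by (auto simp: ker_def B(1) subset_iff simp del: map_eq_conv)
    qed
  qed
  define \<alpha> \<beta> \<gamma> where "\<alpha> = ker {(x, x, u, u) | x u. x \<in> ?U \<and> u \<in> ?U}"
    and "\<beta> = ker {(x, y, y, x) | x y. x \<in> ?U \<and> y \<in> ?U}"
    and "\<gamma> = ker {(x, y, y, u) | x y u. x \<in> ?U \<and> y \<in> ?U \<and> u \<in> ?U}"
  have cong: "congruence B \<alpha>" "congruence B \<beta>" "congruence B \<gamma>"
    unfolding \<alpha>_def \<beta>_def \<gamma>_def by (auto intro!: ker simp: T_def)
  define v where "v i = \<phi> (tf (Var i))" for i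
  have vB: "v i \<in> univ B" for i using Var by (auto simp: v_def B)
  have \<psi>v: "\<psi> (v i) (a, b, c, d) = pt a b c d i" if "(a, b, c, d) \<in> T" for i a b c d
    using that Var by (simp add: v_def \<psi>\<phi> tf_def)
  \<comment> \<open>The first and the last projection are related by \<beta> and by the join of
    \<gamma> and \<alpha>. Since \<gamma> lies below \<beta>, the modular law relates them by the
    join of \<gamma> and \<open>\<alpha> \<inter> \<beta>\<close>; the members of a connecting chain
    are the Day operations.\<close>
  have "(v 0, v 1) \<in> \<alpha>" "(v 1, v 2) \<in> \<gamma>" "(v 2, v 3) \<in> \<alpha>"
    by (auto simp: \<alpha>_def \<gamma>_def ker_def vB \<psi>v T_def pt_def)
  then have "(v 0, v 3) \<in> \<theta>" if "trans \<theta>" "\<gamma> \<union> \<alpha> \<subseteq> \<theta>" for \<theta>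
    using that by (meson UnCI subsetD transD)
  then have "(v 0, v 3) \<in> con_join B \<gamma> \<alpha>"
    by (auto simp: con_join_def congruence_def equiv_def)
  moreover have "(v 0, v 3) \<in> \<beta>"
    by (auto simp: \<beta>_def ker_def vB \<psi>v T_def pt_def)
  moreover have "\<gamma> \<subseteq> \<beta>" unfolding \<gamma>_def \<beta>_def ker_def by blast
  ultimately have "(v 0, v 3) \<in> con_join B \<gamma> (\<alpha> \<inter> \<beta>)"
    using mod cong unfolding congruence_modular_def by blast
  then have "(v 0, v 3) \<in> con_join B (\<alpha> \<inter> \<beta>) \<gamma>" by (simp add: con_join_def Un_commute)
  moreover have "congruence B (\<alpha> \<inter> \<beta>)"
  proof -
    have ker_Int: "ker S \<inter> ker S' = ker (S \<union> S')" for S S'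
      unfolding ker_def by blast
    have "\<alpha> \<inter> \<beta> = ker ({(x, x, u, u) | x u. x \<in> ?U \<and> u \<in> ?U} \<union> {(x, y, y, x) | x y. x \<in> ?U \<and> y \<in> ?U})"
      unfolding \<alpha>_def \<beta>_def by (rule ker_Int)
    also have "congruence B \<dots>" by (rule ker) (auto simp: T_def)
    finally show ?thesis .
  qed
  ultimately have "\<exists>n. (v 0, v 3) \<in> ((\<alpha> \<inter> \<beta>) O \<gamma>) ^^ n"
    using con_join_chain[OF _ cong(3), of "\<alpha> \<inter> \<beta>" "v 0" "v 3"] by simp
  then obtain n where "(v 0, v 3) \<in> ((\<alpha> \<inter> \<beta>) O \<gamma>) ^^ n" ..
  then obtain e where e: "e 0 = v 0" "e n = v 3" "\<And>i. i < n \<Longrightarrow> (e i, e (Suc i)) \<in> (\<alpha> \<inter> \<beta>) O \<gamma>"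
    by (auto simp: relpow_fun_conv)
  \<comment> \<open>At the end of the chain no intermediate element exists; the first projection is
    a default that also satisfies the absorption law.\<close>
  have "\<exists>h. if i < n then (e i, h) \<in> \<alpha> \<inter> \<beta> \<and> (h, e (Suc i)) \<in> \<gamma> else h = v 0" for i
    using e(3)[of i] by (cases "i < n") auto
  then obtain e' where e'_if: "\<And>i. if i < n then (e i, e' i) \<in> \<alpha> \<inter> \<beta> \<and> (e' i, e (Suc i)) \<in> \<gamma> else e' i = v 0"
    by metis
  have e': "(e i, e' i) \<in> \<alpha>" "(e i, e' i) \<in> \<beta>" "(e' i, e (Suc i)) \<in> \<gamma>" if "i < n" for i
    using e'_if[of i] that by simp_all
  have eB: "e i \<in> univ B \<and> (v 0, e i) \<in> \<beta>" if "i \<le> n" for i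
    using that
  proof (induction i)
    case 0
    then show ?case using e(1) vB by (auto simp: \<beta>_def ker_def)
  next
    case (Suc i)
    then have "(v 0, e i) \<in> \<beta>" "(e i, e' i) \<in> \<beta>" "(e' i, e (Suc i)) \<in> \<beta>" 
      using e'[of i] \<open>\<gamma> \<subseteq> \<beta>\<close> by auto
    then show ?case by (auto simp: \<beta>_def ker_def)
  qed
  have e'B: "e' i \<in> univ B \<and> (v 0, e' i) \<in> \<beta>" if "i \<le> n" for i
  proof (cases "i < n")
    case True
    then show ?thesis using eB[of i] e'(2)[of i] by (auto simp: \<beta>_def ker_def)
  next
    case False
    then show ?thesis using vB e'_if[of i] by (auto simp: \<beta>_def ker_def)
  qed
  have rep: "\<exists>f. op4 f \<and> (\<forall>a b c d. (a, b, c, d) \<in> T \<longrightarrow> f a b c d = \<psi> x (a, b, c, d))" if x: "x \<in> univ B" for x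
  proof -
    obtain t where "wf_trm ?sg t" "\<psi> x = tf t" using \<psi>Cl[OF x] by (auto simp: Cl_def)
    then show ?thesis
      by (intro exI[of _ "\<lambda>a b c d. eval A (pt a b c d) t"]) (auto simp: op4_def tf_def)
  qed
  have "\<forall>i. \<exists>f. i \<le> n \<longrightarrow> op4 f \<and> (\<forall>a b c d. (a, b, c, d) \<in> T \<longrightarrow> f a b c d = \<psi> (e i) (a, b, c, d))"
    using rep eB by metis
  then obtain c where c: "\<And>i. i \<le> n \<Longrightarrow> op4 (c i)"
    "\<And>i x y z u. i \<le> n \<Longrightarrow> (x, y, z, u) \<in> T \<Longrightarrow> c i x y z u = \<psi> (e i) (x, y, z, u)"
    by metis
  have "\<forall>i. \<exists>f. i \<le> n \<longrightarrow> op4 f \<and> (\<forall>a b c d. (a, b, c, d) \<in> T \<longrightarrow> f a b c d = \<psi> (e' i) (a, b, c, d))"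
    using rep e'B by metis
  then obtain d where d: "\<And>i. i \<le> n \<Longrightarrow> op4 (d i)"
    "\<And>i x y z u. i \<le> n \<Longrightarrow> (x, y, z, u) \<in> T \<Longrightarrow> d i x y z u = \<psi> (e' i) (x, y, z, u)"
    by metis
  have "c 0 x y z u = x \<and> c n x y z u = u \<and> (\<forall>i\<le>n. c i x y y x = x \<and> d i x y y x = x) \<and>
      (\<forall>i<n. c i x x u u = d i x x u u \<and> d i x y y u = c (Suc i) x y y u)"
    if U: "x \<in> ?U" "y \<in> ?U" "z \<in> ?U" "u \<in> ?U" for x y z u
  proof -
    from U have T: "(x, y, z, u) \<in> T" "(x, y, y, x) \<in> T" "(x, x, u, u) \<in> T" "(x, y, y, u) \<in> T"
      by (auto simp: T_def)
    have "c 0 x y z u = x" "c n x y z u = u"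
      using T e by (auto simp: c \<psi>v pt_def)
    moreover have "c i x y y x = x" "d i x y y x = x" if "i \<le> n" for i
    proof -
      have "\<psi> (v 0) (x, y, y, x) = \<psi> (e i) (x, y, y, x)" "\<psi> (v 0) (x, y, y, x) = \<psi> (e' i) (x, y, y, x)"
        using eB[OF that] e'B[OF that] U unfolding \<beta>_def ker_def by blast+
      then show "c i x y y x = x" "d i x y y x = x"
        using T that by (simp_all add: c d \<psi>v pt_def)
    qed
    moreover have "c i x x u u = d i x x u u" "d i x y y u = c (Suc i) x y y u" if "i < n" for i
    proof -
      have "\<psi> (e i) (x, x, u, u) = \<psi> (e' i) (x, x, u, u)"
        using e'(1)[OF that] U unfolding \<alpha>_def ker_def by blast
      moreover have "\<psi> (e' i) (x, y, y, u) = \<psi> (e (Suc i)) (x, y, y, u)"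
        using e'(3)[OF that] U unfolding \<gamma>_def ker_def by blast
      ultimately show "c i x x u u = d i x x u u" "d i x y y u = c (Suc i) x y y u"
        using T that by (simp_all add: c d)
    qed
    ultimately show ?thesis by blast
  qed
  then show ?thesis using c(1) d(1) by blast
qed

section \<open>Binary polynomials and links\<close>

lemma eval_pol: "wf_trm (signature A) t \<Longrightarrow> (\<lambda>\<rho>. eval A \<rho> t) \<in> pol"
proof (induction t)
  case (App f ts)
  have "(\<lambda>\<rho>. oper A f (map (\<lambda>F. F \<rho>) (map (\<lambda>t \<rho>. eval A \<rho> t) ts))) \<in> pol"
    by (rule pol.op) (use App in auto)
  then show ?case by (simp add: comp_def)
qed (simp add: pol.var)

lemma op4_pol:
  assumes "op4 f" "G1 \<in> pol" "G2 \<in> pol" "G3 \<in> pol" "G4 \<in> pol"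
  shows "(\<lambda>\<rho>. f (G1 \<rho>) (G2 \<rho>) (G3 \<rho>) (G4 \<rho>)) \<in> pol"
proof -
  obtain t where t: "wf_trm (signature A) t" "f = (\<lambda>a b c d. eval A (pt a b c d) t)"
    using assms(1) by (auto simp: op4_def)
  have "(\<lambda>\<rho>. eval A (\<lambda>i. pt G1 G2 G3 G4 i \<rho>) t) \<in> pol"
    by (rule pol_subst[OF eval_pol[OF t(1)]]) (auto simp: pt_def assms)
  moreover have "(\<lambda>i. pt G1 G2 G3 G4 i \<rho>) = pt (G1 \<rho>) (G2 \<rho>) (G3 \<rho>) (G4 \<rho>)" for \<rho>
    by (auto simp: pt_def)
  ultimately show ?thesis by (simp add: t(2))
qed

text \<open>The second argument sits at variable 0, the one through which
  \<open>no_separating_chain\<close> composes its steps; the first argument is a parameter.\<close>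

definition pol2 :: "('a \<Rightarrow> 'a \<Rightarrow> 'a) \<Rightarrow> bool" where
  "pol2 D \<longleftrightarrow> (\<lambda>\<rho>. D (\<rho> 1) (\<rho> 0)) \<in> pol"

lemma pol2_pol:
  assumes "pol2 D" "G \<in> pol" "H \<in> pol"
  shows "(\<lambda>\<rho>. D (G \<rho>) (H \<rho>)) \<in> pol"
  using pol_subst[of "\<lambda>\<rho>. D (\<rho> 1) (\<rho> 0)" "\<lambda>i. if i = 0 then H else G"] assms
  by (simp add: pol2_def)

lemma pol2_closed: "pol2 D \<Longrightarrow> y \<in> univ A \<Longrightarrow> z \<in> univ A \<Longrightarrow> D y z \<in> univ A"
  using pol_closed[of "\<lambda>\<rho>. D (\<rho> 1) (\<rho> 0)" "\<lambda>i. if i = 0 then z else y"]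
  by (auto simp: pol2_def vals_def split: if_splits)

lemma pol2_comp: "pol2 G \<Longrightarrow> pol2 D \<Longrightarrow> pol2 E \<Longrightarrow> pol2 (\<lambda>y z. G (D y z) (E y z))"
  unfolding pol2_def by (rule pol2_pol[unfolded pol2_def])

lemma pol2_proj: "pol2 (\<lambda>y z. z)" "pol2 (\<lambda>y z. y)"
  by (auto simp: pol2_def pol.var)

lemma pol2_const: "a \<in> univ A \<Longrightarrow> pol2 (\<lambda>y z. a)"
  by (auto simp: pol2_def pol.const)

lemma pol2_op4:
  assumes "op4 f" "pol2 D1" "pol2 D2" "pol2 D3" "pol2 D4"
  shows "pol2 (\<lambda>y z. f (D1 y z) (D2 y z) (D3 y z) (D4 y z))"
  using op4_pol[OF assms(1)] assms(2-) unfolding pol2_def by blast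

lemma pol2_diag: "pol2 D \<Longrightarrow> x \<in> univ A \<Longrightarrow> pol2 (\<lambda>y z. D x z)"
  using pol2_comp[OF _ pol2_const pol2_proj(1)] .

text \<open>The relation on unary polynomials fixing \<open>x\<close> that the ternary operations with
  \<open>D(x, y, x) = x\<close> induce; a chain of such links is what Jonsson's and Gumm's conditions provide.\<close>

definition link :: "'a \<Rightarrow> ('a \<Rightarrow> 'a) \<Rightarrow> ('a \<Rightarrow> 'a) \<Rightarrow> bool" where
  "link x s t \<longleftrightarrow> (\<exists>D. pol2 D \<and> (\<forall>y\<in>univ A. D y x = x) \<and>
     (\<forall>z\<in>univ A. s z = D x z \<and> t z = D z z))"

definition linked :: "'a \<Rightarrow> ('a \<Rightarrow> 'a) \<Rightarrow> ('a \<Rightarrow> 'a) \<Rightarrow> bool" where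
  "linked x = equivclp (link x)"

lemma linked_trans [trans]: "linked x s t \<Longrightarrow> linked x t u \<Longrightarrow> linked x s u"
  by (auto simp: linked_def intro: equivclp_trans)

lemma linked_sym: "linked x s t \<Longrightarrow> linked x t s"
  by (auto simp: linked_def intro: equivclp_sym)

lemma link_linked: "link x s t \<Longrightarrow> linked x s t"
  by (auto simp: linked_def)

lemma linked_invariant:
  assumes "linked x s t" "\<And>s t. link x s t \<Longrightarrow> P s \<longleftrightarrow> P t"
  shows "P s \<longleftrightarrow> P t"
  using assms(1) unfolding linked_def
  by (induction rule: equivclp_induct) (use assms(2) in blast)+

lemma linked_eq:
  assumes "pol2 (\<lambda>y z. s z)" "s x = x" "\<And>z. z \<in> univ A \<Longrightarrow> s z = t z"
  shows "linked x s t"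
  by (rule link_linked, unfold link_def, rule exI[of _ "\<lambda>y z. s z"]) (use assms in auto)

text \<open>Composing the operation of each link with G again gives a link, because
  \<open>G x x = x\<close> preserves the value x at z = x.\<close>

lemma linked_cong:
  assumes "linked x s t" "pol2 G" "G x x = x"
  shows "linked x (\<lambda>z. G (s z) z) (\<lambda>z. G (t z) z)"
  using assms(1) unfolding linked_def
proof (induction rule: equivclp_induct)
  case (step t u)
  have "link x (\<lambda>z. G (s z) z) (\<lambda>z. G (t z) z)" if "link x s t" for s t
  proof -
    obtain D where D: "pol2 D" "\<forall>y\<in>univ A. D y x = x" "\<forall>z\<in>univ A. s z = D x z \<and> t z = D z z"
      using \<open>link x s t\<close> by (auto simp: link_def)
    then show ?thesis
      unfolding link_def
      by (intro exI[of _ "\<lambda>y z. G (D y z) z"]) (auto intro: pol2_comp assms pol2_proj simp: assms(3))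
  qed
  then have "link x (\<lambda>z. G (t z) z) (\<lambda>z. G (u z) z) \<or> link x (\<lambda>z. G (u z) z) (\<lambda>z. G (t z) z)"
    using step by blast
  then show ?case using step.IH by (meson equivclp_into_equivclp)
qed simp

end

section \<open>From Day operations to Gumm's operation\<close>

locale day_algebra = finite_algebra +
  fixes n :: nat and c d :: "nat \<Rightarrow> 'a \<Rightarrow> 'a \<Rightarrow> 'a \<Rightarrow> 'a \<Rightarrow> 'a"
  assumes op4: "i \<le> n \<Longrightarrow> op4 (c i)" "i \<le> n \<Longrightarrow> op4 (d i)"
    and c0: "\<lbrakk>x \<in> univ A; y \<in> univ A; z \<in> univ A; u \<in> univ A\<rbrakk> \<Longrightarrow> c 0 x y z u = x"
    and cn: "\<lbrakk>x \<in> univ A; y \<in> univ A; z \<in> univ A; u \<in> univ A\<rbrakk> \<Longrightarrow> c n x y z u = u"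
    and absorb: "\<lbrakk>i \<le> n; x \<in> univ A; y \<in> univ A\<rbrakk> \<Longrightarrow> c i x y y x = x"
      "\<lbrakk>i \<le> n; x \<in> univ A; y \<in> univ A\<rbrakk> \<Longrightarrow> d i x y y x = x"
    and cd: "\<lbrakk>i < n; x \<in> univ A; u \<in> univ A\<rbrakk> \<Longrightarrow> c i x x u u = d i x x u u"
    and dc: "\<lbrakk>i < n; x \<in> univ A; y \<in> univ A; u \<in> univ A\<rbrakk> \<Longrightarrow> d i x y y u = c (Suc i) x y y u"
begin

lemmas c_pol2 = pol2_op4[OF op4(1)] and d_pol2 = pol2_op4[OF op4(2)]

text \<open>Write s = \<open>H1 x z\<close>, t = \<open>H2 x z\<close>, m = \<open>H1 z z\<close>.
  Moving y from x to z in \<open>f (H1 x z) (H1 y z) (H2 y z) (H2 x z)\<close> links f(s, s, t, t)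
  to f(s, m, m, t), as both operations agree on the diagonal. On the first pattern
  \<open>c i\<close> equals \<open>d i\<close>, on the second \<open>d i\<close> equals
  \<open>c (Suc i)\<close>; so links lead from \<open>c 0\<close>, which returns s, to
  \<open>c n\<close>, which returns t.\<close>

lemma linked_shift:
  assumes x: "x \<in> univ A" and H: "pol2 H1" "pol2 H2"
    and diag: "\<And>z. z \<in> univ A \<Longrightarrow> H1 z z = H2 z z"
    and base: "\<And>y. y \<in> univ A \<Longrightarrow> H1 y x = H2 y x" "H1 x x = x"
  shows "linked x (H1 x) (H2 x)"
proof -
  let ?s = "H1 x" and ?t = "H2 x"
  have U: "z \<in> univ A \<Longrightarrow> y \<in> univ A \<Longrightarrow> H1 y z \<in> univ A \<and> H2 y z \<in> univ A" for y z
    using H pol2_closed by auto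
  have Hx: "pol2 (\<lambda>y z. H1 x z)" "pol2 (\<lambda>y z. H2 x z)" using H x by (auto intro: pol2_diag)
  have Hz: "pol2 (\<lambda>y z. H1 z z)" using pol2_comp[OF H(1) pol2_proj(1) pol2_proj(1)] .
  have ln: "linked x (\<lambda>z. f (?s z) (?s z) (?t z) (?t z)) (\<lambda>z. f (?s z) (H1 z z) (H1 z z) (?t z))"
    if f: "op4 f" "\<And>y. y \<in> univ A \<Longrightarrow> f x y y x = x" for f
  proof (rule link_linked, unfold link_def, intro exI conjI ballI)
    show "pol2 (\<lambda>y z. f (H1 x z) (H1 y z) (H2 y z) (H2 x z))"
      using pol2_op4[OF f(1) Hx(1) H(1) H(2) Hx(2)] .
    show "f (H1 x x) (H1 y x) (H2 y x) (H2 x x) = x" if "y \<in> univ A" for y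
      using base that x f(2) U by metis
  qed (auto simp: diag)
  have step: "i \<le> n \<Longrightarrow> linked x ?s (\<lambda>z. c i (?s z) (?s z) (?t z) (?t z))" for i
  proof (induction i)
    case 0
    show ?case by (rule linked_eq) (use base Hx x U in \<open>auto simp: c0\<close>)
  next
    case (Suc i)
    then have i: "i < n" by simp
    note Suc.IH
    also have "linked x (\<lambda>z. c i (?s z) (?s z) (?t z) (?t z)) (\<lambda>z. d i (?s z) (?s z) (?t z) (?t z))"
      by (rule linked_eq) (use base x U i absorb Hx in \<open>auto intro!: c_pol2 simp: cd\<close>)
    also have "linked x \<dots> (\<lambda>z. d i (?s z) (H1 z z) (H1 z z) (?t z))"
      by (rule ln) (use i x op4 absorb in auto)
    also have "linked x \<dots> (\<lambda>z. c (Suc i) (?s z) (H1 z z) (H1 z z) (?t z))"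
    proof (rule linked_eq)
      show "pol2 (\<lambda>y z. d i (?s z) (H1 z z) (H1 z z) (?t z))"
        using i Hx Hz by (auto intro!: d_pol2)
    qed (use i x U base absorb in \<open>auto simp: dc\<close>)
    also have "linked x \<dots> (\<lambda>z. c (Suc i) (?s z) (?s z) (?t z) (?t z))"
      by (rule linked_sym, rule ln) (use Suc.prems x op4 absorb in auto)
    finally show ?case using i by simp
  qed
  have "linked x ?s (\<lambda>z. c n (?s z) (?s z) (?t z) (?t z))" using step by simp
  also have "linked x \<dots> ?t"
    by (rule linked_eq) (use base x U absorb Hx in \<open>auto intro!: c_pol2 simp: cn\<close>)
  finally show ?thesis .
qed

text \<open>Gumm's construction. For a = b the absorption laws make every wrapping disappear, so the
  value is e. At (x, z, z) the value remains linked to \<open>c i z z x x\<close>, which is z at the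
  start and x for i = n.\<close>

fun q :: "nat \<Rightarrow> 'a \<Rightarrow> 'a \<Rightarrow> 'a \<Rightarrow> 'a" where
  "q 0 a b e = e"
| "q (Suc i) a b e = c (Suc i) (d i (q i a b e) a b (q i a b e)) b a (d i (q i a b e) a b (q i a b e))"

lemma q_pol:
  assumes "i \<le> n" "F \<in> pol" "G \<in> pol" "H \<in> pol"
  shows "(\<lambda>\<rho>. q i (F \<rho>) (G \<rho>) (H \<rho>)) \<in> pol"
  using assms(1)
proof (induction i)
  case (Suc i)
  then have "(\<lambda>\<rho>. d i (q i (F \<rho>) (G \<rho>) (H \<rho>)) (F \<rho>) (G \<rho>) (q i (F \<rho>) (G \<rho>) (H \<rho>))) \<in> pol"
    using assms by (intro op4_pol[OF op4(2)]) auto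
  then show ?case unfolding q.simps using Suc.prems assms by (intro op4_pol[OF op4(1)]) auto
qed (simp add: assms)

lemma q_left: "i \<le> n \<Longrightarrow> a \<in> univ A \<Longrightarrow> e \<in> univ A \<Longrightarrow> q i a a e = e"
  by (induction i) (auto simp: absorb)

text \<open>Inside step i + 1 the induction hypothesis replaces \<open>q i\<close> by
  \<open>c i z z x x\<close>; two shifts and the equations between \<open>d i\<close> and
  \<open>c (Suc i)\<close> then remove the wrapping.\<close>

lemma linked_q:
  assumes x: "x \<in> univ A"
  shows "i \<le> n \<Longrightarrow> linked x (\<lambda>z. q i x z z) (\<lambda>z. c i z z x x)"
proof (induction i)
  case 0
  show ?case by (rule linked_eq) (use x in \<open>auto simp: c0 pol2_proj\<close>)
next
  case (Suc i)
  then have i: "i < n" "i \<le> n" "Suc i \<le> n" by simp_all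
  note pols = c_pol2 d_pol2 pol2_proj pol2_const x i
  have U: "c i z z x x \<in> univ A" if "z \<in> univ A" for z
    by (rule pol2_closed[of "\<lambda>y z. c i z z x x" z z]) (use that in \<open>auto intro!: pols\<close>)
  have U': "c (Suc i) z z z x \<in> univ A" if "z \<in> univ A" for z
    by (rule pol2_closed[of "\<lambda>y z. c (Suc i) z z z x" z z]) (use that in \<open>auto intro!: pols\<close>)
  define o1 where "o1 = (\<lambda>z. d i (q i x z z) x z (q i x z z))"
  have "linked x o1 (\<lambda>z. d i (c i z z x x) x z (c i z z x x))"
    unfolding o1_def using Suc.IH[OF i(2)]
    by (rule linked_cong[where G = "\<lambda>w z. d i w x z w"]) (use x i absorb in \<open>auto intro!: pols\<close>)
  \<comment> \<open>On the diagonal y = z absorption leaves \<open>c i z z x x\<close> of the first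
    operation, and this equals \<open>d i z z x x\<close>.\<close>
  also have "linked x \<dots> (\<lambda>z. d i z x x x)"
    by (rule linked_shift[where ?H1.0 = "\<lambda>y z. d i (c i z z x x) y z (c i z z x x)" and ?H2.0 = "\<lambda>y z. d i z y x x"])
      (use x i absorb U cd in \<open>auto intro!: pols\<close>)
  also have "linked x \<dots> (\<lambda>z. d i z z z x)"
    by (rule link_linked, unfold link_def, rule exI[of _ "\<lambda>y z. d i z y y x"])
      (use x i absorb in \<open>auto intro!: pols\<close>)
  also have "linked x \<dots> (\<lambda>z. c (Suc i) z z z x)"
    by (rule linked_eq) (use x i absorb dc in \<open>auto intro!: pols\<close>)
  finally have "linked x (\<lambda>z. c (Suc i) (o1 z) z x (o1 z)) (\<lambda>z. c (Suc i) (c (Suc i) z z z x) z x (c (Suc i) z z z x))"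
    by (rule linked_cong[where G = "\<lambda>w z. c (Suc i) w z x w"]) (use x i absorb in \<open>auto intro!: pols\<close>)
  also have "linked x \<dots> (\<lambda>z. c (Suc i) z z x x)"
    by (rule linked_shift[where ?H1.0 = "\<lambda>y z. c (Suc i) (c (Suc i) z z z x) z y (c (Suc i) z z z x)"
          and ?H2.0 = "\<lambda>y z. c (Suc i) z z y x"])
      (use x i absorb U' in \<open>auto intro!: pols\<close>)
  finally show ?case by (simp add: o1_def)
qed

end

context finite_algebra
begin

lemma gumm_operation:
  assumes "in_congruence_modular_variety A"
  shows "\<exists>p. (\<forall>F\<in>pol. \<forall>G\<in>pol. \<forall>H\<in>pol. (\<lambda>\<rho>. p (F \<rho>) (G \<rho>) (H \<rho>)) \<in> pol) \<and>
    (\<forall>x\<in>univ A. \<forall>y\<in>univ A. p x x y = y) \<and> (\<forall>x\<in>univ A. linked x (\<lambda>z. p x z z) (\<lambda>_. x))"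
proof -
  obtain n c d where ncd: "(\<forall>i\<le>n. op4 (c i) \<and> op4 (d i)) \<and>
    (\<forall>x\<in>univ A. \<forall>y\<in>univ A. \<forall>z\<in>univ A. \<forall>u\<in>univ A.
      c 0 x y z u = x \<and> c n x y z u = u \<and>
      (\<forall>i\<le>n. c i x y y x = x \<and> d i x y y x = x) \<and>
      (\<forall>i<n. c i x x u u = d i x x u u \<and> d i x y y u = c (Suc i) x y y u))"
    using day_operations[OF assms] by blast
  interpret day_algebra A n c d
    by unfold_locales (use ncd in blast)+
  have "linked x (\<lambda>z. q n x z z) (\<lambda>_. x)" if x: "x \<in> univ A" for x
  proof -
    have "linked x (\<lambda>z. c n z z x x) (\<lambda>_. x)"
      by (rule linked_eq) (use x cn in \<open>auto intro!: c_pol2 pol2_proj pol2_const\<close>)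
    then show ?thesis using linked_q[OF x] linked_trans by blast
  qed
  then show ?thesis using q_pol q_left by (intro exI[of _ "q n"]) auto
qed

end

section \<open>From Gumm's operation to a Maltsev operation\<close>

context supernilpotent_algebra
begin

text \<open>A point \<open>w\<close> that never reaches \<open>x\<close> yields, along a chain of links, a polynomial meet-like cube
  with another such point at its top; iterating this contradicts supernilpotence.\<close>

lemma gumm_orbit_reaches:
  assumes p: "\<And>F G H. F \<in> pol \<Longrightarrow> G \<in> pol \<Longrightarrow> H \<in> pol \<Longrightarrow> (\<lambda>\<rho>. p (F \<rho>) (G \<rho>) (H \<rho>)) \<in> pol"
    and pl: "\<And>x y. x \<in> univ A \<Longrightarrow> y \<in> univ A \<Longrightarrow> p x x y = y"
    and ln: "linked x (\<lambda>z. p x z z) (\<lambda>_. x)" and x: "x \<in> univ A" and w: "w \<in> univ A"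
  shows "\<exists>j. ((\<lambda>z. p x z z) ^^ j) w = x"
proof (rule ccontr)
  let ?\<tau> = "\<lambda>z. p x z z"
  define good where "good w \<longleftrightarrow> w \<in> univ A \<and> (\<forall>j. (?\<tau> ^^ j) w \<noteq> x)" for w
  assume "\<not> ?thesis"
  then have w_good: "good w" using w by (simp add: good_def)
  have \<tau>x: "(?\<tau> ^^ j) x = x" for j by (induction j) (auto simp: pl x)
  have \<tau>pol: "(\<lambda>\<rho>. (?\<tau> ^^ j) (F \<rho>)) \<in> pol" if "F \<in> pol" for F j
    by (induction j) (use that x in \<open>auto intro: p pol.const\<close>)
  have \<tau>U: "(?\<tau> ^^ j) z \<in> univ A" if "z \<in> univ A" for z j
    using pol_closed[OF \<tau>pol[OF pol.var[of 0]], of "\<lambda>_. z" j] that by (auto simp: vals_def)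
  have good_pow: "good ((?\<tau> ^^ j) z)" if "good z" for j z
    using that \<tau>U unfolding good_def by (metis comp_apply funpow_add)
  define R where "R w g y0 y1 s \<longleftrightarrow> g \<in> pol \<and> y0 \<in> univ A \<and> y1 \<in> univ A \<and> good s \<and>
      g ((\<lambda>_. y0)(0 := x)) = x \<and> g ((\<lambda>_. y0)(0 := w)) = x \<and>
      g ((\<lambda>_. y1)(0 := x)) = x \<and> g ((\<lambda>_. y1)(0 := w)) = s" for w g y0 y1 s
  have step: "\<exists>g y0 y1 s. R w g y0 y1 s" if wg: "good w" for w
  proof -
    have w: "w \<in> univ A" using wg by (simp add: good_def)
    have "good (?\<tau> w)" using good_pow[OF wg, of 1] by simp
    moreover have "\<not> good x" using \<tau>x by (auto simp: good_def)
    \<comment> \<open>The chain leads from the map \<open>?\<tau>\<close>, whose value at w is good,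
      to the constant x, which is not; goodness of the value at w must change across some
      link.\<close>
    ultimately obtain s t where st: "link x s t" "good (s w) \<noteq> good (t w)"
      using linked_invariant[OF ln, of "\<lambda>s. good (s w)"] by auto
    then obtain D where D: "pol2 D" "\<And>y. y \<in> univ A \<Longrightarrow> D y x = x" "s w = D x w" "t w = D w w"
      using w by (auto simp: link_def)
    then obtain y0 y1 where y: "y0 \<in> univ A" "y1 \<in> univ A" "good (D y1 w)" "\<not> good (D y0 w)"
      using st x w by metis
    \<comment> \<open>Iterating \<open>?\<tau>\<close> sends the bad value to x itself, leaves x
      fixed, and keeps good values good.\<close>
    then obtain j where j: "(?\<tau> ^^ j) (D y0 w) = x"
      using pol2_closed[OF D(1) y(1) w] by (auto simp: good_def)
    show ?thesis
      unfolding R_def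
      by (rule exI[of _ "\<lambda>\<rho>. (?\<tau> ^^ j) (D (\<rho> 1) (\<rho> 0))"], rule exI[of _ y0], rule exI[of _ y1],
          rule exI[of _ "(?\<tau> ^^ j) (D y1 w)"])
        (use y D j \<tau>x good_pow in \<open>auto intro!: \<tau>pol simp: pol2_def\<close>)
  qed
  then obtain g y0 y1 s where "\<And>w. good w \<Longrightarrow> R w (g w) (y0 w) (y1 w) (s w)"
    by metis
  note g = this[unfolded R_def]
  have sg: "good ((s ^^ j) w)" for j
    by (induction j) (use w_good g in auto)
  have "x = (s ^^ k) w"
    by (rule no_separating_chain[where g = "\<lambda>j. g ((s ^^ j) w)" and ?y0.0 = "\<lambda>j _. y0 ((s ^^ j) w)" and
          ?y1.0 = "\<lambda>j _. y1 ((s ^^ j) w)" and u = "\<lambda>_. x" and v = "\<lambda>j. (s ^^ j) w"])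
      (use g[OF sg] x w in \<open>auto simp: vals_def\<close>)
  then show False using sg[of k] \<tau>x[of 0] by (auto simp: good_def dest!: spec[of _ 0])
qed

text \<open>Nesting \<open>p a (h a b b) (h a b e)\<close> iterates the map sending z to
  \<open>p a z z\<close> when e = b, and returns e when a = b. Each orbit reaches a and stays there,
  so one number of iterations suffices for all pairs.\<close>

lemma maltsev_operation:
  assumes "in_congruence_modular_variety A"
  shows "\<exists>m. (\<forall>F\<in>pol. \<forall>G\<in>pol. \<forall>H\<in>pol. (\<lambda>\<rho>. m (F \<rho>) (G \<rho>) (H \<rho>)) \<in> pol) \<and>
    (\<forall>x\<in>univ A. \<forall>y\<in>univ A. m x y y = x \<and> m x x y = y)"
proof -
  obtain p where p: "\<forall>F\<in>pol. \<forall>G\<in>pol. \<forall>H\<in>pol. (\<lambda>\<rho>. p (F \<rho>) (G \<rho>) (H \<rho>)) \<in> pol"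
    "\<forall>x\<in>univ A. \<forall>y\<in>univ A. p x x y = y" "\<forall>x\<in>univ A. linked x (\<lambda>z. p x z z) (\<lambda>_. x)"
    using gumm_operation[OF assms] by blast
  have "\<exists>j. ((\<lambda>z. p x z z) ^^ j) w = x" if "x \<in> univ A" "w \<in> univ A" for x w
    by (rule gumm_orbit_reaches[of p]) (use p that in blast)+
  then obtain J where J: "\<And>x w. x \<in> univ A \<Longrightarrow> w \<in> univ A \<Longrightarrow> ((\<lambda>z. p x z z) ^^ J x w) w = x"
    by metis
  define N where "N = (\<Sum>x\<in>univ A. \<Sum>w\<in>univ A. J x w)"
  have N: "((\<lambda>z. p x z z) ^^ N) w = x" if "x \<in> univ A" "w \<in> univ A" for x w
  proof -
    have "J x w \<le> (\<Sum>w\<in>univ A. J x w)" using that fin by (intro member_le_sum) auto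
    also have "\<dots> \<le> N" unfolding N_def using that fin by (intro member_le_sum) auto
    finally obtain r where "N = r + J x w" by (metis add.commute le_Suc_ex)
    then have "((\<lambda>z. p x z z) ^^ N) w = ((\<lambda>z. p x z z) ^^ r) x"
      using J[OF that] by (simp add: funpow_add)
    also have "((\<lambda>z. p x z z) ^^ i) x = x" for i by (induction i) (use p(2) that in auto)
    finally show ?thesis .
  qed
  define m where "m = rec_nat (\<lambda>a b e. e) (\<lambda>_ h a b e. p a (h a b b) (h a b e))"
  have m: "m 0 = (\<lambda>a b e. e)" "m (Suc j) = (\<lambda>a b e. p a (m j a b b) (m j a b e))" for j
    unfolding m_def by simp_all
  have "(\<lambda>\<rho>. m j (F \<rho>) (G \<rho>) (H \<rho>)) \<in> pol" if "F \<in> pol" "G \<in> pol" "H \<in> pol" for F G H j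
    using that(3) by (induction j arbitrary: H) (use that p(1) in \<open>auto simp: m\<close>)
  moreover have "m j a b b = ((\<lambda>z. p a z z) ^^ j) b" for j a b
    by (induction j) (auto simp: m)
  moreover have "m j a a e = e" if "a \<in> univ A" "e \<in> univ A" for j a e
    using that(2) by (induction j arbitrary: e) (use that p(2) in \<open>auto simp: m\<close>)
  ultimately show ?thesis using N by (intro exI[of _ "m N"]) auto
qed

end

section \<open>Nilpotent groups acting on a set of prime power order\<close>

primrec iterated_commutator :: "(nat \<Rightarrow> 'a \<Rightarrow> 'a) \<Rightarrow> nat \<Rightarrow> 'a \<Rightarrow> 'a" where
  "iterated_commutator g 0 = g 0"
| "iterated_commutator g (Suc j) =
     g (Suc j) \<circ> iterated_commutator g j \<circ> inv (g (Suc j)) \<circ> inv (iterated_commutator g j)"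

text \<open>The action of the group ring element (w - 1)^i on functions.\<close>

primrec differences :: "('a \<Rightarrow> 'a) \<Rightarrow> nat \<Rightarrow> ('a \<Rightarrow> int) \<Rightarrow> 'a \<Rightarrow> int" where
  "differences w 0 h = h"
| "differences w (Suc i) h = (\<lambda>x. differences w i h (w x) - differences w i h x)"

lemma differences_binomial:
  "differences w i h x = (\<Sum>l\<le>i. (- 1) ^ (i + l) * int (i choose l) * h ((w ^^ l) x))"
proof (induction i arbitrary: x)
  case (Suc i)
  let ?a = "\<lambda>l. h ((w ^^ l) x)"
  have "(\<Sum>l\<le>Suc i. (- 1) ^ (Suc i + l) * int (Suc i choose l) * ?a l) =
      (- 1) ^ Suc i * ?a 0 + (\<Sum>l\<le>i. (- 1) ^ (Suc i + Suc l) * int (Suc i choose Suc l) * ?a (Suc l))"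
    by (subst sum.atMost_Suc_shift) simp
  also have "(\<Sum>l\<le>i. (- 1) ^ (Suc i + Suc l) * int (Suc i choose Suc l) * ?a (Suc l)) =
      (\<Sum>l\<le>i. (- 1) ^ (i + l) * int (i choose l) * ?a (Suc l)) +
      (\<Sum>l\<le>i. (- 1) ^ (i + l) * int (i choose Suc l) * ?a (Suc l))"
    by (simp add: sum.distrib[symmetric] algebra_simps)
  also have "(\<Sum>l\<le>i. (- 1) ^ (i + l) * int (i choose l) * ?a (Suc l)) = differences w i h (w x)"
    by (simp add: Suc funpow_swap1)
  also have "(- 1) ^ Suc i * ?a 0 + (differences w i h (w x) +
        (\<Sum>l\<le>i. (- 1) ^ (i + l) * int (i choose Suc l) * ?a (Suc l))) =
      differences w i h (w x) - (\<Sum>l\<le>Suc i. (- 1) ^ (i + l) * int (i choose l) * ?a l)"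
    by (subst sum.atMost_Suc_shift) (simp add: sum_negf[symmetric])
  also have "\<dots> = differences w (Suc i) h x" by (simp add: Suc)
  finally show ?case by simp
qed simp

text \<open>The identity (w - 1)^p = w^p - 1 in characteristic p: the inner binomial coefficients
  are divisible by p.\<close>

lemma differences_prime:
  assumes "prime p"
  shows "int p dvd differences w p h x - (h ((w ^^ p) x) - h x)"
proof -
  let ?f = "\<lambda>l. (- 1) ^ (p + l) * int (p choose l) * h ((w ^^ l) x)"
  have p: "p > 1" using assms prime_gt_1_nat by blast
  have "{..p} = insert 0 (insert p {1..<p})" using p by auto
  then have "differences w p h x = ?f 0 + ?f p + (\<Sum>l\<in>{1..<p}. ?f l)"
    using p by (simp add: differences_binomial)
  also have "?f p = h ((w ^^ p) x)" by (simp flip: mult_2)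
  finally have "differences w p h x - (h ((w ^^ p) x) - h x) =
      ((- 1) ^ p + 1) * h x + (\<Sum>l\<in>{1..<p}. ?f l)"
    by (simp add: algebra_simps)
  \<comment> \<open>The sign is -1 for odd p; for p = 2 the sum is 2.\<close>
  moreover have "int p dvd (- 1) ^ p + 1"
    using assms prime_odd_nat[of p] p by (cases "p = 2") auto
  moreover have "int p dvd (\<Sum>l\<in>{1..<p}. ?f l)"
  proof (rule dvd_sum)
    fix l assume "l \<in> {1..<p}"
    then have "p dvd (p choose l)" using assms by (intro dvd_choose_prime) auto
    then show "int p dvd ?f l" by simp
  qed
  ultimately show ?thesis by simp
qed

lemma permutes_funpow_eq_id:
  assumes "finite X" "g permutes X"
  shows "\<exists>e>0. g ^^ e = id"
proof -
  have pw: "(g ^^ i) permutes X" for i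
    by (induction i) (simp_all only: funpow.simps permutes_id permutes_compose[OF _ assms(2)])
  have "finite {h. h permutes X}" using assms(1) by (rule finite_permutations)
  then have "\<not> inj (\<lambda>i. g ^^ i)"
    using pw by (metis (no_types, lifting) finite_subset image_subsetI infinite_UNIV_nat mem_Collect_eq finite_imageD)
  then obtain i j where ij: "i < j" "g ^^ i = g ^^ j" by (metis injI linorder_neqE_nat)
  have "g ^^ (j - i) = id"
  proof
    fix x
    have "i + (j - i) = j" using ij by simp
    then have "(g ^^ i) ((g ^^ (j - i)) x) = (g ^^ i) x"
      using ij by (metis comp_apply funpow_add)
    then show "(g ^^ (j - i)) x = id x" using permutes_inj[OF pw[of i]] by (simp add: inj_eq)
  qed
  then show ?thesis using ij by (intro exI[of _ "j - i"]) auto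
qed

section \<open>The augmentation series of a transitive nilpotent group\<close>

locale nilpotent_action =
  fixes X :: "'a set" and G :: "('a \<Rightarrow> 'a) set" and p k :: nat
  assumes finX: "finite X" and perm: "g \<in> G \<Longrightarrow> g permutes X"
    and id: "id \<in> G" and comp: "g \<in> G \<Longrightarrow> h \<in> G \<Longrightarrow> g \<circ> h \<in> G" and inv: "g \<in> G \<Longrightarrow> inv g \<in> G"
    and trans: "x \<in> X \<Longrightarrow> y \<in> X \<Longrightarrow> \<exists>g\<in>G. g x = y"
    and nil: "(\<And>j. j \<le> k \<Longrightarrow> gs j \<in> G) \<Longrightarrow> iterated_commutator gs k = id"
    and prime: "prime p"
begin

text \<open>The ascending series of the functions modulo \<open>p\<close> under the augmentation ideal of the group
  ring: membership in some term says that products of sufficiently many \<open>g - 1\<close> annihilate \<open>h\<close>.\<close>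

primrec V :: "nat \<Rightarrow> ('a \<Rightarrow> int) set" where
  "V 0 = {h. \<forall>x\<in>X. int p dvd h x}"
| "V (Suc j) = {h. \<forall>g\<in>G. (\<lambda>x. h (g x) - h x) \<in> V j}"

lemma act: "g \<in> G \<Longrightarrow> x \<in> X \<Longrightarrow> g x \<in> X"
  using perm permutes_in_image by metis

lemma finG: "finite G"
  by (rule finite_subset[OF _ finite_permutations[OF finX]]) (use perm in blast)

lemma pow: "g \<in> G \<Longrightarrow> g ^^ i \<in> G"
  by (induction i) (simp_all only: funpow.simps id comp)

lemma V_mono: "j \<le> j' \<Longrightarrow> V j \<subseteq> V j'"
proof (induction j' rule: dec_induct)
  case (step j')
  have "V i \<subseteq> V (Suc i)" for i by (induction i) (auto simp: act)
  then show ?case using step by blast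
qed simp

lemma V_cong: "h \<in> V j \<Longrightarrow> (\<And>x. x \<in> X \<Longrightarrow> int p dvd h x - h' x) \<Longrightarrow> h' \<in> V j"
proof (induction j arbitrary: h h')
  case 0
  have "int p dvd h' x" if "x \<in> X" for x
    using dvd_diff[of "int p" "h x" "h x - h' x"] 0 that by simp
  then show ?case by simp
next
  case (Suc j)
  have "(\<lambda>x. h' (g x) - h' x) \<in> V j" if g: "g \<in> G" for g
  proof (rule Suc.IH)
    show "(\<lambda>x. h (g x) - h x) \<in> V j" using Suc.prems g by simp
    show "int p dvd h (g x) - h x - (h' (g x) - h' x)" if "x \<in> X" for x
      using dvd_diff[OF Suc.prems(2)[OF act[OF g that]] Suc.prems(2)[OF that]] by (simp add: algebra_simps)
  qed
  then show ?case by simp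
qed

text \<open>These are the block systems of the action. Functions that are constant on classes modulo
  p serve as the functions on the quotient action, which thus needs no type of its own.\<close>

definition invariant :: "'a rel \<Rightarrow> bool" where
  "invariant \<theta> \<longleftrightarrow> equiv X \<theta> \<and> (\<forall>g\<in>G. \<forall>(x, y)\<in>\<theta>. (g x, g y) \<in> \<theta>)"

definition class_constant :: "'a rel \<Rightarrow> ('a \<Rightarrow> int) \<Rightarrow> bool" where
  "class_constant \<theta> h \<longleftrightarrow> (\<forall>(x, y)\<in>\<theta>. int p dvd h x - h y)"

lemma class_constant_difference:
  assumes "invariant \<theta>" "class_constant \<theta> h" "g \<in> G"
  shows "class_constant \<theta> (\<lambda>x. h (g x) - h x)"
  unfolding class_constant_def
proof clarify
  fix x y assume xy: "(x, y) \<in> \<theta>"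
  then have "(g x, g y) \<in> \<theta>" using assms by (auto simp: invariant_def)
  then have "int p dvd h (g x) - h (g y)" "int p dvd h x - h y"
    using assms(2) xy by (auto simp: class_constant_def)
  from dvd_diff[OF this] show "int p dvd h (g x) - h x - (h (g y) - h y)" by (simp add: algebra_simps)
qed

text \<open>By nilpotency some element outside the kernel of the action on the classes of \<open>\<theta>\<close> is central
  modulo that kernel; a power of it has prime order there, and transitivity makes it act freely.\<close>

lemma central_element:
  assumes \<theta>: "invariant \<theta>" and xy: "x \<in> X" "y \<in> X" "(x, y) \<notin> \<theta>"
  shows "\<exists>w\<in>G. \<exists>q. prime q \<and> (\<forall>x\<in>X. ((w ^^ q) x, x) \<in> \<theta>) \<and>
    (\<forall>i x. 0 < i \<and> i < q \<and> x \<in> X \<longrightarrow> ((w ^^ i) x, x) \<notin> \<theta>) \<and>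
    (\<forall>i. \<forall>g\<in>G. \<forall>x\<in>X. (g ((w ^^ i) x), (w ^^ i) (g x)) \<in> \<theta>)"
proof -
  have eq: "equiv X \<theta>" and inv\<theta>: "\<And>g x y. g \<in> G \<Longrightarrow> (x, y) \<in> \<theta> \<Longrightarrow> (g x, g y) \<in> \<theta>"
    using \<theta> by (auto simp: invariant_def)
  have refl: "x \<in> X \<Longrightarrow> (x, x) \<in> \<theta>" and sym: "(x, y) \<in> \<theta> \<Longrightarrow> (y, x) \<in> \<theta>"
    and tr: "(x, y) \<in> \<theta> \<Longrightarrow> (y, z) \<in> \<theta> \<Longrightarrow> (x, z) \<in> \<theta>" for x y z
    using eq by (auto simp: equiv_def refl_on_def dest: symD transD)
  define K where "K = {g \<in> G. \<forall>x\<in>X. (g x, x) \<in> \<theta>}"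
  have "id \<in> K" using id refl by (simp add: K_def)
  obtain g0 where "g0 \<in> G" "g0 x = y" using trans xy by blast
  then have g0: "g0 \<in> G - K" using xy sym by (auto simp: K_def)
  define cm where "cm g z = g \<circ> z \<circ> inv g \<circ> inv z" for g z :: "'a \<Rightarrow> 'a"
  have cmG: "cm g z \<in> G" if "g \<in> G" "z \<in> G" for g z
    unfolding cm_def by (intro comp inv that)
  \<comment> \<open>Otherwise every element outside K has a commutator outside K, and starting from
    \<open>g0\<close> one obtains an iterated commutator of length k that is not the
    identity.\<close>
  have "\<exists>z\<in>G - K. \<forall>g\<in>G. cm g z \<in> K"
  proof (rule ccontr)
    assume "\<not> ?thesis"
    then obtain \<gamma> where \<gamma>: "\<And>z. z \<in> G - K \<Longrightarrow> \<gamma> z \<in> G \<and> cm (\<gamma> z) z \<notin> K" by (auto simp: Bex_def Ball_def) metis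
    define zs where "zs = rec_nat g0 (\<lambda>_ z. cm (\<gamma> z) z)"
    have zs: "zs 0 = g0" "zs (Suc j) = cm (\<gamma> (zs j)) (zs j)" for j by (simp_all add: zs_def)
    have zsG: "zs j \<in> G - K" for j by (induction j) (use g0 \<gamma> cmG in \<open>auto simp: zs\<close>)
    define gs where "gs j = (case j of 0 \<Rightarrow> g0 | Suc i \<Rightarrow> \<gamma> (zs i))" for j
    have "iterated_commutator gs j = zs j" for j
      by (induction j) (auto simp: zs gs_def cm_def)
    moreover have "gs j \<in> G" for j using g0 \<gamma> zsG by (auto simp: gs_def split: nat.split)
    ultimately have "zs k = id" using nil by metis
    then show False using zsG[of k] \<open>id \<in> K\<close> by simp
  qed
  then obtain z where z: "z \<in> G" "z \<notin> K" "\<And>g. g \<in> G \<Longrightarrow> cm g z \<in> K" by blast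
  have comm: "(g (z x), z (g x)) \<in> \<theta>" if g: "g \<in> G" and x: "x \<in> X" for g x
  proof -
    have "inv z (z (g x)) = g x" "inv g (g x) = x"
      using permutes_inverses(2)[OF perm] z(1) g by auto
    then have "cm g z (z (g x)) = g (z x)" by (simp add: cm_def)
    moreover have "(cm g z (z (g x)), z (g x)) \<in> \<theta>"
      using z(3)[OF g] act z(1) g x by (auto simp: K_def)
    ultimately show ?thesis by simp
  qed
  have commpow: "(g ((z ^^ i) x), (z ^^ i) (g x)) \<in> \<theta>" if g: "g \<in> G" and x: "x \<in> X" for g x i
  proof (induction i)
    case (Suc i)
    have "(g (z ((z ^^ i) x)), z (g ((z ^^ i) x))) \<in> \<theta>" using comm g act[OF pow] z(1) x by blast
    moreover have "(z (g ((z ^^ i) x)), z ((z ^^ i) (g x))) \<in> \<theta>" using Suc inv\<theta> z(1) by blast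
    ultimately show ?case using tr by auto
  qed (simp add: refl act g x)
  \<comment> \<open>A power of z that fixes one class commutes modulo \<theta> with a transitive
    group, so it fixes all classes.\<close>
  have free: "z ^^ i \<in> K" if h: "((z ^^ i) x, x) \<in> \<theta>" and x: "x \<in> X" for i x
  proof -
    have "((z ^^ i) y, y) \<in> \<theta>" if "y \<in> X" for y
    proof -
      obtain g where g: "g \<in> G" "g x = y" using trans x \<open>y \<in> X\<close> by blast
      then have "(g ((z ^^ i) x), (z ^^ i) y) \<in> \<theta>" using commpow x by blast
      moreover have "(g ((z ^^ i) x), y) \<in> \<theta>" using inv\<theta>[OF g(1) h] g(2) by simp
      ultimately show ?thesis using tr sym by blast
    qed
    then show ?thesis using pow z(1) by (simp add: K_def)
  qed
  define e where "e = (LEAST e. e > 0 \<and> z ^^ e \<in> K)"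
  obtain e0 where "e0 > 0" "z ^^ e0 = id" using permutes_funpow_eq_id[OF finX perm[OF z(1)]] by blast
  then have "e0 > 0 \<and> z ^^ e0 \<in> K" using \<open>id \<in> K\<close> by simp
  then have e: "e > 0" "z ^^ e \<in> K" unfolding e_def by (metis (mono_tags, lifting) LeastI)+
  have least: "z ^^ i \<notin> K" if "0 < i" "i < e" for i
    using that not_less_Least[of i] unfolding e_def by auto
  have "e \<noteq> 1" using e z(2) by auto
  \<comment> \<open>Here e is the order of z modulo K; the power with exponent e / q has prime order
    q there.\<close>
  then obtain q where q: "prime q" "q dvd e" using prime_factor_nat by blast
  then obtain r where r: "e = r * q" by (metis dvd_def mult.commute)
  have r0: "r > 0" "q > 0" using e r by (auto intro: Nat.gr0I)
  show ?thesis
  proof (intro bexI[of _ "z ^^ r"] exI[of _ q] conjI q(1) ballI allI impI pow z(1))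
    show "(g (((z ^^ r) ^^ i) x), ((z ^^ r) ^^ i) (g x)) \<in> \<theta>" if "g \<in> G" "x \<in> X" for g x i
      using commpow[OF that] by (simp add: funpow_mult)
    show "(((z ^^ r) ^^ q) x, x) \<in> \<theta>" if "x \<in> X" for x
      using e(2) that by (simp add: funpow_mult r K_def)
    show "(((z ^^ r) ^^ i) x, x) \<notin> \<theta>" if "0 < i \<and> i < q \<and> x \<in> X" for i x
    proof
      assume "(((z ^^ r) ^^ i) x, x) \<in> \<theta>"
      then have "z ^^ (r * i) \<in> K" using free that by (simp add: funpow_mult)
      moreover have "0 < r * i" "r * i < e" using that r r0 by auto
      ultimately show False using least by blast
    qed
  qed
qed

text \<open>Merging the classes in each orbit of a central w divides their number by the prime order
  of w, which must therefore be p. The coarser relation falls under the induction hypothesis. As (w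
  - 1)^p annihilates h modulo p, h itself is reached by removing the factors w - 1 one by
  one.\<close>

lemma class_constant_in_V:
  "invariant \<theta> \<Longrightarrow> card (X // \<theta>) = p ^ r \<Longrightarrow> class_constant \<theta> h \<Longrightarrow> \<exists>j. h \<in> V j"
proof (induction r arbitrary: \<theta> h)
  case 0
  have eq: "equiv X \<theta>" using 0 by (simp add: invariant_def)
  have all: "(x, y) \<in> \<theta>" if "x \<in> X" "y \<in> X" for x y
  proof -
    have "\<theta> `` {x} \<in> X // \<theta>" "\<theta> `` {y} \<in> X // \<theta>" using that by (auto intro: quotientI)
    then have "\<theta> `` {x} = \<theta> `` {y}" using 0(2) by (metis card_1_singletonE power_0 singletonD)
    then show ?thesis using eq_equiv_class[OF _ eq that(2)] by simp
  qed
  have "h \<in> V 1" using 0(3) act all unfolding class_constant_def by fastforce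
  then show ?case by blast
next
  case (Suc r)
  have eq: "equiv X \<theta>" and inv\<theta>: "\<And>g x y. g \<in> G \<Longrightarrow> (x, y) \<in> \<theta> \<Longrightarrow> (g x, g y) \<in> \<theta>"
    using Suc.prems(1) by (auto simp: invariant_def)
  have refl: "x \<in> X \<Longrightarrow> (x, x) \<in> \<theta>" and sym: "(x, y) \<in> \<theta> \<Longrightarrow> (y, x) \<in> \<theta>"
    and tr: "(x, y) \<in> \<theta> \<Longrightarrow> (y, z) \<in> \<theta> \<Longrightarrow> (x, z) \<in> \<theta>" and inX: "(x, y) \<in> \<theta> \<Longrightarrow> x \<in> X \<and> y \<in> X" for x y z
    using eq by (auto simp: equiv_def refl_on_def dest: symD transD)
  have "\<exists>x\<in>X. \<exists>y\<in>X. (x, y) \<notin> \<theta>"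
  proof (rule ccontr)
    assume "\<not> ?thesis"
    then have "\<theta> `` {x} = X" if "x \<in> X" for x using that inX by blast
    then have "X // \<theta> \<subseteq> {X}" by (auto simp: quotient_def)
    then have "card (X // \<theta>) \<le> 1" by (metis card_mono finite.intros is_singletonI is_singleton_altdef)
    moreover have "p ^ Suc r > 1" using prime prime_gt_1_nat one_less_power by blast
    ultimately show False using Suc.prems(2) by simp
  qed
  then obtain w q where w: "w \<in> G" and q: "prime q" and wq: "\<And>x. x \<in> X \<Longrightarrow> ((w ^^ q) x, x) \<in> \<theta>"
    and free: "\<And>i x. 0 < i \<Longrightarrow> i < q \<Longrightarrow> x \<in> X \<Longrightarrow> ((w ^^ i) x, x) \<notin> \<theta>"
    and commpow: "\<And>g x i. g \<in> G \<Longrightarrow> x \<in> X \<Longrightarrow> (g ((w ^^ i) x), (w ^^ i) (g x)) \<in> \<theta>"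
    using central_element[OF Suc.prems(1)] by metis
  have q0: "q > 0" using q prime_gt_0_nat by blast
  have wX: "(w ^^ i) x \<in> X" if "x \<in> X" for i x using act[OF pow[OF w]] that .
  have inv_pow: "((w ^^ i) x, (w ^^ i) y) \<in> \<theta>" if "(x, y) \<in> \<theta>" for i x y using inv\<theta>[OF pow[OF w]] that .
  have mult: "((w ^^ (m * q)) x, x) \<in> \<theta>" if "x \<in> X" for m x
  proof (induction m)
    case (Suc m)
    have "((w ^^ q) ((w ^^ (m * q)) x), (w ^^ (m * q)) x) \<in> \<theta>" using wq wX that by blast
    then show ?case using Suc tr by (auto simp: funpow_add)
  qed (simp add: refl that)
  have reduce: "((w ^^ i) x, (w ^^ (i mod q)) x) \<in> \<theta>" if "x \<in> X" for i x
  proof -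
    have "w ^^ i = w ^^ (i mod q + (i div q) * q)" by simp
    then have "(w ^^ i) x = (w ^^ (i mod q)) ((w ^^ ((i div q) * q)) x)" unfolding funpow_add by simp
    then show ?thesis using inv_pow[OF mult[OF that]] by simp
  qed
  define \<theta>' where "\<theta>' = {(x, y). x \<in> X \<and> y \<in> X \<and> (\<exists>i. ((w ^^ i) x, y) \<in> \<theta>)}"
  have sub: "(x, y) \<in> \<theta> \<Longrightarrow> (x, y) \<in> \<theta>'" for x y
    using inX by (auto simp: \<theta>'_def intro!: exI[of _ 0])
  have eq': "equiv X \<theta>'"
  proof (rule equivI)
    show "\<theta>' \<subseteq> X \<times> X" by (auto simp: \<theta>'_def)
    show "refl_on X \<theta>'" using refl sub by (auto simp: refl_on_def)
    show "sym \<theta>'"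
    proof (rule symI)
      fix x y assume "(x, y) \<in> \<theta>'"
      then obtain i where i: "((w ^^ i) x, y) \<in> \<theta>" "x \<in> X" "y \<in> X" by (auto simp: \<theta>'_def)
      have "((w ^^ (i * (q - 1))) ((w ^^ i) x), (w ^^ (i * (q - 1))) y) \<in> \<theta>"
        using inv_pow i(1) .
      moreover have "(w ^^ (i * (q - 1))) ((w ^^ i) x) = (w ^^ (i * q)) x"
      proof -
        have "i * (q - 1) + i = i * q" using q0 by (cases q) auto
        then show ?thesis by (metis comp_apply funpow_add)
      qed
      ultimately have "((w ^^ (i * (q - 1))) y, x) \<in> \<theta>" using mult[OF i(2)] tr sym by metis
      then show "(y, x) \<in> \<theta>'" using i by (auto simp: \<theta>'_def)
    qed
    show "trans \<theta>'"
    proof (rule transI)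
      fix x y z assume "(x, y) \<in> \<theta>'" "(y, z) \<in> \<theta>'"
      then obtain i j where ij: "((w ^^ i) x, y) \<in> \<theta>" "((w ^^ j) y, z) \<in> \<theta>" "x \<in> X" "z \<in> X"
        by (auto simp: \<theta>'_def)
      have "((w ^^ j) ((w ^^ i) x), z) \<in> \<theta>" using inv_pow[OF ij(1)] ij(2) tr by blast
      then have "((w ^^ (j + i)) x, z) \<in> \<theta>" by (simp add: funpow_add)
      then show "(x, z) \<in> \<theta>'" using ij by (auto simp: \<theta>'_def)
    qed
  qed
  have inv': "invariant \<theta>'"
    unfolding invariant_def
  proof (intro conjI eq' ballI, clarify)
    fix g x y assume g: "g \<in> G" and "(x, y) \<in> \<theta>'"
    then obtain i where i: "((w ^^ i) x, y) \<in> \<theta>" "x \<in> X" "y \<in> X" by (auto simp: \<theta>'_def)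
    have "((w ^^ i) (g x), g y) \<in> \<theta>" using commpow[OF g i(2)] inv\<theta>[OF g i(1)] tr sym by blast
    then show "(g x, g y) \<in> \<theta>'" using act g i by (auto simp: \<theta>'_def)
  qed
  have fin: "finite (X // \<theta>)" "finite (X // \<theta>')"
    using finX eq eq' by (auto intro!: finite_quotient simp: equiv_def)
  have image': "\<theta>' `` (\<theta> `` {x}) = \<theta>' `` {x}" if "x \<in> X" for x
  proof -
    have "(x, z) \<in> \<theta>'" if "(x, y) \<in> \<theta>" "(y, z) \<in> \<theta>'" for y z
      using eq' sub[OF that(1)] that(2) by (meson equivE transD)
    then show ?thesis using refl[OF that] by blast
  qed
  \<comment> \<open>A class of \<open>\<theta>'\<close> is the union of the translates of one class
    of \<theta> under the powers of w below q, which are distinct because w acts freely.\<close>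
  have fibre: "card {c \<in> X // \<theta>. \<theta>' `` c = C} = q" if C: "C \<in> X // \<theta>'" for C
  proof -
    obtain x where x: "x \<in> X" "C = \<theta>' `` {x}" using C by (auto elim: quotientE)
    let ?c = "\<lambda>i. \<theta> `` {(w ^^ i) x}"
    have "{c \<in> X // \<theta>. \<theta>' `` c = C} = ?c ` {..<q}"
    proof (intro set_eqI iffI)
      fix c assume "c \<in> {c \<in> X // \<theta>. \<theta>' `` c = C}"
      then obtain y where y: "y \<in> X" "c = \<theta> `` {y}" "\<theta>' `` {y} = \<theta>' `` {x}"
        using x image' by (auto elim!: quotientE)
      then have "(x, y) \<in> \<theta>'" using eq_equiv_class[OF y(3)[symmetric] eq' y(1)] by simp
      then obtain i where "((w ^^ i) x, y) \<in> \<theta>" by (auto simp: \<theta>'_def)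
      then have "((w ^^ (i mod q)) x, y) \<in> \<theta>" using reduce[OF x(1)] tr sym by blast
      then have "?c (i mod q) = c" using equiv_class_eq[OF eq] y by simp
      then show "c \<in> ?c ` {..<q}" using q0 by (intro image_eqI[of _ _ "i mod q"]) auto
    next
      fix c assume "c \<in> ?c ` {..<q}"
      then obtain i where i: "c = ?c i" by blast
      have "(x, (w ^^ i) x) \<in> \<theta>'" using refl wX x by (auto simp: \<theta>'_def)
      then have "\<theta>' `` {x} = \<theta>' `` {(w ^^ i) x}" by (rule equiv_class_eq[OF eq'])
      then have "\<theta>' `` c = C" using i x image'[OF wX[OF x(1)]] by simp
      moreover have "c \<in> X // \<theta>" unfolding i by (rule quotientI) (rule wX[OF x(1)])
      ultimately show "c \<in> {c \<in> X // \<theta>. \<theta>' `` c = C}" by blast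
    qed
    moreover have "inj_on ?c {..<q}"
    proof -
      have neq: False if "i < j" "j < q" "?c i = ?c j" for i j
      proof -
        have ij: "((w ^^ j) x, (w ^^ i) x) \<in> \<theta>"
          using eq_equiv_class[OF that(3) eq] wX x sym by blast
        moreover have "(w ^^ j) x = (w ^^ (j - i)) ((w ^^ i) x)"
        proof -
          have "j = j - i + i" using that by simp
          then show ?thesis by (metis comp_apply funpow_add)
        qed
        ultimately show False using free[of "j - i" "(w ^^ i) x"] that wX x by auto
      qed
      show ?thesis
      proof (rule inj_onI)
        fix i j assume "i \<in> {..<q}" "j \<in> {..<q}" "?c i = ?c j"
        then show "i = j" using neq[of i j] neq[of j i] by (cases i j rule: linorder_cases) auto
      qed
    qed
    ultimately show ?thesis by (simp add: card_image)
  qed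
  have "(\<Sum>C\<in>X // \<theta>'. \<Sum>c\<in>{c \<in> X // \<theta>. \<theta>' `` c = C}. 1) = (\<Sum>c\<in>X // \<theta>. (1::nat))"
  proof (rule sum.group[OF fin])
    show "(``) \<theta>' ` (X // \<theta>) \<subseteq> X // \<theta>'"
      using image' by (auto elim!: quotientE intro: quotientI)
  qed
  then have card: "card (X // \<theta>') * q = p ^ Suc r"
    using fibre Suc.prems(2) by simp
  then have "q dvd p ^ Suc r" by (metis dvd_triv_right)
  then have "q = p" using q prime by (meson prime_dvd_power primes_dvd_imp_eq)
  then have card': "card (X // \<theta>') = p ^ r" using card q0 by simp
  let ?\<Delta> = "\<lambda>h x. h (w x) - h x"
  \<comment> \<open>If w - 1 annihilates h, then h is constant on the coarser classes. In the other
    case w commutes with every g modulo \<theta>, so (w - 1)(g - 1) h lies one term lower than (w -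
    1) h; G is finite, so the levels found for all g have a common bound.\<close>
  have lift: "class_constant \<theta> h \<Longrightarrow> ?\<Delta> h \<in> V j \<Longrightarrow> \<exists>j'. h \<in> V j'" for j h
  proof (induction j arbitrary: h)
    case 0
    have "int p dvd h x - h ((w ^^ i) x)" if "x \<in> X" for x i
    proof (induction i)
      case (Suc i)
      have "int p dvd h (w ((w ^^ i) x)) - h ((w ^^ i) x)" using 0(2) wX that by simp
      from dvd_diff[OF Suc this] show ?case by simp
    qed simp
    note powers = this
    have "int p dvd h x - h y" if xy: "(x, y) \<in> \<theta>'" for x y
    proof -
      obtain i where i: "((w ^^ i) x, y) \<in> \<theta>" "x \<in> X" using xy by (auto simp: \<theta>'_def)
      then have "int p dvd h ((w ^^ i) x) - h y" using 0(1) by (auto simp: class_constant_def)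
      from dvd_add[OF powers[OF i(2), of i] this] show ?thesis by simp
    qed
    then have "class_constant \<theta>' h" by (auto simp: class_constant_def)
    then show ?case using Suc.IH[OF inv' card'] by blast
  next
    case (Suc j)
    have "\<exists>j'. (\<lambda>x. h (g x) - h x) \<in> V j'" if g: "g \<in> G" for g
    proof (rule Suc.IH)
      show "class_constant \<theta> (\<lambda>x. h (g x) - h x)"
        using class_constant_difference[OF \<open>invariant \<theta>\<close> Suc.prems(1) g] .
      show "?\<Delta> (\<lambda>x. h (g x) - h x) \<in> V j"
      proof (rule V_cong)
        show "(\<lambda>x. ?\<Delta> h (g x) - ?\<Delta> h x) \<in> V j" using Suc.prems(2) g by simp
        fix x assume "x \<in> X"
        then have "(w (g x), g (w x)) \<in> \<theta>" using commpow[OF g, of x 1] sym by simp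
        then have "int p dvd h (w (g x)) - h (g (w x))"
          using Suc.prems(1) by (auto simp: class_constant_def)
        then show "int p dvd ?\<Delta> h (g x) - ?\<Delta> h x - ?\<Delta> (\<lambda>x. h (g x) - h x) x"
          by (simp add: algebra_simps)
      qed
    qed
    then obtain J where J: "\<And>g. g \<in> G \<Longrightarrow> (\<lambda>x. h (g x) - h x) \<in> V (J g)" by metis
    have "h \<in> V (Suc (sum J G))"
      using J V_mono[OF member_le_sum[of _ G J]] finG by fastforce
    then show ?case by blast
  qed
  have const: "class_constant \<theta> (differences w i h)" for i
    using class_constant_difference[OF \<open>invariant \<theta>\<close> _ w] Suc.prems(3) by (induction i) auto
  have "differences w i h \<in> V j \<Longrightarrow> \<exists>j'. h \<in> V j'" for i j
  proof (induction i arbitrary: j)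
    case (Suc i)
    then obtain j' where "differences w i h \<in> V j'" using lift[OF const[of i], of j] by auto
    then show ?case by (rule Suc.IH)
  qed auto
  moreover have "differences w p h \<in> V 0"
  proof -
    have "int p dvd differences w p h x" if "x \<in> X" for x
    proof -
      have "int p dvd h ((w ^^ p) x) - h x"
        using wq[OF that] Suc.prems(3) \<open>q = p\<close> by (auto simp: class_constant_def)
      from dvd_add[OF differences_prime[OF prime, of w h x] this] show ?thesis by (simp add: algebra_simps)
    qed
    then show ?thesis by simp
  qed
  ultimately show ?case by blast
qed

theorem all_in_V:
  assumes "card X = p ^ m"
  shows "\<exists>j. h \<in> V j"
proof (rule class_constant_in_V)
  show "invariant (Id_on X)" using act by (auto simp: invariant_def intro!: equivI refl_onI symI transI)
  have "X // Id_on X = (\<lambda>x. {x}) ` X" by (auto simp: quotient_def)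
  then show "card (X // Id_on X) = p ^ m" using assms by (simp add: card_image)
qed (auto simp: class_constant_def)

end

section \<open>The group of polynomial permutations\<close>

lemma iterated_commutator_cong:
  "(\<And>i. i \<le> j \<Longrightarrow> g i = g' i) \<Longrightarrow> iterated_commutator g j = iterated_commutator g' j"
  by (induction j) auto

text \<open>This makes iterated commutators absorbing as soon as each entry has parameters at which
  it is trivial.\<close>

lemma iterated_commutator_eq_id:
  assumes "i \<le> j" "g i = id" "\<And>l. l \<le> j \<Longrightarrow> bij (g l)"
  shows "iterated_commutator g j = id"
proof -
  have bij: "bij (iterated_commutator g l)" if "l \<le> j" for l
    using that by (induction l) (auto intro!: bij_comp bij_imp_bij_inv assms(3))
  have cancel: "f \<circ> inv f = id" if "bij f" for f :: "'a \<Rightarrow> 'a"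
    using that by (metis bij_is_surj surj_iff)
  show ?thesis
    using assms(1) bij assms(3)
  proof (induction j rule: dec_induct)
    case base
    show ?case
    proof (cases i)
      case 0
      then show ?thesis using assms(2) by simp
    next
      case (Suc l)
      then show ?thesis using assms(2) base(1)[of l] cancel by (simp add: comp_assoc)
    qed
  next
    case (step n)
    then have "iterated_commutator g n = id" by (meson Suc_leD le_SucI)
    then show ?case using cancel[of "g (Suc n)"] step.prems(2) by simp
  qed
qed

section \<open>Permutations depending polynomially on parameters\<close>

context finite_algebra
begin

definition depends :: "((nat \<Rightarrow> 'a) \<Rightarrow> 'b) \<Rightarrow> nat set \<Rightarrow> bool" where
  "depends E I \<longleftrightarrow> (\<forall>\<rho>\<in>vals. \<forall>\<rho>'\<in>vals. (\<forall>i\<in>I. \<rho> i = \<rho>' i) \<longrightarrow> E \<rho> = E \<rho>')"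

definition junta :: "nat \<Rightarrow> ((nat \<Rightarrow> 'a) \<Rightarrow> 'b) \<Rightarrow> bool" where
  "junta D E \<longleftrightarrow> (\<exists>I. finite I \<and> card I \<le> D \<and> depends E I)"

lemma dependsD: "depends E I \<Longrightarrow> \<rho> \<in> vals \<Longrightarrow> \<rho>' \<in> vals \<Longrightarrow> (\<And>i. i \<in> I \<Longrightarrow> \<rho> i = \<rho>' i) \<Longrightarrow> E \<rho> = E \<rho>'"
  unfolding depends_def by blast

text \<open>Variable 0 of the polynomial is the point that is moved, the others are shifted by one
  and act as parameters. Outside the universe the permutations are the identity, so that members can
  be compared as functions.\<close>

definition perm_family :: "((nat \<Rightarrow> 'a) \<Rightarrow> 'a \<Rightarrow> 'a) \<Rightarrow> bool" where
  "perm_family \<Gamma> \<longleftrightarrow> (\<exists>F\<in>pol. \<forall>\<rho>\<in>vals. \<forall>z\<in>univ A. \<Gamma> \<rho> z = F (case_nat z \<rho>)) \<and>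
     (\<forall>\<rho>\<in>vals. \<Gamma> \<rho> permutes univ A)"

lemma case_nat_vals: "z \<in> univ A \<Longrightarrow> \<rho> \<in> vals \<Longrightarrow> case_nat z \<rho> \<in> vals"
  by (auto intro!: valsI simp: vals_nth split: nat.split)

lemma perm_family_permutes: "perm_family \<Gamma> \<Longrightarrow> \<rho> \<in> vals \<Longrightarrow> \<Gamma> \<rho> permutes univ A"
  by (simp add: perm_family_def)

lemma perm_family_id: "perm_family (\<lambda>\<rho>. id)"
  unfolding perm_family_def by (auto intro!: bexI[of _ "\<lambda>\<rho>. \<rho> 0"] pol.var permutes_id)

lemma perm_family_comp:
  assumes "perm_family \<Gamma>" "perm_family \<Delta>"
  shows "perm_family (\<lambda>\<rho>. \<Gamma> \<rho> \<circ> \<Delta> \<rho>)"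
proof -
  obtain F G where F: "F \<in> pol" "\<forall>\<rho>\<in>vals. \<forall>z\<in>univ A. \<Gamma> \<rho> z = F (case_nat z \<rho>)"
    and G: "G \<in> pol" "\<forall>\<rho>\<in>vals. \<forall>z\<in>univ A. \<Delta> \<rho> z = G (case_nat z \<rho>)"
    using assms by (auto simp: perm_family_def)
  have "(\<lambda>\<sigma>. F (\<lambda>i. (case i of 0 \<Rightarrow> G | Suc j \<Rightarrow> (\<lambda>\<sigma>. \<sigma> (Suc j))) \<sigma>)) \<in> pol" (is "?H \<in> pol")
    by (rule pol_subst[OF F(1)]) (auto intro: pol.var G split: nat.split)
  moreover have "(\<Gamma> \<rho> \<circ> \<Delta> \<rho>) z = ?H (case_nat z \<rho>)" if "\<rho> \<in> vals" "z \<in> univ A" for \<rho> z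
  proof -
    have "\<Delta> \<rho> z \<in> univ A" using assms(2) that by (simp add: perm_family_def permutes_in_image)
    moreover have "(\<lambda>i. (case i of 0 \<Rightarrow> G | Suc j \<Rightarrow> (\<lambda>\<sigma>. \<sigma> (Suc j))) (case_nat z \<rho>)) = case_nat (\<Delta> \<rho> z) \<rho>"
      using G(2) that by (auto split: nat.split)
    ultimately show ?thesis using F(2) that by simp
  qed
  moreover have "\<Gamma> \<rho> \<circ> \<Delta> \<rho> permutes univ A" if "\<rho> \<in> vals" for \<rho>
    using assms that by (intro permutes_compose perm_family_permutes)
  ultimately show ?thesis unfolding perm_family_def by (intro conjI bexI[of _ ?H]) simp_all
qed

lemma perm_family_subst:
  assumes "perm_family \<Gamma>" "\<And>i. H i \<in> pol"
  shows "perm_family (\<lambda>\<rho>. \<Gamma> (\<lambda>i. H i \<rho>))"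
proof -
  obtain F where F: "F \<in> pol" "\<forall>\<rho>\<in>vals. \<forall>z\<in>univ A. \<Gamma> \<rho> z = F (case_nat z \<rho>)"
    using assms by (auto simp: perm_family_def)
  have val: "(\<lambda>i. H i \<rho>) \<in> vals" if "\<rho> \<in> vals" for \<rho> using assms(2) that pol_closed by (auto intro!: valsI)
  have "(\<lambda>\<sigma>. H j (\<lambda>l. \<sigma> (Suc l))) \<in> pol" for j
    using pol_subst[OF assms(2), of "\<lambda>l \<sigma>. \<sigma> (Suc l)"] by (simp add: pol.var)
  then have "(\<lambda>\<sigma>. F (\<lambda>i. (case i of 0 \<Rightarrow> (\<lambda>\<sigma>. \<sigma> 0) | Suc j \<Rightarrow> (\<lambda>\<sigma>. H j (\<lambda>l. \<sigma> (Suc l)))) \<sigma>)) \<in> pol" (is "?H \<in> pol")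
    by (intro pol_subst[OF F(1)]) (auto intro: pol.var split: nat.split)
  moreover have "\<Gamma> (\<lambda>i. H i \<rho>) z = ?H (case_nat z \<rho>)" if "\<rho> \<in> vals" "z \<in> univ A" for \<rho> z
  proof -
    have "(\<lambda>i. (case i of 0 \<Rightarrow> (\<lambda>\<sigma>. \<sigma> 0) | Suc j \<Rightarrow> (\<lambda>\<sigma>. H j (\<lambda>l. \<sigma> (Suc l)))) (case_nat z \<rho>)) =
        case_nat z (\<lambda>i. H i \<rho>)"
      by (auto split: nat.split)
    then show ?thesis using F(2) val that by simp
  qed
  moreover have "\<Gamma> (\<lambda>i. H i \<rho>) permutes univ A" if "\<rho> \<in> vals" for \<rho>
    using perm_family_permutes[OF assms(1) val[OF that]] .
  ultimately show ?thesis unfolding perm_family_def by (intro conjI bexI[of _ ?H]) simp_all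
qed

lemma uniform_exponent: "\<exists>N>0. \<forall>g. g permutes univ A \<longrightarrow> g ^^ N = id"
proof -
  let ?P = "{g. g permutes univ A}"
  obtain e where e: "\<And>g. g permutes univ A \<Longrightarrow> e g > 0 \<and> g ^^ e g = id"
    using permutes_funpow_eq_id[OF fin] by metis
  have finP: "finite ?P" using fin by (rule finite_permutations)
  have "g ^^ prod e ?P = id" if "g permutes univ A" for g
  proof -
    have "e g dvd prod e ?P" using finP that by (intro dvd_prodI) auto
    then obtain c where "prod e ?P = e g * c" unfolding dvd_def by blast
    moreover have "(id ^^ c) = (id :: 'a \<Rightarrow> 'a)" by (rule id_funpow)
    ultimately show ?thesis using e[OF that] by (simp flip: funpow_mult)
  qed
  moreover have "prod e ?P > 0" using e by (intro prod_pos) auto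
  ultimately show ?thesis by blast
qed

text \<open>With an exponent common to all permutations of the universe, inversion is a power and
  hence stays polynomial.\<close>

lemma perm_family_inv:
  assumes "perm_family \<Gamma>"
  shows "perm_family (\<lambda>\<rho>. inv (\<Gamma> \<rho>))"
proof -
  obtain N where N: "N > 0" "\<And>g. g permutes univ A \<Longrightarrow> g ^^ N = id" using uniform_exponent by blast
  have pw: "perm_family (\<lambda>\<rho>. \<Gamma> \<rho> ^^ i)" for i
    by (induction i) (simp_all only: funpow.simps perm_family_id perm_family_comp[OF assms])
  have inv: "inv (\<Gamma> \<rho>) = \<Gamma> \<rho> ^^ (N - 1)" if "\<rho> \<in> vals" for \<rho>
  proof (rule inv_unique_comp)
    have "\<Gamma> \<rho> ^^ N = id" using N(2) assms that by (simp add: perm_family_def)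
    moreover have "N = Suc (N - 1)" using N(1) by simp
    ultimately show "\<Gamma> \<rho> \<circ> \<Gamma> \<rho> ^^ (N - 1) = id" "\<Gamma> \<rho> ^^ (N - 1) \<circ> \<Gamma> \<rho> = id"
      by (metis funpow.simps(2), metis funpow_Suc_right)
  qed
  show ?thesis using pw[of "N - 1"] inv unfolding perm_family_def by simp
qed

end

context supernilpotent_algebra
begin

text \<open>If parameters \<rho> collapsed u and v, the k-fold chain of F that collapses them at
  \<rho> and passes them on unchanged at \<open>\<rho>0\<close> would give u = v. So all members are
  injective on a finite set.\<close>

lemma perm_familyI:
  assumes F: "F \<in> pol" and \<rho>0: "\<rho>0 \<in> vals" "\<And>z. z \<in> univ A \<Longrightarrow> F (case_nat z \<rho>0) = z"
  shows "perm_family (\<lambda>\<rho> z. if z \<in> univ A then F (case_nat z \<rho>) else z)"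
proof -
  have "inj_on (\<lambda>z. F (case_nat z \<rho>)) (univ A)" if \<rho>: "\<rho> \<in> vals" for \<rho>
  proof (rule inj_onI)
    fix u v assume uv: "u \<in> univ A" "v \<in> univ A" "F (case_nat u \<rho>) = F (case_nat v \<rho>)"
    have upd: "(case_nat a \<sigma>)(0 := z) = case_nat z \<sigma>" for a z :: 'a and \<sigma>
      by (auto split: nat.split)
    show "u = v"
      by (rule no_separating_chain[where g = "\<lambda>_. F" and ?y0.0 = "\<lambda>_. case_nat u \<rho>" and
            ?y1.0 = "\<lambda>_. case_nat u \<rho>0" and u = "\<lambda>_. u" and v = "\<lambda>_. v"])
        (use F uv \<rho> \<rho>0 in \<open>auto simp: upd case_nat_vals\<close>)
  qed
  then have "bij_betw (\<lambda>z. F (case_nat z \<rho>)) (univ A) (univ A)" if "\<rho> \<in> vals" for \<rho>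
    using that endo_inj_surj[OF fin, of "\<lambda>z. F (case_nat z \<rho>)"] pol_closed[OF F] case_nat_vals
    by (simp add: bij_betw_def image_subset_iff)
  then have "(\<lambda>z. if z \<in> univ A then F (case_nat z \<rho>) else z) permutes univ A" if "\<rho> \<in> vals" for \<rho>
    using that by (intro bij_imp_permutes) (simp_all cong: bij_betw_cong)
  then show ?thesis using F unfolding perm_family_def by auto
qed

lemma perm_family_absorbing:
  assumes \<Gamma>: "perm_family \<Gamma>" and ab: "a \<in> vals" "b \<in> vals"
    and S: "\<And>S. S \<subset> {..k} \<Longrightarrow> \<Gamma> (mix col a b S) = id"
  shows "\<Gamma> (mix col a b {..k}) = id"
proof
  fix z
  obtain F where F: "F \<in> pol" "\<And>\<rho> z. \<rho> \<in> vals \<Longrightarrow> z \<in> univ A \<Longrightarrow> \<Gamma> \<rho> z = F (case_nat z \<rho>)"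
    using \<Gamma> by (auto simp: perm_family_def)
  \<comment> \<open>The moved point z receives the colour \<open>Suc k\<close>, which is never
    switched, so it acts as a constant.\<close>
  have mx: "mix (case_nat (Suc k) col) (case_nat z a) (case_nat z b) S = case_nat z (mix col a b S)"
    if "S \<subseteq> {..k}" for S
    using that by (auto simp: mix_def split: nat.split)
  show "\<Gamma> (mix col a b {..k}) z = id z"
  proof (cases "z \<in> univ A")
    case True
    have "F (mix (case_nat (Suc k) col) (case_nat z a) (case_nat z b) {..k}) = z"
    proof (rule absorbing_trivial[OF F(1)])
      fix S assume "S \<subset> {..k}"
      then show "F (mix (case_nat (Suc k) col) (case_nat z a) (case_nat z b) S) = z"
        using S F(2)[OF mix_vals[OF ab] True] by (simp add: mx psubset_imp_subset) (metis id_apply)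
    qed (use case_nat_vals True ab in auto)
    then show ?thesis using F(2)[OF mix_vals[OF ab] True] by (simp add: mx)
  next
    case False
    then show ?thesis using permutes_not_in[OF perm_family_permutes[OF \<Gamma> mix_vals[OF ab]]] by simp
  qed
qed

definition polynomial_group :: "('a \<Rightarrow> 'a) set" where
  "polynomial_group = {\<Gamma> \<rho> | \<Gamma> \<rho>. perm_family \<Gamma> \<and> \<rho> \<in> vals \<and> (\<exists>\<rho>0\<in>vals. \<Gamma> \<rho>0 = id)}"

lemma polynomial_groupI:
  "perm_family \<Gamma> \<Longrightarrow> \<rho> \<in> vals \<Longrightarrow> \<rho>0 \<in> vals \<Longrightarrow> \<Gamma> \<rho>0 = id \<Longrightarrow> \<Gamma> \<rho> \<in> polynomial_group"
  by (auto simp: polynomial_group_def)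

lemma polynomial_group_comp:
  assumes "g \<in> polynomial_group" "h \<in> polynomial_group"
  shows "g \<circ> h \<in> polynomial_group"
proof -
  obtain \<Gamma> \<rho> \<rho>0 where g: "g = \<Gamma> \<rho>" "perm_family \<Gamma>" "\<rho> \<in> vals" "\<rho>0 \<in> vals" "\<Gamma> \<rho>0 = id"
    using assms(1) by (auto simp: polynomial_group_def)
  obtain \<Delta> \<sigma> \<sigma>0 where h: "h = \<Delta> \<sigma>" "perm_family \<Delta>" "\<sigma> \<in> vals" "\<sigma>0 \<in> vals" "\<Delta> \<sigma>0 = id"
    using assms(2) by (auto simp: polynomial_group_def)
  \<comment> \<open>Even and odd positions give the two factors separate parameters, so that one
    family covers both and is trivial where both are.\<close>
  define E where "E \<rho> \<sigma> i = (if even i then \<rho> (i div 2) else \<sigma> (i div 2))" for \<rho> \<sigma> :: "nat \<Rightarrow> 'a" and i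
  have E: "E \<rho> \<sigma> \<in> vals" if "\<rho> \<in> vals" "\<sigma> \<in> vals" for \<rho> \<sigma>
    using that by (auto simp: E_def vals_def)
  have E': "(\<lambda>i. E \<rho> \<sigma> (2 * i)) = \<rho>" "(\<lambda>i. E \<rho> \<sigma> (2 * i + 1)) = \<sigma>" for \<rho> \<sigma>
    by (auto simp: E_def)
  let ?\<Theta> = "\<lambda>\<rho>. \<Gamma> (\<lambda>i. \<rho> (2 * i)) \<circ> \<Delta> (\<lambda>i. \<rho> (2 * i + 1))"
  have "perm_family ?\<Theta>"
    by (intro perm_family_comp perm_family_subst[OF g(2)] perm_family_subst[OF h(2)] pol.var)
  then have "?\<Theta> (E \<rho> \<sigma>) \<in> polynomial_group"
    by (rule polynomial_groupI[where ?\<rho>0.0 = "E \<rho>0 \<sigma>0"]) (use E E' g h in auto)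
  then show ?thesis using g h E' by simp
qed

text \<open>Each of the k + 1 entries gets a colour of its own. If some colour is at its base point,
  that entry and thus the commutator is trivial; absorption makes the top corner trivial as
  well.\<close>

lemma polynomial_group_nilpotent:
  assumes "\<And>j. j \<le> k \<Longrightarrow> g j \<in> polynomial_group"
  shows "iterated_commutator g k = id"
proof -
  have "\<forall>j. \<exists>\<Gamma> d c. j \<le> k \<longrightarrow> g j = \<Gamma> d \<and> perm_family \<Gamma> \<and> d \<in> vals \<and> c \<in> vals \<and> \<Gamma> c = id"
    using assms by (fastforce simp: polynomial_group_def)
  then obtain \<Gamma> d c where \<Gamma>: "\<And>j. j \<le> k \<Longrightarrow>
      g j = \<Gamma> j (d j) \<and> perm_family (\<Gamma> j) \<and> d j \<in> vals \<and> c j \<in> vals \<and> \<Gamma> j (c j) = id"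
    by metis
  define w where "w = Suc k"
  define \<Omega> where "\<Omega> j \<rho> = iterated_commutator (\<lambda>j. \<Gamma> j (\<lambda>i. \<rho> (i * w + j))) j" for j \<rho>
  have fam: "perm_family (\<lambda>\<rho>. \<Gamma> j (\<lambda>i. \<rho> (i * w + j)))" if "j \<le> k" for j
    by (rule perm_family_subst[of "\<Gamma> j" "\<lambda>i \<rho>. \<rho> (i * w + j)"]) (use \<Gamma>[OF that] in \<open>auto intro: pol.var\<close>)
  have \<Omega>: "perm_family (\<Omega> j)" if "j \<le> k" for j
    using that
  proof (induction j)
    case (Suc j)
    then show ?case
      unfolding \<Omega>_def[abs_def] iterated_commutator.simps
      by (intro perm_family_comp perm_family_inv fam) auto
  qed (use fam[of 0] in \<open>simp add: \<Omega>_def[abs_def]\<close>)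
  define a where "a i = (c (i mod w) (i div w))" for i
  define b where "b i = (d (i mod w) (i div w))" for i
  have lt: "i mod w \<le> k" for i by (simp add: w_def flip: less_Suc_eq_le)
  have ab: "a \<in> vals" "b \<in> vals"
    unfolding a_def b_def using \<Gamma>[OF lt] by (blast intro: valsI vals_nth)+
  have mx: "\<Gamma> j (\<lambda>i. mix (\<lambda>i. i mod w) a b S (i * w + j)) = (if j \<in> S then g j else id)" if "j \<le> k" for j S
  proof -
    have "(i * w + j) mod w = j" "(i * w + j) div w = i" for i using that by (auto simp: w_def simp del: mult_Suc_right)
    then have "(\<lambda>i. mix (\<lambda>i. i mod w) a b S (i * w + j)) = (if j \<in> S then d j else c j)"
      by (auto simp: mix_def a_def b_def)
    then show ?thesis using \<Gamma>[OF that] by auto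
  qed
  have "\<Omega> k (mix (\<lambda>i. i mod w) a b {..k}) = id"
  proof (rule perm_family_absorbing[OF \<Omega> ab])
    fix S assume "S \<subset> {..k}"
    then obtain j where j: "j \<le> k" "j \<notin> S" by auto
    have "bij (if l \<in> S then g l else id)" if "l \<le> k" for l
      using \<Gamma>[OF that] perm_family_permutes permutes_bij by auto
    then have "iterated_commutator (\<lambda>j. if j \<in> S then g j else id) k = id"
      by (intro iterated_commutator_eq_id[OF j(1)]) (use j in auto)
    then show "\<Omega> k (mix (\<lambda>i. i mod w) a b S) = id"
      unfolding \<Omega>_def by (subst iterated_commutator_cong[OF mx]) auto
  qed simp
  then show ?thesis
    unfolding \<Omega>_def using mx[of _ "{..k}"] by (subst (asm) iterated_commutator_cong[where g' = g]) auto
qed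

text \<open>I collects the variables in which \<Gamma> is absorbing, n counts the untreated ones.
  Resetting the last untreated variable gives \<open>\<Gamma>0\<close>, and
  \<open>inv (\<Gamma>0 \<rho>) \<circ> \<Gamma> \<rho>\<close> is absorbing in that variable too.
  In the end either I has at most k elements or \<Gamma> is trivial.\<close>

lemma perm_family_decomposition:
  assumes o: "o' \<in> vals"
  shows "perm_family \<Gamma> \<Longrightarrow> \<Gamma> o' = id \<Longrightarrow> finite I \<Longrightarrow> I \<inter> {..<n} = {} \<Longrightarrow> depends \<Gamma> (I \<union> {..<n}) \<Longrightarrow>
    (\<And>\<rho> i. \<rho> \<in> vals \<Longrightarrow> i \<in> I \<Longrightarrow> \<rho> i = o' i \<Longrightarrow> \<Gamma> \<rho> = id) \<Longrightarrow>
    \<exists>\<Gamma>s. (\<forall>\<Delta>\<in>set \<Gamma>s. perm_family \<Delta> \<and> \<Delta> o' = id \<and> junta k \<Delta>) \<and>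
      (\<forall>\<rho>\<in>vals. \<Gamma> \<rho> = foldr (\<circ>) (map (\<lambda>\<Delta>. \<Delta> \<rho>) \<Gamma>s) id)"
proof (induction n arbitrary: \<Gamma> I)
  case 0
  show ?case
  proof (cases "card I \<le> k")
    case True
    then show ?thesis using 0 by (intro exI[of _ "[\<Gamma>]"]) (auto simp: junta_def)
  next
    case False
    then obtain T where T: "T \<subseteq> I" "card T = Suc k" "finite T"
      using obtain_subset_with_card_n[of "Suc k" I] by auto
    then obtain h where h: "bij_betw h {..k} T"
      using ex_bij_betw_nat_finite[of T] by (auto simp: lessThan_Suc_atMost atLeast0LessThan)
    define col where "col i = (if i \<in> T then inv_into {..k} h i else Suc k)" for i
    have col: "i \<in> T \<Longrightarrow> col i \<le> k" "j \<le> k \<Longrightarrow> h j \<in> T \<and> col (h j) = j" for i j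
      using h by (auto simp: col_def bij_betw_def inv_into_into[of _ h "{..k}", simplified])
    have "\<Gamma> \<rho> = id" if \<rho>: "\<rho> \<in> vals" for \<rho>
    proof -
      \<comment> \<open>Only the variables in T are reset; the others keep their values from \<rho>,
        so the top corner is \<rho> itself.\<close>
      let ?a = "\<lambda>i. if i \<in> T then o' i else \<rho> i"
      have a: "?a \<in> vals" using o \<rho> by (auto simp: vals_def)
      have "\<Gamma> (mix col ?a \<rho> {..k}) = id"
      proof (rule perm_family_absorbing[OF 0(1) a \<rho>])
        fix S assume "S \<subset> {..k}"
        then obtain j where j: "j \<le> k" "j \<notin> S" by auto
        then have "mix col ?a \<rho> S (h j) = o' (h j)" "h j \<in> I" using col(2)[of j] T(1) by (auto simp: mix_def)
        then show "\<Gamma> (mix col ?a \<rho> S) = id" using 0(6) mix_vals[OF a \<rho>] by blast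
      qed
      moreover have "mix col ?a \<rho> {..k} = \<rho>" using col(1) by (auto simp: mix_def)
      ultimately show ?thesis by simp
    qed
    then show ?thesis by (intro exI[of _ "[]"]) auto
  qed
next
  case (Suc n)
  define \<Gamma>0 where "\<Gamma>0 \<rho> = \<Gamma> (\<rho>(n := o' n))" for \<rho>
  define \<Gamma>1 where "\<Gamma>1 \<rho> = inv (\<Gamma>0 \<rho>) \<circ> \<Gamma> \<rho>" for \<rho>
  have upd: "\<rho>(n := o' n) \<in> vals" if "\<rho> \<in> vals" for \<rho> using vals_upd that o vals_nth by blast
  have "perm_family (\<lambda>\<rho>. \<Gamma> (\<lambda>i. (if i = n then (\<lambda>\<rho>. o' n) else (\<lambda>\<rho>. \<rho> i)) \<rho>))"
    using o by (intro perm_family_subst[OF Suc.prems(1)]) (auto intro: pol.var pol.const vals_nth)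
  moreover have "(\<lambda>i. (if i = n then (\<lambda>\<rho>. o' n) else (\<lambda>\<rho>. \<rho> i)) \<rho>) = \<rho>(n := o' n)" for \<rho>
    by auto
  ultimately have fam0: "perm_family \<Gamma>0" by (simp add: \<Gamma>0_def[abs_def])
  have fam1: "perm_family \<Gamma>1"
    unfolding \<Gamma>1_def by (intro perm_family_comp perm_family_inv fam0 Suc.prems)
  have split: "\<Gamma> \<rho> = \<Gamma>0 \<rho> \<circ> \<Gamma>1 \<rho>" if "\<rho> \<in> vals" for \<rho>
    using permutes_inv_o(1)[OF perm_family_permutes[OF fam0 that]]
    by (simp add: \<Gamma>1_def comp_assoc[symmetric])
  have triv: "\<Gamma>1 \<rho> = id" if "\<rho> \<in> vals" "\<Gamma>0 \<rho> = \<Gamma> \<rho>" for \<rho>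
    using permutes_inv_o(2)[OF perm_family_permutes[OF fam0 that(1)]] that(2) by (simp add: \<Gamma>1_def)
  have dep0: "depends \<Gamma>0 (I \<union> {..<n})"
    unfolding depends_def \<Gamma>0_def
  proof (intro ballI impI)
    fix \<rho> \<rho>' assume "\<rho> \<in> vals" "\<rho>' \<in> vals" "\<forall>i\<in>I \<union> {..<n}. \<rho> i = \<rho>' i"
    then show "\<Gamma> (\<rho>(n := o' n)) = \<Gamma> (\<rho>'(n := o' n))"
      by (intro dependsD[OF Suc.prems(5)] upd) auto
  qed
  have dep1: "depends \<Gamma>1 (insert n I \<union> {..<n})"
    unfolding depends_def
  proof (intro ballI impI)
    fix \<rho> \<rho>' assume \<rho>: "\<rho> \<in> vals" "\<rho>' \<in> vals" "\<forall>i\<in>insert n I \<union> {..<n}. \<rho> i = \<rho>' i"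
    have "\<Gamma>0 \<rho> = \<Gamma>0 \<rho>'" by (rule dependsD[OF dep0]) (use \<rho> in auto)
    moreover have "\<Gamma> \<rho> = \<Gamma> \<rho>'" by (rule dependsD[OF Suc.prems(5)]) (use \<rho> in \<open>auto simp: less_Suc_eq\<close>)
    ultimately show "\<Gamma>1 \<rho> = \<Gamma>1 \<rho>'" by (simp add: \<Gamma>1_def)
  qed
  have notin: "n \<notin> I" using Suc.prems(4) by auto
  have abs0: "\<Gamma>0 \<rho> = id" if "\<rho> \<in> vals" "i \<in> I" "\<rho> i = o' i" for \<rho> i
    unfolding \<Gamma>0_def using that notin by (intro Suc.prems(6)[OF upd, of _ i]) auto
  have id0: "\<Gamma>0 o' = id" unfolding \<Gamma>0_def fun_upd_triv by (rule Suc.prems(2))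
  have "\<exists>\<Gamma>s. (\<forall>\<Delta>\<in>set \<Gamma>s. perm_family \<Delta> \<and> \<Delta> o' = id \<and> junta k \<Delta>) \<and>
      (\<forall>\<rho>\<in>vals. \<Gamma>0 \<rho> = foldr (\<circ>) (map (\<lambda>\<Delta>. \<Delta> \<rho>) \<Gamma>s) id)"
    by (rule Suc.IH[of \<Gamma>0 I]) (use fam0 id0 dep0 abs0 Suc.prems in auto)
  moreover have "\<exists>\<Gamma>s. (\<forall>\<Delta>\<in>set \<Gamma>s. perm_family \<Delta> \<and> \<Delta> o' = id \<and> junta k \<Delta>) \<and>
      (\<forall>\<rho>\<in>vals. \<Gamma>1 \<rho> = foldr (\<circ>) (map (\<lambda>\<Delta>. \<Delta> \<rho>) \<Gamma>s) id)"
  proof (rule Suc.IH[of \<Gamma>1 "insert n I"])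
    show "\<Gamma>1 o' = id" by (intro triv[OF o]) (simp only: id0 Suc.prems(2))
    show "\<Gamma>1 \<rho> = id" if "\<rho> \<in> vals" "i \<in> insert n I" "\<rho> i = o' i" for \<rho> i
    proof (rule triv[OF that(1)])
      show "\<Gamma>0 \<rho> = \<Gamma> \<rho>"
      proof (cases "i = n")
        case True
        then have "\<rho>(n := o' n) = \<rho>" using that(3) by (metis fun_upd_triv)
        then show ?thesis by (simp add: \<Gamma>0_def)
      next
        case False
        then show ?thesis using that abs0[of \<rho> i] Suc.prems(6)[of \<rho> i] by auto
      qed
    qed
  qed (use fam1 dep1 Suc.prems in auto)
  ultimately obtain \<Gamma>s \<Gamma>s' where gs: "\<forall>\<Delta>\<in>set \<Gamma>s \<union> set \<Gamma>s'. perm_family \<Delta> \<and> \<Delta> o' = id \<and> junta k \<Delta>"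
    "\<forall>\<rho>\<in>vals. \<Gamma>0 \<rho> = foldr (\<circ>) (map (\<lambda>\<Delta>. \<Delta> \<rho>) \<Gamma>s) id"
    "\<forall>\<rho>\<in>vals. \<Gamma>1 \<rho> = foldr (\<circ>) (map (\<lambda>\<Delta>. \<Delta> \<rho>) \<Gamma>s') id"
    by (metis UnE)
  have append: "foldr (\<circ>) (fs @ fs') id = foldr (\<circ>) fs id \<circ> foldr (\<circ>) fs' id" for fs fs' :: "('a \<Rightarrow> 'a) list"
    by (induction fs) (simp_all only: append.simps foldr.simps comp_assoc id_comp id_apply comp_apply)
  have "\<Gamma> \<rho> = foldr (\<circ>) (map (\<lambda>\<Delta>. \<Delta> \<rho>) (\<Gamma>s @ \<Gamma>s')) id" if "\<rho> \<in> vals" for \<rho>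
    unfolding map_append append using split[OF that] gs(2,3) that by simp
  moreover have "\<forall>\<Delta>\<in>set (\<Gamma>s @ \<Gamma>s'). perm_family \<Delta> \<and> \<Delta> o' = id \<and> junta k \<Delta>"
    unfolding set_append by (rule gs(1))
  ultimately show ?case by blast
qed

end

section \<open>Density of solutions\<close>

context finite_algebra
begin

text \<open>The analogue modulo p of polynomials of degree at most D: products add the bounds, and
  differences in one variable lower them.\<close>

inductive junta_sum :: "nat \<Rightarrow> nat \<Rightarrow> ((nat \<Rightarrow> 'a) \<Rightarrow> int) \<Rightarrow> bool" for p D where
  junta: "junta D E \<Longrightarrow> junta_sum p D E"
| add: "junta_sum p D E \<Longrightarrow> junta_sum p D E' \<Longrightarrow> junta_sum p D (\<lambda>\<rho>. E \<rho> + E' \<rho>)"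
| modulo: "junta_sum p D E \<Longrightarrow> (\<And>\<rho>. \<rho> \<in> vals \<Longrightarrow> int p dvd E \<rho> - E' \<rho>) \<Longrightarrow> junta_sum p D E'"

lemma junta_const: "junta D (\<lambda>\<rho>. c)"
  by (auto simp: junta_def depends_def intro!: exI[of _ "{}"])

lemma junta_comp:
  assumes "junta D E"
  shows "junta D (\<lambda>\<rho>. \<phi> (E \<rho>))"
proof -
  obtain I where I: "finite I" "card I \<le> D" "depends E I" using assms by (auto simp: junta_def)
  have "depends (\<lambda>\<rho>. \<phi> (E \<rho>)) I"
    unfolding depends_def
  proof (intro ballI impI)
    fix \<rho> \<rho>' assume \<rho>: "\<rho> \<in> vals" "\<rho>' \<in> vals" "\<forall>i\<in>I. \<rho> i = \<rho>' i"
    have "E \<rho> = E \<rho>'" by (rule dependsD[OF I(3)]) (use \<rho> in auto)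
    then show "\<phi> (E \<rho>) = \<phi> (E \<rho>')" by simp
  qed
  then show ?thesis using I unfolding junta_def by (intro exI[of _ I]) simp
qed

lemma junta_sum_mult:
  assumes "junta_sum p D E" "junta k J"
  shows "junta_sum p (D + k) (\<lambda>\<rho>. J \<rho> * E \<rho>)"
  using assms(1)
proof (induction rule: junta_sum.induct)
  case (junta E)
  obtain I I' where I: "finite I" "card I \<le> D" "depends E I" and I': "finite I'" "card I' \<le> k" "depends J I'"
    using junta assms(2) by (auto simp: junta_def)
  have "card (I \<union> I') \<le> D + k" using card_Un_le[of I I'] I I' by linarith
  moreover have "depends (\<lambda>\<rho>. J \<rho> * E \<rho>) (I \<union> I')"
    unfolding depends_def
  proof (intro ballI impI)
    fix \<rho> \<rho>' assume \<rho>: "\<rho> \<in> vals" "\<rho>' \<in> vals" "\<forall>i\<in>I \<union> I'. \<rho> i = \<rho>' i"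
    have "J \<rho> = J \<rho>'" by (rule dependsD[OF I'(3)]) (use \<rho> in auto)
    moreover have "E \<rho> = E \<rho>'" by (rule dependsD[OF I(3)]) (use \<rho> in auto)
    ultimately show "J \<rho> * E \<rho> = J \<rho>' * E \<rho>'" by simp
  qed
  ultimately show ?case
    using I I' by (intro junta_sum.junta) (auto simp: junta_def intro!: exI[of _ "I \<union> I'"])
next
  case (add E E')
  then show ?case using junta_sum.add[OF add.IH] by (simp add: algebra_simps)
next
  case (modulo E E')
  show ?case
  proof (rule junta_sum.modulo[OF modulo.IH])
    show "int p dvd J \<rho> * E \<rho> - J \<rho> * E' \<rho>" if "\<rho> \<in> vals" for \<rho>
      using dvd_mult[OF modulo(2)[OF that], of "J \<rho>"] by (simp add: algebra_simps)
  qed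
qed

lemma junta_sum_sum:
  "finite S \<Longrightarrow> (\<And>s. s \<in> S \<Longrightarrow> junta_sum p D (E s)) \<Longrightarrow> junta_sum p D (\<lambda>\<rho>. \<Sum>s\<in>S. E s \<rho>)"
  by (induction rule: finite_induct) (simp_all add: junta_sum.junta junta_const junta_sum.add)

lemma junta_sum_0:
  assumes "junta_sum p 0 E" "\<rho> \<in> vals" "\<rho>' \<in> vals"
  shows "int p dvd E \<rho> - E \<rho>'"
  using assms(1)
proof (induction rule: junta_sum.induct)
  case (junta E)
  then have "depends E {}" by (auto simp: junta_def)
  then have "E \<rho> = E \<rho>'" by (rule dependsD) (use assms in auto)
  then show ?case by simp
next
  case (add E E')
  then show ?case using dvd_add[OF add.IH] by (simp add: algebra_simps)
next
  case (modulo E E')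
  have "E' \<rho> - E' \<rho>' = E \<rho> - E \<rho>' - (E \<rho> - E' \<rho>) + (E \<rho>' - E' \<rho>')" by simp
  also have "int p dvd \<dots>"
    by (intro dvd_add dvd_diff modulo.IH modulo(2) assms)
  finally show ?case .
qed

text \<open>Juntas that read variable n no longer do so after it is fixed, and those that do not
  read it cancel.\<close>

lemma junta_sum_derivative:
  assumes "junta_sum p D E" "a \<in> univ A" "b \<in> univ A"
  shows "junta_sum p (D - 1) (\<lambda>\<rho>. E (\<rho>(n := a)) - E (\<rho>(n := b)))"
  using assms(1)
proof (induction rule: junta_sum.induct)
  case (junta E)
  then obtain I where I: "finite I" "card I \<le> D" "depends E I" by (auto simp: junta_def)
  have "junta (D - 1) (\<lambda>\<rho>. E (\<rho>(n := a)) - E (\<rho>(n := b)))"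
  proof (cases "n \<in> I")
    case True
    have "depends (\<lambda>\<rho>. E (\<rho>(n := a)) - E (\<rho>(n := b))) (I - {n})"
      unfolding depends_def
    proof (intro ballI impI)
      fix \<rho> \<rho>' assume "\<rho> \<in> vals" "\<rho>' \<in> vals" "\<forall>i\<in>I - {n}. \<rho> i = \<rho>' i"
      then have "E (\<rho>(n := c)) = E (\<rho>'(n := c))" if "c \<in> univ A" for c
        using that by (intro dependsD[OF I(3)] vals_upd) auto
      then show "E (\<rho>(n := a)) - E (\<rho>(n := b)) = E (\<rho>'(n := a)) - E (\<rho>'(n := b))"
        using assms by simp
    qed
    moreover have "card (I - {n}) \<le> D - 1" using I True by simp
    ultimately show ?thesis using I(1) unfolding junta_def by (intro exI[of _ "I - {n}"]) simp
  next
    case False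
    have "depends (\<lambda>\<rho>. E (\<rho>(n := a)) - E (\<rho>(n := b))) {}"
      unfolding depends_def
    proof (intro ballI impI)
      fix \<rho> \<rho>' assume \<rho>: "\<rho> \<in> vals" "\<rho>' \<in> vals"
      have "E (\<sigma>(n := a)) = E (\<sigma>(n := b))" if "\<sigma> \<in> vals" for \<sigma>
        using that assms False by (intro dependsD[OF I(3)] vals_upd) auto
      then show "E (\<rho>(n := a)) - E (\<rho>(n := b)) = E (\<rho>'(n := a)) - E (\<rho>'(n := b))"
        using \<rho> by simp
    qed
    then show ?thesis unfolding junta_def by (intro exI[of _ "{}"]) simp
  qed
  then show ?case by (rule junta_sum.junta)
next
  case (add E E')
  then show ?case using junta_sum.add[OF add.IH] by (simp add: algebra_simps)
next
  case (modulo E E')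
  show ?case
  proof (rule junta_sum.modulo[OF modulo.IH])
    fix \<rho> assume "\<rho> \<in> vals"
    then have "int p dvd E (\<rho>(n := a)) - E' (\<rho>(n := a))" "int p dvd E (\<rho>(n := b)) - E' (\<rho>(n := b))"
      using modulo(2) vals_upd assms by blast+
    from dvd_diff[OF this]
    show "int p dvd E (\<rho>(n := a)) - E (\<rho>(n := b)) - (E' (\<rho>(n := a)) - E' (\<rho>(n := b)))"
      by (simp add: algebra_simps)
  qed
qed

text \<open>Induction on the number of variables: either some difference quotient in the last variable is
  nonzero, and it is a sum of smaller juntas, or the last variable is irrelevant modulo \<open>p\<close>.\<close>

lemma junta_sum_nonzero:
  "junta_sum p D E \<Longrightarrow> depends E {..<n} \<Longrightarrow> s \<in> vals \<Longrightarrow> \<not> int p dvd E s \<Longrightarrow>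
    \<exists>I\<subseteq>{..<n}. card I \<le> D \<and>
      (\<forall>y\<in>vals. \<exists>y'\<in>vals. (\<forall>i. i \<notin> I \<longrightarrow> y' i = y i) \<and> \<not> int p dvd E y')"
proof (induction n arbitrary: D E s)
  case 0
  have "\<not> int p dvd E y" if "y \<in> vals" for y
    using 0(4) dependsD[OF 0(2) that 0(3)] by simp
  then show ?case by (intro exI[of _ "{}"]) auto
next
  case (Suc n)
  have sn: "s n \<in> univ A" using Suc.prems vals_nth by blast
  have depn: "E (\<rho>(n := c)) = E (\<rho>'(n := c))"
    if "\<rho> \<in> vals" "\<rho>' \<in> vals" "\<forall>i\<in>{..<n}. \<rho> i = \<rho>' i" "c \<in> univ A" for \<rho> \<rho>' c
    using that by (intro dependsD[OF Suc.prems(2)] vals_upd) auto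
  show ?case
  proof (cases "\<exists>a\<in>univ A. \<exists>b\<in>univ A. \<exists>\<rho>\<in>vals. \<not> int p dvd E (\<rho>(n := a)) - E (\<rho>(n := b))")
    case True
    then obtain a b \<rho> where ab: "a \<in> univ A" "b \<in> univ A" "\<rho> \<in> vals"
      "\<not> int p dvd E (\<rho>(n := a)) - E (\<rho>(n := b))" by blast
    \<comment> \<open>A sum with D = 0 is constant modulo p and has no such difference. So D - 1 is
      not truncated, and variable n may be added to I.\<close>
    then have "D \<noteq> 0" using junta_sum_0 Suc.prems(1) vals_upd by metis
    let ?d = "\<lambda>\<rho>. E (\<rho>(n := a)) - E (\<rho>(n := b))"
    have "depends ?d {..<n}"
      unfolding depends_def using depn ab by metis
    then obtain I where I: "I \<subseteq> {..<n}" "card I \<le> D - 1"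
      "\<And>y. y \<in> vals \<Longrightarrow> \<exists>y'\<in>vals. (\<forall>i. i \<notin> I \<longrightarrow> y' i = y i) \<and> \<not> int p dvd ?d y'"
      using Suc.IH[OF junta_sum_derivative[OF Suc.prems(1) ab(1,2)] _ ab(3,4)] by blast
    show ?thesis
    proof (intro exI[of _ "insert n I"] conjI ballI)
      show "insert n I \<subseteq> {..<Suc n}" using I(1) by auto
      have "card (insert n I) \<le> Suc (card I)" using card_Un_le[of "{n}" I] by simp
      then show "card (insert n I) \<le> D" using I(2) \<open>D \<noteq> 0\<close> by simp
      fix y assume "y \<in> vals"
      then obtain y' where y': "y' \<in> vals" "\<forall>i. i \<notin> I \<longrightarrow> y' i = y i" "\<not> int p dvd ?d y'"
        using I(3) by blast
      then have "\<not> int p dvd E (y'(n := a)) \<or> \<not> int p dvd E (y'(n := b))" by auto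
      then obtain c where "c \<in> univ A" "\<not> int p dvd E (y'(n := c))" using ab by blast
      then show "\<exists>y'\<in>vals. (\<forall>i. i \<notin> insert n I \<longrightarrow> y' i = y i) \<and> \<not> int p dvd E y'"
        using y' vals_upd by (intro bexI[of _ "y'(n := c)"]) auto
    qed
  next
    case False
    let ?E = "\<lambda>\<rho>. E (\<rho>(n := s n))"
    have same: "int p dvd E \<rho> - ?E \<rho>" if "\<rho> \<in> vals" for \<rho>
    proof -
      have "int p dvd E (\<rho>(n := \<rho> n)) - E (\<rho>(n := s n))" using False that sn vals_nth by blast
      then show ?thesis by simp
    qed
    have iff: "int p dvd E \<rho> \<longleftrightarrow> int p dvd ?E \<rho>" if "\<rho> \<in> vals" for \<rho>
      using same[OF that] by (metis diff_add_cancel dvd_add_right_iff)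
    have "junta_sum p D ?E" using Suc.prems(1) same by (rule junta_sum.modulo)
    moreover have "depends ?E {..<n}" unfolding depends_def using depn sn by blast
    moreover have "\<not> int p dvd ?E s" using Suc.prems(4) by simp
    ultimately obtain I where "I \<subseteq> {..<n}" "card I \<le> D"
      "\<forall>y\<in>vals. \<exists>y'\<in>vals. (\<forall>i. i \<notin> I \<longrightarrow> y' i = y i) \<and> \<not> int p dvd ?E y'"
      using Suc.IH[of D ?E s] Suc.prems(3) by blast
    moreover have "{..<n} \<subseteq> {..<Suc n}" by auto
    ultimately show ?thesis using iff by (intro exI[of _ I]) (meson order_trans)
  qed
qed

end

section \<open>From nilpotent action to dense solutions\<close>

context supernilpotent_algebra
begin

lemma nilpotent_action_polynomial_group:
  assumes "in_congruence_modular_variety A" "prime p"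
  shows "nilpotent_action (univ A) polynomial_group p k"
proof
  show "finite (univ A)" by (rule fin)
  show "g permutes univ A" if "g \<in> polynomial_group" for g
    using that perm_family_permutes by (auto simp: polynomial_group_def)
  obtain a where "a \<in> univ A" using ne by blast
  then have a: "(\<lambda>_. a) \<in> vals" by (auto simp: vals_def)
  show "id \<in> polynomial_group"
    using polynomial_groupI[OF perm_family_id a a] by simp
  show "g \<circ> h \<in> polynomial_group" if "g \<in> polynomial_group" "h \<in> polynomial_group" for g h
    using that by (rule polynomial_group_comp)
  show "inv g \<in> polynomial_group" if "g \<in> polynomial_group" for g
  proof -
    obtain \<Gamma> \<rho> \<rho>0 where g: "g = \<Gamma> \<rho>" "perm_family \<Gamma>" "\<rho> \<in> vals" "\<rho>0 \<in> vals" "\<Gamma> \<rho>0 = id"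
      using \<open>g \<in> polynomial_group\<close> by (auto simp: polynomial_group_def)
    have "inv (\<Gamma> \<rho>0) = id" unfolding g(5) by (rule inv_id)
    then show ?thesis unfolding g(1) using polynomial_groupI[OF perm_family_inv[OF g(2)] g(3,4)] by simp
  qed
  show "\<exists>g\<in>polynomial_group. g x = y" if xy: "x \<in> univ A" "y \<in> univ A" for x y
  proof -
    obtain m where m: "\<forall>F\<in>pol. \<forall>G\<in>pol. \<forall>H\<in>pol. (\<lambda>\<rho>. m (F \<rho>) (G \<rho>) (H \<rho>)) \<in> pol"
      "\<forall>x\<in>univ A. \<forall>y\<in>univ A. m x y y = x \<and> m x x y = y"
      using maltsev_operation[OF assms(1)] by blast
    \<comment> \<open>With both parameters equal to x the permutation is trivial; with parameters x
      and y it sends x to \<open>m x x y = y\<close>.\<close>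
    let ?F = "\<lambda>\<sigma>. m (\<sigma> 0) (\<sigma> 1) (\<sigma> 2)"
    let ?\<Gamma> = "\<lambda>\<rho> z. if z \<in> univ A then ?F (case_nat z \<rho>) else z"
    have F: "?F \<in> pol" using m(1) pol.var[of 0] pol.var[of 1] pol.var[of 2] by simp
    have \<rho>: "(\<lambda>_. x) \<in> vals" "(\<lambda>i. if i = 0 then x else y) \<in> vals" using xy by (auto simp: vals_def)
    have "perm_family ?\<Gamma>"
      by (rule perm_familyI[OF F \<rho>(1)]) (use m(2) xy in \<open>simp add: numeral_2_eq_2\<close>)
    moreover have "?\<Gamma> (\<lambda>_. x) = id"
      using m(2) xy by (auto simp: numeral_2_eq_2)
    ultimately have "?\<Gamma> (\<lambda>i. if i = 0 then x else y) \<in> polynomial_group"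
      using \<rho> by (intro polynomial_groupI[of ?\<Gamma>])
    then show ?thesis
    proof (rule bexI[rotated])
      show "?\<Gamma> (\<lambda>i. if i = 0 then x else y) x = y"
        using m(2) xy by (simp add: numeral_2_eq_2)
    qed
  qed
  show "iterated_commutator gs k = id" if "\<And>j. j \<le> k \<Longrightarrow> gs j \<in> polynomial_group" for gs
    using that by (rule polynomial_group_nilpotent)
  show "prime p" by (rule assms(2))
qed

text \<open>Peeling off the outermost factor, h(\<Gamma> b) = h(b) + (h(\<Gamma> b) - h(b)). For
  each of the finitely many values g of \<Gamma> the difference belongs to a function one term lower
  in the series, and a junta of k variables detects whether \<Gamma> takes the value g. Each of the
  j levels thus costs k variables, however long the list is.\<close>

lemma composition_junta_sum:
  assumes "nilpotent_action (univ A) polynomial_group p k"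
    and "\<And>\<Delta> \<rho>. \<Delta> \<in> set \<Gamma>s \<Longrightarrow> \<rho> \<in> vals \<Longrightarrow> \<Delta> \<rho> \<in> polynomial_group"
    and "\<And>\<Delta>. \<Delta> \<in> set \<Gamma>s \<Longrightarrow> junta k \<Delta>"
    and "h \<in> nilpotent_action.V (univ A) polynomial_group p j" and "a \<in> univ A"
  shows "junta_sum p (k * j) (\<lambda>\<rho>. h (foldr (\<lambda>\<Delta>. \<Delta> \<rho>) \<Gamma>s a))"
proof -
  interpret nilpotent_action "univ A" polynomial_group p k by fact
  have inU: "foldr (\<lambda>\<Delta>. \<Delta> \<rho>) \<Delta>s a \<in> univ A"
    if "\<rho> \<in> vals" "\<And>\<Delta>. \<Delta> \<in> set \<Delta>s \<Longrightarrow> \<Delta> \<rho> \<in> polynomial_group" for \<rho> \<Delta>s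
    using that by (induction \<Delta>s) (auto simp: act assms(5))
  show ?thesis
    using assms(2-4)
  proof (induction j arbitrary: h \<Gamma>s)
    case 0
    have "junta_sum p 0 (\<lambda>\<rho>. 0)" by (intro junta_sum.junta junta_const)
    then have "junta_sum p 0 (\<lambda>\<rho>. h (foldr (\<lambda>\<Delta>. \<Delta> \<rho>) \<Gamma>s a))"
      by (rule junta_sum.modulo) (use 0 inU in auto)
    then show ?case by simp
  next
    case (Suc j)
    note h = Suc.prems(3)
    show ?case
      using Suc.prems(1,2)
    proof (induction \<Gamma>s)
      case Nil
      then show ?case by (auto intro: junta_sum.junta junta_const)
    next
      case (Cons \<Gamma> \<Gamma>s)
      let ?b = "\<lambda>\<rho>. foldr (\<lambda>\<Delta>. \<Delta> \<rho>) \<Gamma>s a"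
      have "junta_sum p (k * j + k) (\<lambda>\<rho>. of_bool (\<Gamma> \<rho> = g) * (h (g (?b \<rho>)) - h (?b \<rho>)))"
        if g: "g \<in> polynomial_group" for g
      proof (rule junta_sum_mult)
        show "junta k (\<lambda>\<rho>. of_bool (\<Gamma> \<rho> = g) :: int)"
          using Cons.prems(2)[of \<Gamma>] by (intro junta_comp[of k \<Gamma> "\<lambda>f. of_bool (f = g)"]) simp
        show "junta_sum p (k * j) (\<lambda>\<rho>. h (g (?b \<rho>)) - h (?b \<rho>))"
          by (rule Suc.IH[of \<Gamma>s "\<lambda>x. h (g x) - h x"]) (use Cons.prems h g in auto)
      qed
      then have "junta_sum p (k * j + k)
          (\<lambda>\<rho>. \<Sum>g\<in>polynomial_group. of_bool (\<Gamma> \<rho> = g) * (h (g (?b \<rho>)) - h (?b \<rho>)))"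
        by (intro junta_sum_sum finG)
      moreover have "junta_sum p (k * j + k) (\<lambda>\<rho>. h (?b \<rho>))"
        using Cons.IH Cons.prems by (simp add: algebra_simps)
      ultimately have "junta_sum p (k * j + k) (\<lambda>\<rho>. h (?b \<rho>) +
          (\<Sum>g\<in>polynomial_group. of_bool (\<Gamma> \<rho> = g) * (h (g (?b \<rho>)) - h (?b \<rho>))))"
        by (rule junta_sum.add[rotated])
      then have "junta_sum p (k * j + k) (\<lambda>\<rho>. h (foldr (\<lambda>\<Delta>. \<Delta> \<rho>) (\<Gamma> # \<Gamma>s) a))"
      proof (rule junta_sum.modulo)
        fix \<rho> assume \<rho>: "\<rho> \<in> vals"
        then have "\<Gamma> \<rho> \<in> polynomial_group" using Cons.prems(1) by simp
        then have "(\<Sum>g\<in>polynomial_group. of_bool (\<Gamma> \<rho> = g) * (h (g (?b \<rho>)) - h (?b \<rho>))) =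
            h (\<Gamma> \<rho> (?b \<rho>)) - h (?b \<rho>)"
          using finG by (simp add: of_bool_def if_distrib[of "\<lambda>x. x * _"] cong: if_cong)
        then show "int p dvd h (?b \<rho>) +
            (\<Sum>g\<in>polynomial_group. of_bool (\<Gamma> \<rho> = g) * (h (g (?b \<rho>)) - h (?b \<rho>))) -
            h (foldr (\<lambda>\<Delta>. \<Delta> \<rho>) (\<Gamma> # \<Gamma>s) a)"
          by simp
      qed
      then show ?case by (simp add: algebra_simps)
    qed
  qed
qed

theorem solutions_dense:
  assumes "in_congruence_modular_variety A" "primepow (card (univ A))"
  shows "\<exists>D. \<forall>F\<in>pol. \<forall>G\<in>pol. (\<exists>s\<in>vals. F s = G s) \<longrightarrow>
    (\<exists>I. finite I \<and> card I \<le> D \<and>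
      (\<forall>y\<in>vals. \<exists>y'\<in>vals. (\<forall>i. i \<notin> I \<longrightarrow> y' i = y i) \<and> F y' = G y'))"
proof -
  obtain p e where p: "prime p" "card (univ A) = p ^ e"
    using assms(2) by (auto simp: primepow_def)
  have p1: "\<not> int p dvd 1" using p(1) by auto
  have action: "nilpotent_action (univ A) polynomial_group p k"
    using nilpotent_action_polynomial_group assms(1) p(1) .
  interpret nilpotent_action "univ A" polynomial_group p k by fact
  obtain m where m: "\<forall>F\<in>pol. \<forall>G\<in>pol. \<forall>H\<in>pol. (\<lambda>\<rho>. m (F \<rho>) (G \<rho>) (H \<rho>)) \<in> pol"
    "\<And>x y. x \<in> univ A \<Longrightarrow> y \<in> univ A \<Longrightarrow> m x y y = x \<and> m x x y = y"
    using maltsev_operation[OF assms(1)] by blast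
  obtain z where z: "z \<in> univ A" using ne by blast
  define o' where "o' = (\<lambda>_::nat. z)"
  have o': "o' \<in> vals" using z by (auto simp: vals_def o'_def)
  \<comment> \<open>The function h depends on z alone, so its level j, and with it the bound
    \<open>k * j\<close>, is the same for all equations.\<close>
  define h where "h x = (if x = z then 1 else 0 :: int)" for x
  obtain j where j: "h \<in> V j" using all_in_V[OF p(2)] by blast
  \<comment> \<open>This allows \<open>F1 \<rho> = F2 \<rho>\<close> to be expressed by
    \<open>m (F1 \<rho>) (F2 \<rho>) z = z\<close>: with parameters v and z the map is a
    permutation, because with parameters z and z it is trivial, and it sends v to z.\<close>
  have cancel: "u = v" if "u \<in> univ A" "v \<in> univ A" "m u v z = z" for u v
  proof -
    let ?F = "\<lambda>\<sigma>. m (\<sigma> 0) (\<sigma> 1) (\<sigma> 2)"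
    have F: "?F \<in> pol" using m(1) pol.var[of 0] pol.var[of 1] pol.var[of 2] by simp
    have \<rho>: "o' \<in> vals" "(\<lambda>i. if i = 0 then v else z) \<in> vals" using z that o' by (auto simp: vals_def)
    have "perm_family (\<lambda>\<rho> z. if z \<in> univ A then ?F (case_nat z \<rho>) else z)"
      by (rule perm_familyI[OF F \<rho>(1)]) (use m(2) z in \<open>simp add: numeral_2_eq_2 o'_def\<close>)
    from permutes_inj[OF perm_family_permutes[OF this \<rho>(2)]]
    have "m u v z = m v v z \<longrightarrow> u = v"
      using that(1,2) by (auto dest!: injD[of _ u v] simp: numeral_2_eq_2)
    then show ?thesis using m(2)[of v z] that z by simp
  qed
  show ?thesis
  proof (intro exI[of _ "k * j"] ballI impI)
    fix F1 F2 assume F12: "F1 \<in> pol" "F2 \<in> pol" and "\<exists>s\<in>vals. F1 s = F2 s"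
    then obtain s where s: "s \<in> vals" "F1 s = F2 s" by blast
    define F where "F \<rho> = m (F1 \<rho>) (F2 \<rho>) z" for \<rho>
    have F: "F \<in> pol" unfolding F_def using m(1)[rule_format, OF F12 pol.const[OF z]] .
    have Fz: "F \<rho> = z \<longleftrightarrow> F1 \<rho> = F2 \<rho>" if "\<rho> \<in> vals" for \<rho>
      unfolding F_def using cancel m(2) z pol_closed[OF F12(1) that] pol_closed[OF F12(2) that] by metis
    obtain n where n: "\<And>\<rho> \<rho>'. (\<forall>i<n. \<rho> i = \<rho>' i) \<Longrightarrow> F \<rho> = F \<rho>'"
      using pol_finite_support[OF F] by blast
    have Fo: "F o' \<in> univ A" using pol_closed[OF F o'] .
    define \<Gamma> where "\<Gamma> \<rho> x = (if x \<in> univ A then m x (F o') (F \<rho>) else x)" for \<rho> x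
    have "(\<lambda>\<sigma>. m (\<sigma> 0) (F o') (F (\<lambda>i. \<sigma> (Suc i)))) \<in> pol"
      by (rule m(1)[rule_format, OF pol.var[of 0] pol.const[OF Fo] pol_subst[OF F, of "\<lambda>i \<sigma>. \<sigma> (Suc i)"]])
        (rule pol.var)
    from perm_familyI[OF this o'] have fam: "perm_family \<Gamma>"
      using m(2) Fo by (simp add: \<Gamma>_def[abs_def] cong: if_cong)
    have \<Gamma>o: "\<Gamma> o' = id" using m(2) Fo by (auto simp: \<Gamma>_def)
    have "\<exists>\<Gamma>s. (\<forall>\<Delta>\<in>set \<Gamma>s. perm_family \<Delta> \<and> \<Delta> o' = id \<and> junta k \<Delta>) \<and>
        (\<forall>\<rho>\<in>vals. \<Gamma> \<rho> = foldr (\<circ>) (map (\<lambda>\<Delta>. \<Delta> \<rho>) \<Gamma>s) id)"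
    proof (rule perm_family_decomposition[OF o' fam \<Gamma>o, of "{}" n])
      have "\<Gamma> \<rho> = \<Gamma> \<rho>'" if "\<forall>i<n. \<rho> i = \<rho>' i" for \<rho> \<rho>'
        using n[OF that] by (simp add: \<Gamma>_def[abs_def] cong: if_cong)
      then show "depends \<Gamma> ({} \<union> {..<n})" by (simp add: depends_def)
    qed auto
    then obtain \<Gamma>s where \<Gamma>s: "\<And>\<Delta>. \<Delta> \<in> set \<Gamma>s \<Longrightarrow> perm_family \<Delta> \<and> \<Delta> o' = id \<and> junta k \<Delta>"
      "\<And>\<rho>. \<rho> \<in> vals \<Longrightarrow> \<Gamma> \<rho> = foldr (\<circ>) (map (\<lambda>\<Delta>. \<Delta> \<rho>) \<Gamma>s) id"
      by blast
    have fold: "foldr (\<circ>) (map (\<lambda>\<Delta>. \<Delta> \<rho>) \<Delta>s) id x = foldr (\<lambda>\<Delta>. \<Delta> \<rho>) \<Delta>s x" for \<rho> \<Delta>s and x :: 'a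
      by (induction \<Delta>s) auto
    have F\<Gamma>: "F \<rho> = foldr (\<lambda>\<Delta>. \<Delta> \<rho>) \<Gamma>s (F o')" if "\<rho> \<in> vals" for \<rho>
    proof -
      have "\<Gamma> \<rho> (F o') = F \<rho>" using m(2) Fo pol_closed[OF F that] by (simp add: \<Gamma>_def)
      then show ?thesis using \<Gamma>s(2)[OF that] fold by metis
    qed
    have "junta_sum p (k * j) (\<lambda>\<rho>. h (foldr (\<lambda>\<Delta>. \<Delta> \<rho>) \<Gamma>s (F o')))"
      by (rule composition_junta_sum[OF action]) (use \<Gamma>s(1) j Fo o' in \<open>auto intro: polynomial_groupI\<close>)
    then have js: "junta_sum p (k * j) (\<lambda>\<rho>. h (F \<rho>))"
      by (rule junta_sum.modulo) (simp add: F\<Gamma>)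
    have nz: "\<not> int p dvd h (F \<rho>) \<longleftrightarrow> F1 \<rho> = F2 \<rho>" if "\<rho> \<in> vals" for \<rho>
      using Fz[OF that] p1 by (auto simp: h_def)
    have "h (F \<rho>) = h (F \<rho>')" if "\<forall>i<n. \<rho> i = \<rho>' i" for \<rho> \<rho>'
      using n[OF that] by simp
    then have "depends (\<lambda>\<rho>. h (F \<rho>)) {..<n}" by (simp add: depends_def)
    from junta_sum_nonzero[OF js this s(1)] nz s
    obtain I where "I \<subseteq> {..<n}" "card I \<le> k * j"
      "\<forall>y\<in>vals. \<exists>y'\<in>vals. (\<forall>i. i \<notin> I \<longrightarrow> y' i = y i) \<and> \<not> int p dvd h (F y')"
      by blast
    then show "\<exists>I. finite I \<and> card I \<le> k * j \<and>
        (\<forall>y\<in>vals. \<exists>y'\<in>vals. (\<forall>i. i \<notin> I \<longrightarrow> y' i = y i) \<and> F1 y' = F2 y')"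
      using nz by (intro exI[of _ I]) (metis finite_lessThan finite_subset)
  qed
qed

end

section \<open>Structured programs for the random access machine\<close>

fun dexec :: "instr \<Rightarrow> bool \<Rightarrow> nat \<Rightarrow> (nat \<Rightarrow> nat) \<Rightarrow> (nat \<Rightarrow> nat) \<Rightarrow> config" where
  "dexec (Const r n) b i R M = Running (Suc i) (R(r := n)) M"
| "dexec (Move r s) b i R M = Running (Suc i) (R(r := R s)) M"
| "dexec (Add r s t) b i R M = Running (Suc i) (R(r := R s + R t)) M"
| "dexec (Sub r s t) b i R M = Running (Suc i) (R(r := R s - R t)) M"
| "dexec (Load r s) b i R M = Running (Suc i) (R(r := M (R s))) M"
| "dexec (Store r s) b i R M = Running (Suc i) R (M(R r := R s))"
| "dexec (Flip r) b i R M = Running (Suc i) (R(r := of_bool b)) M"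
| "dexec (Jump l) b i R M = Running l R M"
| "dexec (JumpZero r l) b i R M = Running (if R r = 0 then l else Suc i) R M"
| "dexec (Halt a) b i R M = Halted a"

fun dstep :: "instr list \<Rightarrow> bool \<Rightarrow> config \<Rightarrow> config" where
  "dstep P b (Running i R M) = (if i < length P then dexec (P ! i) b i R M else Halted False)"
| "dstep P b (Halted a) = Halted a"

lemma step_dstep: "step P cfg = map_pmf (\<lambda>b. dstep P b cfg) (bernoulli_pmf (1/2))"
proof (cases cfg)
  case (Running i R M)
  have "exec a i R M = map_pmf (\<lambda>b. dexec a b i R M) (bernoulli_pmf (1/2))" for a
    by (cases a) simp_all
  then show ?thesis using Running by simp
qed simp

primrec drun :: "instr list \<Rightarrow> (nat \<Rightarrow> bool) \<Rightarrow> config \<Rightarrow> nat \<Rightarrow> config" where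
  "drun P bs cfg 0 = cfg"
| "drun P bs cfg (Suc t) = dstep P (bs t) (drun P bs cfg t)"

definition bits :: "nat \<Rightarrow> (nat \<Rightarrow> bool) pmf" where
  "bits T = Pi_pmf {..<T} False (\<lambda>_. bernoulli_pmf (1/2))"

lemma drun_cong: "(\<And>s. s < t \<Longrightarrow> bs s = bs' s) \<Longrightarrow> drun P bs cfg t = drun P bs' cfg t"
  by (induction t) auto

text \<open>One bit per step is drawn in advance, even for steps that flip nothing; the first t
  steps do not look at bit t, so it may be drawn at any moment.\<close>

lemma run_drun: "run P w t = map_pmf (\<lambda>bs. drun P bs (init_config w) t) (bits t)"
proof (induction t)
  case 0
  show ?case by (simp add: run_def bits_def)
next
  case (Suc t)
  have "run P w (Suc t) = bind_pmf (run P w t) (step P)"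
    by (simp add: run_def)
  also have "\<dots> = bind_pmf (bits t) (\<lambda>bs. map_pmf (\<lambda>b. dstep P b (drun P bs (init_config w) t)) (bernoulli_pmf (1/2)))"
    by (simp add: Suc bind_map_pmf step_dstep[abs_def])
  also have "\<dots> = bind_pmf (bernoulli_pmf (1/2)) (\<lambda>b. map_pmf (\<lambda>bs. dstep P b (drun P bs (init_config w) t)) (bits t))"
    unfolding map_pmf_def by (rule bind_commute_pmf)
  also have "\<dots> = map_pmf (\<lambda>bs. drun P bs (init_config w) (Suc t)) (bits (Suc t))"
  proof -
    have "drun P (bs(t := b)) (init_config w) t = drun P bs (init_config w) t" for bs b
      by (rule drun_cong) simp
    then show ?thesis
      unfolding bits_def lessThan_Suc
      by (subst Pi_pmf_insert) (auto simp: map_pmf_comp pair_pmf_def map_bind_pmf bind_map_pmf map_pmf_def bind_assoc_pmf bind_return_pmf)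
  qed
  finally show ?case .
qed

lemma bits_uniform: "bits T = pmf_of_set {bs. \<forall>t\<ge>T. \<not> bs t}" "finite {bs. \<forall>t\<ge>T. \<not> bs t}"
  and card_bits: "card {bs. \<forall>t\<ge>T. \<not> bs t} = 2 ^ T"
proof -
  have eq: "{bs. \<forall>t\<ge>T. \<not> bs t} = PiE_dflt {..<T} False (\<lambda>_. UNIV)"
    by (auto simp: PiE_dflt_def not_less)
  show "finite {bs. \<forall>t\<ge>T. \<not> bs t}" "card {bs. \<forall>t\<ge>T. \<not> bs t} = 2 ^ T"
    unfolding eq by (auto simp: card_PiE_dflt)
  show "bits T = pmf_of_set {bs. \<forall>t\<ge>T. \<not> bs t}"
    unfolding eq bits_def bernoulli_pmf_half_conv_pmf_of_set by (rule Pi_pmf_of_set) auto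
qed

text \<open>Forgetting the bits in Q maps the good sequences onto all assignments of the remaining
  positions, so there are at least \<open>2 ^ (T - card Q)\<close> good ones.\<close>

lemma bits_prob_ge:
  assumes Q: "Q \<subseteq> {..<T}"
    and good: "\<And>bs. \<forall>t\<ge>T. \<not> bs t \<Longrightarrow> \<exists>bs'. (\<forall>t. t \<notin> Q \<longrightarrow> bs' t = bs t) \<and> good bs'"
  shows "measure_pmf.prob (bits T) {bs. good bs} \<ge> (1/2) ^ card Q"
proof -
  let ?S = "{bs. \<forall>t\<ge>T. \<not> bs t}"
  let ?SQ = "PiE_dflt ({..<T} - Q) False (\<lambda>_. UNIV :: bool set)"
  let ?r = "\<lambda>bs t. t \<notin> Q \<and> bs t"
  have "?SQ \<subseteq> ?r ` (?S \<inter> {bs. good bs})"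
  proof
    fix f assume f: "f \<in> ?SQ"
    then have f': "\<forall>t. t \<ge> T \<or> t \<in> Q \<longrightarrow> \<not> f t" by (auto simp: PiE_dflt_def)
    then obtain bs' where bs': "\<forall>t. t \<notin> Q \<longrightarrow> bs' t = f t" "good bs'" using good[of f] by blast
    have "f = ?r bs'" using bs' f' by fastforce
    moreover have "bs' \<in> ?S \<inter> {bs. good bs}" using bs' f' Q by fastforce
    ultimately show "f \<in> ?r ` (?S \<inter> {bs. good bs})" by blast
  qed
  then have "card ?SQ \<le> card (?S \<inter> {bs. good bs})"
    by (rule surj_card_le[rotated]) (simp add: bits_uniform)
  moreover have "card ?SQ = 2 ^ (T - card Q)"
    using Q finite_subset[OF Q] by (simp add: card_PiE_dflt card_Diff_subset)
  ultimately have "(2::real) ^ (T - card Q) \<le> card (?S \<inter> {bs. good bs})"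
    by (metis of_nat_le_iff of_nat_numeral of_nat_power)
  moreover have "?S \<noteq> {}" by auto
  moreover have "(2::real) ^ (T - card Q) = 2 ^ T * (1/2) ^ card Q"
    using card_mono[OF _ Q] by (simp add: power_diff power_one_over)
  ultimately show ?thesis
    by (simp add: bits_uniform card_bits measure_pmf_of_set field_simps)
qed

section \<open>Structured commands and weakest preconditions\<close>

datatype com = Basic instr | Seq com com | IfZero nat com com | While nat com

primrec csize :: "com \<Rightarrow> nat" where
  "csize (Basic i) = 1"
| "csize (Seq c d) = csize c + csize d"
| "csize (IfZero r c d) = csize c + csize d + 2"
| "csize (While r c) = csize c + 2"

text \<open>Jump targets are absolute, so code is generated for the address l at which it will
  stand. The nonzero branch comes first and ends with a jump over the zero branch; it costs one step
  more.\<close>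

primrec compile :: "nat \<Rightarrow> com \<Rightarrow> instr list" where
  "compile l (Basic i) = [i]"
| "compile l (Seq c d) = compile l c @ compile (l + csize c) d"
| "compile l (IfZero r c d) = JumpZero r (l + csize d + 2) # compile (Suc l) d @
     Jump (l + csize d + 2 + csize c) # compile (l + csize d + 2) c"
| "compile l (While r c) = JumpZero r (l + csize c + 2) # compile (Suc l) c @ [Jump l]"

lemma length_compile [simp]: "length (compile l c) = csize c"
  by (induction c arbitrary: l) auto

type_synonym store = "nat \<Rightarrow> nat"

text \<open>Control flow is left to the compiler, so jumps and halts as basic commands have no valid
  outcome. Only instructions that may create a larger number check the bound B.\<close>

fun wp_instr :: "nat \<Rightarrow> bool \<Rightarrow> instr \<Rightarrow> (store \<Rightarrow> store \<Rightarrow> bool) \<Rightarrow> store \<Rightarrow> store \<Rightarrow> bool" where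
  "wp_instr B b (Const r n) Q R M = (n \<le> B \<and> Q (R(r := n)) M)"
| "wp_instr B b (Move r s) Q R M = Q (R(r := R s)) M"
| "wp_instr B b (Add r s u) Q R M = (R s + R u \<le> B \<and> Q (R(r := R s + R u)) M)"
| "wp_instr B b (Sub r s u) Q R M = Q (R(r := R s - R u)) M"
| "wp_instr B b (Load r s) Q R M = Q (R(r := M (R s))) M"
| "wp_instr B b (Store r s) Q R M = Q R (M(R r := R s))"
| "wp_instr B b (Flip r) Q R M = (1 \<le> B \<and> Q (R(r := of_bool b)) M)"
| "wp_instr B b (Jump l) Q R M = False"
| "wp_instr B b (JumpZero r l) Q R M = False"
| "wp_instr B b (Halt a) Q R M = False"

text \<open>Weakest preconditions for terminating runs that keep all numbers below \<open>B\<close>. The last argument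
  of predicates is the time, at which the random bit \<open>bs t\<close> is available; the bound on the number
  of iterations makes the fixed point for loops the least one.\<close>

type_synonym pred = "store \<Rightarrow> store \<Rightarrow> nat \<Rightarrow> bool"

primrec wp_loop :: "nat \<Rightarrow> (pred \<Rightarrow> pred) \<Rightarrow> pred \<Rightarrow> nat \<Rightarrow> pred" where
  "wp_loop r w Q 0 = (\<lambda>R M t. False)"
| "wp_loop r w Q (Suc m) = (\<lambda>R M t. if R r = 0 then Q R M (Suc t)
     else w (\<lambda>R M t. wp_loop r w Q m R M (Suc t)) R M (Suc t))"

primrec wp :: "nat \<Rightarrow> (nat \<Rightarrow> bool) \<Rightarrow> com \<Rightarrow> pred \<Rightarrow> pred" where
  "wp B bs (Basic i) Q = (\<lambda>R M t. wp_instr B (bs t) i (\<lambda>R M. Q R M (Suc t)) R M)"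
| "wp B bs (Seq c d) Q = wp B bs c (wp B bs d Q)"
| "wp B bs (IfZero r c d) Q = (\<lambda>R M t. if R r = 0 then wp B bs c Q R M (Suc t)
     else wp B bs d (\<lambda>R M t. Q R M (Suc t)) R M (Suc t))"
| "wp B bs (While r c) Q = (\<lambda>R M t. \<exists>m. wp_loop r (wp B bs c) Q m R M t)"

inductive reach :: "instr list \<Rightarrow> (nat \<Rightarrow> bool) \<Rightarrow> nat \<Rightarrow> nat \<Rightarrow> config \<Rightarrow> nat \<Rightarrow> config \<Rightarrow> bool"
  for P bs B where
  refl: "bounded_config B cfg \<Longrightarrow> reach P bs B t cfg t cfg"
| step: "bounded_config B cfg \<Longrightarrow> reach P bs B (Suc t) (dstep P (bs t) cfg) t' cfg' \<Longrightarrow>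
    reach P bs B t cfg t' cfg'"

lemma reach_trans: "reach P bs B t cfg t' cfg' \<Longrightarrow> reach P bs B t' cfg' t'' cfg'' \<Longrightarrow> reach P bs B t cfg t'' cfg''"
  by (induction rule: reach.induct) (auto intro: reach.step)

lemma reach_bounded: "reach P bs B t cfg t' cfg' \<Longrightarrow> bounded_config B cfg'"
  by (induction rule: reach.induct) auto

lemma reach_drun:
  assumes "reach P bs B t cfg t' cfg'" "cfg = drun P bs cfg0 t"
  shows "t \<le> t' \<and> cfg' = drun P bs cfg0 t' \<and> (\<forall>s. t \<le> s \<and> s \<le> t' \<longrightarrow> bounded_config B (drun P bs cfg0 s))"
  using assms
proof (induction rule: reach.induct)
  case (step cfg t t' cfg')
  then have "Suc t \<le> t' \<and> cfg' = drun P bs cfg0 t' \<and> (\<forall>s. Suc t \<le> s \<and> s \<le> t' \<longrightarrow> bounded_config B (drun P bs cfg0 s))"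
    by simp
  moreover have "t \<le> s \<Longrightarrow> s = t \<or> Suc t \<le> s" for s by auto
  ultimately show ?case using step by (metis Suc_leD)
qed auto

definition code_at :: "instr list \<Rightarrow> nat \<Rightarrow> instr list \<Rightarrow> bool" where
  "code_at P l xs \<longleftrightarrow> (\<forall>i < length xs. l + i < length P \<and> P ! (l + i) = xs ! i)"

lemma code_at_Cons: "code_at P l (x # xs) \<longleftrightarrow> l < length P \<and> P ! l = x \<and> code_at P (Suc l) xs"
  by (simp add: code_at_def All_less_Suc2)

lemma code_at_append: "code_at P l (xs @ ys) \<longleftrightarrow> code_at P l xs \<and> code_at P (l + length xs) ys"
proof (induction xs arbitrary: l)
  case Nil
  then show ?case by (simp add: code_at_def)
qed (simp add: code_at_Cons)

lemma wp_instr_sound: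
  assumes "wp_instr B b i Q R M" "bounded_config B (Running l R M)"
  shows "\<exists>R' M'. dexec i b l R M = Running (Suc l) R' M' \<and> Q R' M' \<and> bounded_config B (Running (Suc l) R' M')"
  using assms by (cases i) (auto intro: le_trans[OF diff_le_self] simp: of_bool_def split: if_splits)

lemma wp_sound:
  assumes "wp B bs c Q R M t" "code_at P l (compile l c)" "bounded_config B (Running l R M)"
  shows "\<exists>R' M' t'. Q R' M' t' \<and> reach P bs B t (Running l R M) t' (Running (l + csize c) R' M')"
  using assms
proof (induction c arbitrary: Q R M t l)
  case (Basic i)
  have P: "l < length P" "P ! l = i" using Basic by (auto simp: code_at_Cons)
  obtain R' M' where *: "dexec i (bs t) l R M = Running (Suc l) R' M'" "Q R' M' (Suc t)"
    "bounded_config B (Running (Suc l) R' M')"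
    using wp_instr_sound[OF _ Basic(3)] Basic(1) unfolding wp.simps by blast
  have "reach P bs B t (Running l R M) (Suc t) (Running (Suc l) R' M')"
    by (rule reach.step[OF Basic(3)]) (use * P in \<open>auto intro!: reach.refl simp del: bounded_config.simps\<close>)
  then show ?case using * by auto
next
  case (Seq c d)
  then have "code_at P l (compile l c)" "code_at P (l + csize c) (compile (l + csize c) d)"
    by (auto simp: code_at_append)
  with Seq.prems obtain R' M' t' where
    1: "wp B bs d Q R' M' t'" "reach P bs B t (Running l R M) t' (Running (l + csize c) R' M')"
    using Seq.IH(1) by (metis wp.simps(2))
  obtain R'' M'' t'' where "Q R'' M'' t''"
    "reach P bs B t' (Running (l + csize c) R' M') t'' (Running (l + csize c + csize d) R'' M'')"
    using Seq.IH(2)[OF 1(1) \<open>code_at P (l + csize c) _\<close> reach_bounded[OF 1(2)]] by blast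
  then have "Q R'' M'' t'' \<and> reach P bs B t (Running l R M) t'' (Running (l + csize (Seq c d)) R'' M'')"
    using reach_trans[OF 1(2)] by (simp add: add.assoc)
  then show ?case by blast
next
  case (IfZero r c d)
  have P: "l < length P" "P ! l = JumpZero r (l + csize d + 2)" "code_at P (Suc l) (compile (Suc l) d)"
    "Suc l + csize d < length P" "P ! (Suc l + csize d) = Jump (l + csize d + 2 + csize c)"
    "code_at P (l + csize d + 2) (compile (l + csize d + 2) c)"
    using IfZero.prems(2) by (auto simp: code_at_Cons code_at_append)
  show ?case
  proof (cases "R r = 0")
    case True
    then have "wp B bs c Q R M (Suc t)" using IfZero.prems(1) by simp
    moreover have "bounded_config B (Running (l + csize d + 2) R M)" using IfZero.prems(3) by simp
    ultimately obtain R' M' t' where Q: "Q R' M' t'"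
      and "reach P bs B (Suc t) (Running (l + csize d + 2) R M) t' (Running (l + csize d + 2 + csize c) R' M')"
      using IfZero.IH(1) P(6) by blast
    then have "reach P bs B t (Running l R M) t' (Running (l + csize d + 2 + csize c) R' M')"
      using True P by (intro reach.step[OF IfZero.prems(3)]) simp
    then show ?thesis using Q by (auto simp: ac_simps)
  next
    case False
    then have "wp B bs d (\<lambda>R M t. Q R M (Suc t)) R M (Suc t)" using IfZero.prems(1) by simp
    moreover have "bounded_config B (Running (Suc l) R M)" using IfZero.prems(3) by simp
    ultimately obtain R' M' t' where Q: "Q R' M' (Suc t')"
      and r: "reach P bs B (Suc t) (Running (Suc l) R M) t' (Running (Suc l + csize d) R' M')"
      using IfZero.IH(2) P(3) by blast
    have "reach P bs B t (Running l R M) t' (Running (Suc l + csize d) R' M')"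
      using False P r by (intro reach.step[OF IfZero.prems(3)]) simp
    moreover have "reach P bs B t' (Running (Suc l + csize d) R' M') (Suc t') (Running (l + csize d + 2 + csize c) R' M')"
      using P reach_bounded[OF r] by (intro reach.step[OF reach_bounded[OF r]]) (auto intro: reach.refl)
    ultimately have "reach P bs B t (Running l R M) (Suc t') (Running (l + csize d + 2 + csize c) R' M')"
      by (rule reach_trans)
    then show ?thesis using Q by (auto simp: ac_simps)
  qed
next
  case (While r c)
  have P: "l < length P" "P ! l = JumpZero r (l + csize c + 2)" "code_at P (Suc l) (compile (Suc l) c)"
    "Suc l + csize c < length P" "P ! (Suc l + csize c) = Jump l"
    using While.prems(2) by (auto simp: code_at_Cons code_at_append)
  let ?W = "wp_loop r (wp B bs c) Q"
  obtain m where "?W m R M t" using While.prems(1) by auto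
  then show ?case
    using While.prems(3)
  proof (induction m arbitrary: R M t)
    case (Suc m)
    show ?case
    proof (cases "R r = 0")
      case True
      then have "Q R M (Suc t)" using Suc.prems(1) by simp
      moreover have "reach P bs B t (Running l R M) (Suc t) (Running (l + csize c + 2) R M)"
        using True P Suc.prems(2) by (intro reach.step[OF Suc.prems(2)]) (auto intro: reach.refl)
      ultimately show ?thesis by auto
    next
      case False
      then have "wp B bs c (\<lambda>R M t. ?W m R M (Suc t)) R M (Suc t)"
        using Suc.prems(1) by simp
      moreover have "bounded_config B (Running (Suc l) R M)" using Suc.prems(2) by simp
      ultimately obtain R' M' t' where Q: "?W m R' M' (Suc t')"
        and r: "reach P bs B (Suc t) (Running (Suc l) R M) t' (Running (Suc l + csize c) R' M')"
        using While.IH P(3) by blast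
      have "reach P bs B t (Running l R M) t' (Running (Suc l + csize c) R' M')"
        using False P r by (intro reach.step[OF Suc.prems(2)]) simp
      moreover have "reach P bs B t' (Running (Suc l + csize c) R' M') (Suc t') (Running l R' M')"
        using P reach_bounded[OF r] by (intro reach.step[OF reach_bounded[OF r]]) (auto intro: reach.refl)
      ultimately have r2: "reach P bs B t (Running l R M) (Suc t') (Running l R' M')"
        by (rule reach_trans)
      then show ?thesis using Suc.IH[OF Q reach_bounded[OF r2]] reach_trans[OF r2] by blast
    qed
  qed simp
qed

lemma wp_instr_mono: "wp_instr B b i Q R M \<Longrightarrow> (\<And>R M. Q R M \<Longrightarrow> Q' R M) \<Longrightarrow> wp_instr B b i Q' R M"
  by (cases i) auto

lemma wp_mono: "wp B bs c Q R M t \<Longrightarrow> (\<And>R M t. Q R M t \<Longrightarrow> Q' R M t) \<Longrightarrow> wp B bs c Q' R M t"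
proof (induction c arbitrary: Q Q' R M t)
  case (Basic i)
  then show ?case by (auto intro: wp_instr_mono)
next
  case (Seq c d)
  show ?case using Seq.prems(1) unfolding wp.simps
    by (rule Seq.IH(1)) (rule Seq.IH(2)[OF _ Seq.prems(2)])
next
  case (IfZero r c d)
  then show ?case by (auto split: if_splits)
next
  case (While r c)
  have "wp_loop r (wp B bs c) Q m R M t \<Longrightarrow> wp_loop r (wp B bs c) Q' m R M t" for m R M t
  proof (induction m arbitrary: R M t)
    case (Suc m)
    show ?case
    proof (cases "R r = 0")
      case False
      then have "wp B bs c (\<lambda>R M t. wp_loop r (wp B bs c) Q m R M (Suc t)) R M (Suc t)"
        using Suc.prems by simp
      then have "wp B bs c (\<lambda>R M t. wp_loop r (wp B bs c) Q' m R M (Suc t)) R M (Suc t)"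
        by (rule While.IH) (rule Suc.IH)
      then show ?thesis using False by simp
    qed (use Suc.prems While.prems(2) in simp)
  qed simp
  then show ?case using While.prems(1) unfolding wp.simps by blast
qed

lemma wp_While:
  fixes I :: "nat \<Rightarrow> pred"
  assumes "I k R M t"
    and exit: "\<And>k R M t. I k R M t \<Longrightarrow> R r = 0 \<Longrightarrow> Q R M (Suc t)"
    and body: "\<And>k R M t. I k R M t \<Longrightarrow> R r \<noteq> 0 \<Longrightarrow>
      wp B bs c (\<lambda>R M t. \<exists>k'<k. I k' R M (Suc t)) R M (Suc t)"
  shows "wp B bs (While r c) Q R M t"
proof -
  let ?W = "wp_loop r (wp B bs c) Q"
  have mono: "?W m R M t \<Longrightarrow> ?W (Suc m) R M t" for m R M t
  proof (induction m arbitrary: R M t)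
    case (Suc m)
    show ?case
    proof (cases "R r = 0")
      case False
      then have "wp B bs c (\<lambda>R M t. ?W m R M (Suc t)) R M (Suc t)" using Suc.prems by simp
      then have "wp B bs c (\<lambda>R M t. ?W (Suc m) R M (Suc t)) R M (Suc t)"
        by (rule wp_mono) (rule Suc.IH)
      then show ?thesis using False by simp
    qed (use Suc.prems in simp)
  qed simp
  have mono': "m \<le> m' \<Longrightarrow> ?W m R M t \<Longrightarrow> ?W m' R M t" for m m' R M t
    by (induction m' rule: dec_induct) (use mono in blast)+
  have "?W (Suc k) R M t" if "I k R M t" for k R M t
    using that
  proof (induction k arbitrary: R M t rule: less_induct)
    case (less k)
    show ?case
    proof (cases "R r = 0")
      case True
      then show ?thesis using exit less.prems by simp
    next
      case False
      have "wp B bs c (\<lambda>R M t. ?W k R M (Suc t)) R M (Suc t)"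
        using body[OF less.prems False]
      proof (rule wp_mono)
        fix R M t assume "\<exists>k'<k. I k' R M (Suc t)"
        then obtain k' where "k' < k" "I k' R M (Suc t)" by blast
        then show "?W k R M (Suc t)"
          using less.IH mono'[of "Suc k'" k] by auto
      qed
      then show ?thesis using False by simp
    qed
  qed
  then show ?thesis using assms(1) unfolding wp.simps by blast
qed

text \<open>Loop-free code executes each instruction at most once, so its length bounds its running time.\<close>

primrec lwp :: "nat \<Rightarrow> com \<Rightarrow> (store \<Rightarrow> store \<Rightarrow> bool) \<Rightarrow> store \<Rightarrow> store \<Rightarrow> bool" where
  "lwp B (Basic i) Q = (\<lambda>R M. (\<forall>r. i \<noteq> Flip r) \<and> wp_instr B False i Q R M)"
| "lwp B (Seq c d) Q = lwp B c (lwp B d Q)"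
| "lwp B (IfZero r c d) Q = (\<lambda>R M. if R r = 0 then lwp B c Q R M else lwp B d Q R M)"
| "lwp B (While r c) Q = (\<lambda>R M. False)"

lemma lwp_mono: "lwp B c Q R M \<Longrightarrow> (\<And>R M. Q R M \<Longrightarrow> Q' R M) \<Longrightarrow> lwp B c Q' R M"
proof (induction c arbitrary: Q Q' R M)
  case (Basic i)
  then show ?case by (auto intro: wp_instr_mono)
next
  case (Seq c d)
  show ?case using Seq.prems(1) unfolding lwp.simps
    by (rule Seq.IH(1)) (rule Seq.IH(2)[OF _ Seq.prems(2)])
next
  case (IfZero r c d)
  then show ?case by (auto split: if_splits)
qed simp

lemma lwp_wp: "lwp B c Q R M \<Longrightarrow> wp B bs c (\<lambda>R M t'. Q R M \<and> t' \<le> t + csize c) R M t"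
proof (induction c arbitrary: Q R M t)
  case (Basic i)
  then show ?case by (cases i) auto
next
  case (Seq c d)
  have "wp B bs c (\<lambda>R M t'. lwp B d Q R M \<and> t' \<le> t + csize c) R M t"
    using Seq.IH(1) Seq.prems by simp
  then show ?case
    unfolding wp.simps
  proof (rule wp_mono)
    fix R M t' assume "lwp B d Q R M \<and> t' \<le> t + csize c"
    then have d: "wp B bs d (\<lambda>R M t''. Q R M \<and> t'' \<le> t' + csize d) R M t'" "t' \<le> t + csize c"
      using Seq.IH(2) by auto
    from d(1) show "wp B bs d (\<lambda>R M t'. Q R M \<and> t' \<le> t + csize (Seq c d)) R M t'"
      by (rule wp_mono) (use d(2) in auto)
  qed
next
  case (IfZero r c d)
  show ?case
  proof (cases "R r = 0")
    case True
    then have "wp B bs c (\<lambda>R M t'. Q R M \<and> t' \<le> Suc t + csize c) R M (Suc t)"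
      using IfZero.IH(1)[of Q R M "Suc t"] IfZero.prems by simp
    then have "wp B bs c (\<lambda>R M t'. Q R M \<and> t' \<le> t + csize (IfZero r c d)) R M (Suc t)"
      by (rule wp_mono) auto
    then show ?thesis using True by simp
  next
    case False
    then have "wp B bs d (\<lambda>R M t'. Q R M \<and> t' \<le> Suc t + csize d) R M (Suc t)"
      using IfZero.IH(2)[of Q R M "Suc t"] IfZero.prems by simp
    then have "wp B bs d (\<lambda>R M t'. Q R M \<and> Suc t' \<le> t + csize (IfZero r c d)) R M (Suc t)"
      by (rule wp_mono) auto
    then show ?thesis using False by simp
  qed
qed simp

section \<open>Evaluation of circuits\<close>

text \<open>Moving register 1 to itself serves as the empty command.\<close>

primrec block :: "com list \<Rightarrow> com" where
  "block [] = Basic (Move 1 1)"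
| "block (c # cs) = Seq c (block cs)"

text \<open>Case distinction by counting register r down, with register 1 as the constant one. The
  chosen branch starts with r = 0, and for a fixed list the cost is constant.\<close>

primrec sel :: "nat \<Rightarrow> com list \<Rightarrow> com" where
  "sel r [] = Basic (Move 1 1)"
| "sel r (c # cs) = IfZero r c (Seq (Basic (Sub r r 1)) (sel r cs))"

lemma lwp_sel:
  "R 1 = 1 \<Longrightarrow> r \<noteq> 1 \<Longrightarrow> R r < length cs \<Longrightarrow> lwp B (cs ! R r) Q (R(r := 0)) M \<Longrightarrow> lwp B (sel r cs) Q R M"
proof (induction cs arbitrary: R)
  case (Cons c cs)
  show ?case
  proof (cases "R r")
    case 0
    then have "R(r := 0) = R" by auto
    then show ?thesis using Cons.prems 0 by simp
  next
    case (Suc m)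
    have "lwp B (sel r cs) Q (R(r := m)) M"
    proof (rule Cons.IH)
      have "lwp B (cs ! m) Q (R(r := 0)) M" using Cons.prems(4) unfolding Suc nth_Cons_Suc .
      then show "lwp B (cs ! (R(r := m)) r) Q ((R(r := m))(r := 0)) M"
        unfolding fun_upd_upd fun_upd_same .
    qed (use Cons.prems Suc in auto)
    then show ?thesis using Cons.prems Suc by simp
  qed
qed simp

text \<open>Uniformity in the starting time lets the time bounds of consecutive commands add
  up.\<close>

definition tw :: "nat \<Rightarrow> (nat \<Rightarrow> bool) \<Rightarrow> com \<Rightarrow> (store \<Rightarrow> store \<Rightarrow> bool) \<Rightarrow> nat \<Rightarrow> store \<Rightarrow> store \<Rightarrow> bool" where
  "tw B bs c Q a R M \<longleftrightarrow> (\<forall>t. wp B bs c (\<lambda>R M t'. Q R M \<and> t' \<le> t + a) R M t)"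

lemma tw_Seq:
  assumes "tw B bs c Q1 a R M" "\<And>R M. Q1 R M \<Longrightarrow> tw B bs d Q2 b R M"
  shows "tw B bs (Seq c d) Q2 (a + b) R M"
  unfolding tw_def wp.simps
proof
  fix t
  have "wp B bs c (\<lambda>R M t'. Q1 R M \<and> t' \<le> t + a) R M t" using assms(1) by (simp add: tw_def)
  then show "wp B bs c (wp B bs d (\<lambda>R M t'. Q2 R M \<and> t' \<le> t + (a + b))) R M t"
  proof (rule wp_mono)
    fix R M t' assume t': "Q1 R M \<and> t' \<le> t + a"
    then have "wp B bs d (\<lambda>R M t''. Q2 R M \<and> t'' \<le> t' + b) R M t'" using assms(2) by (simp add: tw_def)
    then show "wp B bs d (\<lambda>R M t'. Q2 R M \<and> t' \<le> t + (a + b)) R M t'"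
      by (rule wp_mono) (use t' in auto)
  qed
qed

lemma lwp_tw: "lwp B c Q R M \<Longrightarrow> tw B bs c Q (csize c) R M"
  by (simp add: tw_def lwp_wp)

lemma tw_While:
  fixes J :: "nat \<Rightarrow> store \<Rightarrow> store \<Rightarrow> bool"
  assumes J: "J k R M" and k: "k \<le> m"
    and exit: "\<And>k R M. J k R M \<Longrightarrow> R r = 0 \<Longrightarrow> Q R M"
    and body: "\<And>k R M. J k R M \<Longrightarrow> R r \<noteq> 0 \<Longrightarrow> lwp B c (\<lambda>R M. \<exists>k'<k. J k' R M) R M"
  shows "tw B bs (While r c) Q (1 + m * (csize c + 2)) R M"
  unfolding tw_def
proof
  fix t
  let ?s = "csize c + 2"
  show "wp B bs (While r c) (\<lambda>R M t'. Q R M \<and> t' \<le> t + (1 + m * ?s)) R M t"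
  \<comment> \<open>An iteration, including test and jump back, costs at most \<open>?s\<close> and
    lowers k, so the time plus \<open>k * ?s\<close> does not grow.\<close>
  proof (rule wp_While[where I = "\<lambda>k R M t'. J k R M \<and> t' + k * ?s \<le> t + m * ?s" and k = k])
    show "J k R M \<and> t + k * ?s \<le> t + m * ?s" using J mult_le_mono1[OF k, of ?s] by (simp del: mult_Suc_right)
    fix k' R M t' assume I: "J k' R M \<and> t' + k' * ?s \<le> t + m * ?s"
    show "Q R M \<and> Suc t' \<le> t + (1 + m * ?s)" if "R r = 0" using I exit that by auto
    show "wp B bs c (\<lambda>R M t'. \<exists>k''<k'. J k'' R M \<and> Suc t' + k'' * ?s \<le> t + m * ?s) R M (Suc t')"
      if "R r \<noteq> 0"
    proof (rule wp_mono[OF lwp_wp[OF body]])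
      show "J k' R M" "R r \<noteq> 0" using I that by auto
      fix R M t'' assume *: "(\<exists>k''<k'. J k'' R M) \<and> t'' \<le> Suc t' + csize c"
      then obtain k'' where k'': "k'' < k'" "J k'' R M" by blast
      then have "Suc k'' * ?s \<le> k' * ?s" by (intro mult_le_mono1) simp
      then have "Suc t'' + k'' * ?s \<le> t + m * ?s" using * I by simp
      then show "\<exists>k''<k'. J k'' R M \<and> Suc t'' + k'' * ?s \<le> t + m * ?s" using k'' by blast
    qed
  qed
qed

text \<open>The flips are unrolled, so the j-th one happens exactly \<open>2 * j\<close> steps after
  the first.\<close>

definition flips :: "nat \<Rightarrow> com list" where
  "flips m = concat (replicate m [Basic (Flip 12), Basic (Add 9 9 12)])"

lemma wp_flips:
  assumes "R 9 + m \<le> B" "1 \<le> B"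
    and "\<And>R'. (\<And>r. r \<noteq> 9 \<Longrightarrow> r \<noteq> 12 \<Longrightarrow> R' r = R r) \<Longrightarrow> R' 9 = R 9 + (\<Sum>j<m. of_bool (bs (t + 2 * j))) \<Longrightarrow>
      wp B bs (block cs) Q R' M (t + 2 * m)"
  shows "wp B bs (block (flips m @ cs)) Q R M t"
  using assms
proof (induction m arbitrary: R t)
  case 0
  then show ?case by (simp add: flips_def)
next
  case (Suc m)
  let ?b = "of_bool (bs t) :: nat"
  let ?R = "R(12 := ?b, 9 := R 9 + ?b)"
  have "wp B bs (block (flips m @ cs)) Q ?R M (Suc (Suc t))"
  proof (rule Suc.IH)
    show "?R 9 + m \<le> B" using Suc.prems(1) by (auto simp: of_bool_def)
    show "1 \<le> B" by fact
    fix R' :: store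
    assume R': "\<And>r. r \<noteq> 9 \<Longrightarrow> r \<noteq> 12 \<Longrightarrow> R' r = ?R r"
      "R' 9 = ?R 9 + (\<Sum>j<m. of_bool (bs (Suc (Suc t) + 2 * j)))"
    have "wp B bs (block cs) Q R' M (t + 2 * Suc m)"
    proof (rule Suc.prems(3))
      show "R' r = R r" if "r \<noteq> 9" "r \<noteq> 12" for r using R'(1)[OF that] that by simp
      show "R' 9 = R 9 + (\<Sum>j<Suc m. of_bool (bs (t + 2 * j)))"
        unfolding R'(2) by (subst sum.lessThan_Suc_shift) simp
    qed
    then show "wp B bs (block cs) Q R' M (Suc (Suc t) + 2 * m)" by simp
  qed
  moreover have "R 9 + ?b \<le> B" using Suc.prems(1) by (auto simp: of_bool_def)
  ultimately show ?case using Suc.prems(2) by (simp add: flips_def fun_upd_twist)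
qed

section \<open>The program\<close>

locale csat_machine =
  fixes A :: "'a alg" and e :: "'a \<Rightarrow> nat"
  assumes alg: "is_algebra A" and fin: "finite (univ A)"
    and bij: "bij_betw e (univ A) {..<card (univ A)}"
begin

definition q :: nat where "q = card (univ A)"
definition dec :: "nat \<Rightarrow> 'a" where "dec = inv_into (univ A) e"
definition tab :: "nat \<Rightarrow> nat list \<Rightarrow> nat" where "tab f vs = e (oper A f (map dec vs))"

lemma dec_e: "a \<in> univ A \<Longrightarrow> dec (e a) = a"
  using bij by (simp add: dec_def bij_betw_def)

lemma e_dec: "m < q \<Longrightarrow> e (dec m) = m" and dec_in: "m < q \<Longrightarrow> dec m \<in> univ A"
  using bij by (auto simp: dec_def bij_betw_def q_def f_inv_into_f inv_into_into)

lemma e_less: "a \<in> univ A \<Longrightarrow> e a < q"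
  using bij by (auto simp: bij_betw_def q_def)

lemma q_pos: "q > 0"
  using alg fin by (simp add: q_def is_algebra_def card_gt_0_iff)

text \<open>Registers: 0 holds the length \<open>n\<close> of the input, 1 the constant one; 3, 4 and 5 hold the base
  addresses \<open>2n\<close>, \<open>3n\<close> and \<open>4n\<close> of the table of gate positions, of the table of gate values (0 for
  a gate not yet evaluated, otherwise the successor of its code) and of the stack; 6 is the stack
  pointer and 7 the height of the stack. The cells from \<open>n\<close> on hold the random valuation.\<close>

text \<open>The remaining operands of the gate on top of the stack are looked up one after the other: an
  unevaluated operand is pushed; if there is none, the position in the code determines the result.\<close>

primrec tree :: "nat \<Rightarrow> nat \<Rightarrow> nat list \<Rightarrow> com" where
  "tree f 0 = (\<lambda>vs. block [Basic (Const 9 (Suc (tab f vs))), Basic (Store 10 9)])"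
| "tree f (Suc m) = (\<lambda>vs. block [Basic (Add 8 8 1), Basic (Load 11 8), Basic (Add 12 4 11), Basic (Load 9 12),
     IfZero 9 (block [Basic (Store 6 11), Basic (Add 6 6 1), Basic (Add 7 7 1)])
       (Seq (Basic (Sub 9 9 1)) (sel 9 (map (\<lambda>b. tree f m (vs @ [b])) [0..<q])))])"

text \<open>Register 11 holds the top gate, 10 the address of its value and 8 the position in its
  code. A top gate that has a value is popped.\<close>

definition dfs_body :: com where
  "dfs_body = block [Basic (Sub 2 6 1), Basic (Load 11 2), Basic (Add 10 4 11), Basic (Load 9 10),
     IfZero 9
       (block [Basic (Add 8 3 11), Basic (Load 8 8), Basic (Load 9 8),
          IfZero 9 (block [Basic (Add 12 0 11), Basic (Load 9 12), Basic (Add 9 9 1), Basic (Store 10 9)])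
            (Seq (Basic (Sub 9 9 1))
              (IfZero 9 (block [Basic (Add 8 8 1), Basic (Load 9 8), Basic (Add 9 9 1), Basic (Store 10 9)])
                (block [Basic (Add 8 8 1), Basic (Load 9 8),
                   sel 9 (map (\<lambda>f. tree f (signature A ! f) []) [0..<length (signature A)])])))])
       (block [Basic (Move 6 2), Basic (Sub 7 7 1)])]"

text \<open>Register 8 walks through the code and 10 through the table. The code of an operation
  gate does not contain its length; the advance, the arity plus 2, is a program constant selected by
  the operation.\<close>

definition parse_body :: com where
  "parse_body = block [Basic (Store 10 8), Basic (Load 9 8),
     IfZero 9 (Basic (Add 8 8 1))
       (Seq (Basic (Sub 9 9 1))
         (IfZero 9 (block [Basic (Add 8 8 1), Basic (Add 8 8 1)])
           (block [Basic (Add 12 8 1), Basic (Load 9 12),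
              sel 9 (map (\<lambda>f. Basic (Const 9 (signature A ! f + 2))) [0..<length (signature A)]),
              Basic (Add 8 8 9)]))),
     Basic (Add 10 10 1), Basic (Sub 7 7 1)]"

definition sample_body :: com where
  "sample_body = block (Basic (Const 9 0) # flips (q - 1) @
     [Basic (Store 10 9), Basic (Add 10 10 1), Basic (Sub 7 7 1)])"

definition dfs_start :: "nat \<Rightarrow> com" where
  "dfs_start a = block [Basic (Const 2 a), Basic (Load 2 2), Basic (Store 5 2), Basic (Add 6 5 1), Basic (Const 7 1)]"

definition init :: com where
  "init = block [Basic (Const 1 1), Basic (Add 3 0 0), Basic (Add 4 3 0), Basic (Add 5 4 0),
     Basic (Move 7 0), Basic (Move 10 0)]"

definition parse_start :: com where
  "parse_start = block [Basic (Const 2 0), Basic (Load 7 2), Basic (Const 8 3), Basic (Move 10 3)]"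

text \<open>Subtraction is truncated, so the differences in both directions are added; the sum is
  zero exactly for equal values.\<close>

definition compare :: com where
  "compare = block [Basic (Const 2 1), Basic (Load 2 2), Basic (Add 10 4 2), Basic (Load 9 10),
     Basic (Const 2 2), Basic (Load 2 2), Basic (Add 10 4 2), Basic (Load 12 10),
     Basic (Sub 2 9 12), Basic (Sub 11 12 9), Basic (Add 2 2 11)]"

definition main_rest :: com where
  "main_rest = Seq parse_start (Seq (While 7 parse_body) (Seq (dfs_start 1) (Seq (While 7 dfs_body)
     (Seq (dfs_start 2) (Seq (While 7 dfs_body) compare)))))"

definition main :: com where
  "main = Seq init (Seq (While 7 sample_body) main_rest)"

definition program :: "instr list" where
  "program = compile 0 main @ [JumpZero 2 (csize main + 2), Halt False, Halt True]"

definition persistent :: "store \<Rightarrow> store \<Rightarrow> bool" where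
  "persistent R R' \<longleftrightarrow> R' 0 = R 0 \<and> R' 1 = R 1 \<and> R' 3 = R 3 \<and> R' 4 = R 4 \<and> R' 5 = R 5"

text \<open>The codes vs read so far are recorded by the position in the tree, not by a register;
  register 8 points to the cell before the next operand. The premises \<open>fin\<close> and
  \<open>push\<close> are the two continuations: all operands have values, or u is the first one
  without.\<close>

lemma lwp_tree:
  assumes "R 1 = 1" and "length us = m" and "\<And>l. l < m \<Longrightarrow> M (R 8 + Suc l) = us ! l"
    and "\<And>u. u \<in> set us \<Longrightarrow> R 4 + u \<le> B \<and> (M (R 4 + u) = 0 \<or> M (R 4 + u) = Suc (code u) \<and> code u < q)"
    and "R 8 + m \<le> B" "R 6 < B" "R 7 < B" "\<And>ws. length ws = length vs + m \<Longrightarrow> set ws \<subseteq> {..<q} \<Longrightarrow> tab f ws < q"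
    and "q \<le> B" "set vs \<subseteq> {..<q}"
    and fin: "\<And>R'. (\<And>u. u \<in> set us \<Longrightarrow> M (R 4 + u) \<noteq> 0) \<Longrightarrow> persistent R R' \<Longrightarrow> R' 6 = R 6 \<Longrightarrow> R' 7 = R 7 \<Longrightarrow>
      Q R' (M(R 10 := Suc (tab f (vs @ map code us))))"
    and push: "\<And>R' u. u \<in> set us \<Longrightarrow> M (R 4 + u) = 0 \<Longrightarrow> persistent R R' \<Longrightarrow> R' 6 = Suc (R 6) \<Longrightarrow> R' 7 = Suc (R 7) \<Longrightarrow>
      Q R' (M(R 6 := u))"
  shows "lwp B (tree f m vs) Q R M"
  using assms
proof (induction m arbitrary: R us vs)
  case 0
  have "tab f vs < q" using 0(8)[of vs] 0(2,10) by auto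
  then have "Suc (tab f vs) \<le> B" using 0(9) by simp
  moreover have "Q (R(9 := Suc (tab f vs))) (M(R 10 := Suc (tab f vs)))"
  proof -
    have "Q (R(9 := Suc (tab f vs))) (M(R 10 := Suc (tab f (vs @ map code us))))"
      by (rule 0(11)) (use 0(2) in \<open>auto simp: persistent_def\<close>)
    then show ?thesis using 0(2) by simp
  qed
  ultimately show ?case by (simp add: fun_upd_idem)
next
  case (Suc m)
  obtain u us' where us: "us = u # us'" using Suc.prems(2) by (cases us) auto
  have u: "M (Suc (R 8)) = u" using Suc.prems(3)[of 0] us by simp
  let ?R = "R(8 := Suc (R 8), 11 := u, 12 := R 4 + u, 9 := M (R 4 + u))"
  have bounds: "Suc (R 8) \<le> B" "R 4 + u \<le> B" using Suc.prems(4)[of u] Suc.prems(5) us by auto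
  show ?case
  proof (cases "M (R 4 + u) = 0")
    case True
    have "Q (R(8 := Suc (R 8), 11 := u, 12 := R 4 + u, 9 := 0, 6 := Suc (R 6), 7 := Suc (R 7))) (M(R 6 := u))"
      by (rule Suc.prems(12)) (use True us in \<open>auto simp: persistent_def\<close>)
    then show ?thesis using Suc.prems(1,6,7) bounds True u by (simp add: fun_upd_idem)
  next
    case False
    then have c: "M (R 4 + u) = Suc (code u)" "code u < q" using Suc.prems(4)[of u] us by auto
    let ?R' = "R(8 := Suc (R 8), 11 := u, 12 := R 4 + u, 9 := 0)"
    have "lwp B (tree f m (vs @ [code u])) Q ?R' M"
    proof (rule Suc.IH[where us = us'])
      show "M (?R' 8 + Suc l) = us' ! l" if "l < m" for l
        using Suc.prems(3)[of "Suc l"] that us by simp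
      show "?R' 4 + u' \<le> B \<and> (M (?R' 4 + u') = 0 \<or> M (?R' 4 + u') = Suc (code u') \<and> code u' < q)"
        if "u' \<in> set us'" for u'
        using Suc.prems(4)[of u'] that us by simp
      show "tab f ws < q" if "length ws = length (vs @ [code u]) + m" "set ws \<subseteq> {..<q}" for ws
        using Suc.prems(8)[of ws] that by simp
      show "Q R'' (M(?R' 10 := Suc (tab f ((vs @ [code u]) @ map code us'))))"
        if "\<And>u. u \<in> set us' \<Longrightarrow> M (?R' 4 + u) \<noteq> 0" "persistent ?R' R''" "R'' 6 = ?R' 6" "R'' 7 = ?R' 7" for R''
      proof -
        have eq: "(vs @ [code u]) @ map code us' = vs @ map code us" "?R' 10 = R 10" using us by simp_all
        show ?thesis unfolding eq
          by (rule Suc.prems(11)) (use that False us in \<open>auto simp: persistent_def\<close>)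
      qed
      show "Q R'' (M(?R' 6 := u'))"
        if "u' \<in> set us'" "M (?R' 4 + u') = 0" "persistent ?R' R''" "R'' 6 = Suc (?R' 6)" "R'' 7 = Suc (?R' 7)" for R'' u'
      proof -
        have eq: "?R' 6 = R 6" by simp
        show ?thesis unfolding eq
          by (rule Suc.prems(12)) (use that us in \<open>auto simp: persistent_def\<close>)
      qed
    qed (use Suc.prems us c in auto)
    then have "lwp B (sel 9 (map (\<lambda>b. tree f m (vs @ [b])) [0..<q])) Q
        (R(8 := Suc (R 8), 11 := u, 12 := R 4 + u, 9 := code u)) M"
      using c Suc.prems(1) by (intro lwp_sel) (simp_all add: fun_upd_upd)
    \<comment> \<open>The postcondition is adapted to the final no-operation of the enclosing
      block.\<close>
    then have "lwp B (sel 9 (map (\<lambda>b. tree f m (vs @ [b])) [0..<q])) (\<lambda>R. Q (R(Suc 0 := R (Suc 0))))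
        (R(8 := Suc (R 8), 11 := u, 12 := R 4 + u, 9 := code u)) M"
      by (rule lwp_mono) simp
    then show ?thesis using Suc.prems(1) bounds c u by (simp add: fun_upd_idem)
  qed
qed

end

lemma concat_nth_offset:
  assumes "i < length xss" "j < length (xss ! i)"
  shows "concat xss ! (length (concat (take i xss)) + j) = xss ! i ! j"
proof -
  have "concat xss = concat (take i xss) @ xss ! i @ concat (drop (Suc i) xss)"
    by (metis id_take_nth_drop[OF assms(1)] concat.simps(2) concat_append)
  then show ?thesis using assms(2) by (simp add: nth_append)
qed

lemma computes_cong:
  "computes A C x i a \<Longrightarrow> (\<And>j. j < length C \<Longrightarrow> x j = x' j) \<Longrightarrow> computes A C x' i a"
proof (induction rule: computes.induct)
  case (InGate i)
  then show ?case using computes.InGate[of i C A x'] by simp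
next
  case (OpGate i f js as)
  have "list_all2 (computes A C x') js as"
    using OpGate.IH OpGate.prems by (auto elim: list_all2_mono)
  then show ?case using OpGate.hyps by (intro computes.OpGate)
qed (auto intro: computes.ConstGate)

context csat_machine
begin

text \<open>The random value of cell \<open>i\<close>: the number of ones among \<open>q - 1\<close> fair bits. The bits are those
  drawn at the moments at which the sampling loop executes its flips.\<close>

definition draw :: "(nat \<Rightarrow> bool) \<Rightarrow> nat \<Rightarrow> nat" where
  "draw bs i = (\<Sum>j<q - 1. of_bool (bs (9 + i * (2 * (q - 1) + 7) + 2 * j)))"

lemma draw_less: "draw bs i < q"
proof -
  have "draw bs i \<le> (\<Sum>j<q - 1. 1)" unfolding draw_def by (intro sum_mono) auto
  then show ?thesis using q_pos by simp
qed

end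

section \<open>Depth first search on a fixed instance and bit sequence\<close>

locale csat_run = csat_machine +
  fixes C :: "'a circuit" and g1 g2 :: nat and bs :: "nat \<Rightarrow> bool" and B :: nat and n :: nat
  assumes inst: "csat_instance A (C, g1, g2)"
    and n_def: "n = length (encode_csat e (C, g1, g2))"
    and B: "5 * n + card (univ A) + sum_list (signature A) + length (signature A) + 10 \<le> B"
begin

abbreviation N :: nat where "N \<equiv> length C"
definition w :: "nat list" where "w = encode_csat e (C, g1, g2)"
definition adr :: "nat \<Rightarrow> nat" where "adr i = 3 + length (concat (take i (map (encode_gate e) C)))"

lemma g: "g1 < N" "g2 < N" and circ: "is_circuit A C"
  using inst by (auto simp: csat_instance_def)

lemma valid: "i < N \<Longrightarrow> valid_gate A N (C ! i)"
  using circ by (auto simp: is_circuit_def)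

lemma lw: "length w = n" by (simp add: w_def n_def)

lemma w_eq: "w = [N, g1, g2] @ concat (map (encode_gate e) C)"
  by (simp add: w_def encode_csat_def)

lemma w_head: "w ! 0 = N" "w ! 1 = g1" "w ! 2 = g2"
  by (simp_all add: w_eq)

lemma adr_0: "adr 0 = 3" and adr_Suc: "i < N \<Longrightarrow> adr (Suc i) = adr i + length (encode_gate e (C ! i))"
  by (simp_all add: adr_def take_Suc_conv_app_nth)

lemma adr_N: "adr N = n"
  by (simp add: adr_def w_eq flip: lw)

lemma adr_mono: "i \<le> j \<Longrightarrow> j \<le> N \<Longrightarrow> adr i \<le> adr j"
  by (induction j rule: dec_induct) (auto simp: adr_Suc)

lemma adr_less: "i < N \<Longrightarrow> j < length (encode_gate e (C ! i)) \<Longrightarrow> adr i + j < n"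
  using adr_mono[of "Suc i" N] by (simp add: adr_Suc adr_N)

lemma w_gate: "i < N \<Longrightarrow> j < length (encode_gate e (C ! i)) \<Longrightarrow> w ! (adr i + j) = encode_gate e (C ! i) ! j"
proof -
  assume i: "i < N" "j < length (encode_gate e (C ! i))"
  have "w ! (adr i + j) = concat (map (encode_gate e) C) ! (length (concat (take i (map (encode_gate e) C))) + j)"
    by (simp add: w_eq adr_def)
  also have "\<dots> = map (encode_gate e) C ! i ! j"
    by (rule concat_nth_offset) (use i in auto)
  finally show ?thesis using i by simp
qed

lemma encode_gate_length: "length (encode_gate e G) \<ge> 1"
  by (cases G) auto

lemma N_le: "N + 3 \<le> n"
proof -
  have "i \<le> N \<Longrightarrow> 3 + i \<le> adr i" for i
  proof (induction i)
    case (Suc i)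
    then show ?case using encode_gate_length[of "C ! i"] by (simp add: adr_Suc)
  qed (simp add: adr_0)
  then show ?thesis using adr_N by force
qed

lemma arity_le: "f < length (signature A) \<Longrightarrow> signature A ! f \<le> sum_list (signature A)"
  by (simp add: member_le_sum_list)

lemma w_bound: "j < n \<Longrightarrow> w ! j \<le> B"
proof -
  assume j: "j < n"
  have "x \<le> B" if "x \<in> set (encode_gate e (C ! i))" "i < N" for x i
    using that valid[OF that(2)] B N_le e_less by (cases "C ! i") (fastforce simp: q_def)+
  then have "x \<le> B" if "x \<in> set (concat (map (encode_gate e) C))" for x
    using that by (auto simp: in_set_conv_nth[of _ C])
  then have "\<forall>x\<in>set w. x \<le> B" using g N_le B by (auto simp: w_eq)
  then show ?thesis using j lw by (metis nth_mem)
qed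

definition X :: "nat \<Rightarrow> nat" where "X i = draw bs i"
definition x :: "nat \<Rightarrow> 'a" where "x i = dec (X i)"

lemma X_less: "X i < q"
  by (simp add: X_def draw_less)

lemma x_range: "range x \<subseteq> univ A"
  using dec_in X_less by (auto simp: x_def)

definition v :: "nat \<Rightarrow> 'a" where "v i = (SOME a. a \<in> univ A \<and> computes A C x i a)"

lemma v: "i < N \<Longrightarrow> v i \<in> univ A" "i < N \<Longrightarrow> computes A C x i (v i)"
proof -
  assume "i < N"
  then have "\<exists>a. a \<in> univ A \<and> computes A C x i a"
    using computes_exists[OF alg circ x_range] by blast
  from someI_ex[OF this] show "v i \<in> univ A" "computes A C x i (v i)"
    by (simp_all add: v_def)
qed

lemma v_InGate: "i < N \<Longrightarrow> C ! i = InGate \<Longrightarrow> e (v i) = X i"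
  using computes_unique[OF v(2) computes.InGate] e_dec[OF X_less] by (metis x_def)

lemma v_ConstGate: "i < N \<Longrightarrow> C ! i = ConstGate a \<Longrightarrow> v i = a"
  using computes_unique[OF v(2) computes.ConstGate] by blast

lemma v_OpGate: "i < N \<Longrightarrow> C ! i = OpGate f js \<Longrightarrow> v i = oper A f (map v js)"
proof -
  assume i: "i < N" "C ! i = OpGate f js"
  then have "list_all2 (computes A C x) js (map v js)"
    using valid[OF i(1)] v(2) by (auto simp: list_all2_conv_all_nth)
  then show ?thesis using computes_unique[OF v(2)[OF i(1)] computes.OpGate[OF i]] by blast
qed

definition regs :: "store \<Rightarrow> bool" where
  "regs R \<longleftrightarrow> R 0 = n \<and> R 1 = 1 \<and> R 3 = 2 * n \<and> R 4 = 3 * n \<and> R 5 = 4 * n"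

definition mem :: "nat set \<Rightarrow> nat list \<Rightarrow> store \<Rightarrow> bool" where
  "mem D st M \<longleftrightarrow> (\<forall>a<n. M a = w ! a) \<and> (\<forall>i<n. M (n + i) = X i) \<and> (\<forall>i<N. M (2 * n + i) = adr i) \<and>
     (\<forall>i<N. M (3 * n + i) = (if i \<in> D then Suc (e (v i)) else 0)) \<and>
     (\<forall>j<length st. M (4 * n + j) = st ! j)"

text \<open>The stack lists, from the bottom to the top, a path in the circuit that starts at the target.
  The measure \<open>k\<close> decreases by one in each iteration of the search.\<close>

definition dfs_inv :: "nat set \<Rightarrow> nat \<Rightarrow> nat \<Rightarrow> store \<Rightarrow> store \<Rightarrow> bool" where
  "dfs_inv D0 tgt k R M \<longleftrightarrow> (\<exists>D st. D0 \<subseteq> D \<and> D \<subseteq> {..<N} \<and> set st \<subseteq> {..<N} \<and>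
     (\<forall>j. Suc j < length st \<longrightarrow> (st ! Suc j, st ! j) \<in> edges C) \<and>
     (if st = [] then tgt \<in> D else st ! 0 = tgt \<and> set (butlast st) \<inter> D = {}) \<and>
     regs R \<and> R 6 = 4 * n + length st \<and> R 7 = length st \<and> mem D st M \<and>
     k = 3 * card ({..<N} - D) + (if st \<noteq> [] \<and> last st \<in> D then 2 else 0) + (N - length st))"

lemma path_distinct:
  assumes "\<And>j. Suc j < length st \<Longrightarrow> (st ! Suc j, st ! j) \<in> edges C"
  shows "distinct st"
proof -
  have path: "j < length st \<Longrightarrow> i < j \<Longrightarrow> (st ! j, st ! i) \<in> (edges C)\<^sup>+" for i j
  proof (induction j)
    case (Suc j)
    then show ?case using assms[of j] by (cases "i = j") (auto intro: trancl_into_trancl2)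
  qed simp
  have "acyclic (edges C)" using circ by (simp add: is_circuit_def)
  then have "st ! i \<noteq> st ! j" if "i < j" "j < length st" for i j
    using path[OF that(2,1)] that by (metis acyclic_def)
  then show ?thesis by (metis distinct_conv_nth linorder_neqE_nat)
qed

text \<open>Acyclicity forbids repetitions on the stack. This bounds its memory and keeps
  \<open>N - length st\<close> in the measure from being truncated.\<close>

lemma path_length:
  assumes "\<And>j. Suc j < length st \<Longrightarrow> (st ! Suc j, st ! j) \<in> edges C" "set st \<subseteq> {..<N}"
  shows "length st \<le> N"
  using distinct_card[OF path_distinct[OF assms(1)]] card_mono[OF _ assms(2)] by simp

text \<open>Origin of the weights in the measure: evaluating a gate frees 3, of which 2 go to the
  flag of an evaluated top; popping frees this 2 and returns 1 for the shorter stack; pushing uses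
  1.\<close>

lemma dfs_assign:
  assumes "D0 \<subseteq> D" "D \<subseteq> {..<N}" "set st \<subseteq> {..<N}"
    "\<And>j. Suc j < length st \<Longrightarrow> (st ! Suc j, st ! j) \<in> edges C"
    "st \<noteq> []" "st ! 0 = tgt" "set (butlast st) \<inter> D = {}" "last st \<notin> D"
    "regs R'" "R' 6 = 4 * n + length st" "R' 7 = length st" "mem D st M"
    and k: "k = 3 * card ({..<N} - D) + (N - length st)"
  shows "\<exists>k'<k. dfs_inv D0 tgt k' R' (M(3 * n + last st := Suc (e (v (last st)))))"
proof -
  let ?i = "last st" and ?D = "insert (last st) D"
  have i: "?i < N" using assms(3,5) last_in_set by blast
  have "distinct st" using path_distinct assms(4) by blast
  then have "?i \<notin> set (butlast st)" using assms(5) by (metis append_butlast_last_id distinct_butlast not_distinct_conv_prefix)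
  then have "set (butlast st) \<inter> ?D = {}" using assms(7) by auto
  moreover have "mem ?D st (M(3 * n + ?i := Suc (e (v ?i))))"
    using assms(12) i N_le by (auto simp: mem_def)
  moreover have "card ({..<N} - D) = Suc (card ({..<N} - ?D))"
    using i assms(8) by (subst card_Suc_Diff1[symmetric, of _ ?i]) (auto simp: Diff_insert2[symmetric] intro!: arg_cong[where f = card])
  ultimately show ?thesis
    unfolding dfs_inv_def k using assms i
    by (intro exI[of _ "3 * card ({..<N} - ?D) + 2 + (N - length st)"] conjI exI[of _ ?D] exI[of _ st]) auto
qed

lemma dfs_push:
  assumes "D0 \<subseteq> D" "D \<subseteq> {..<N}" "set st \<subseteq> {..<N}"
    "\<And>j. Suc j < length st \<Longrightarrow> (st ! Suc j, st ! j) \<in> edges C"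
    "st \<noteq> []" "st ! 0 = tgt" "set (butlast st) \<inter> D = {}" "last st \<notin> D"
    "regs R'" "R' 6 = 4 * n + Suc (length st)" "R' 7 = Suc (length st)" "mem D st M"
    and u: "(u, last st) \<in> edges C" "u < N" "u \<notin> D"
    and k: "k = 3 * card ({..<N} - D) + (N - length st)"
  shows "\<exists>k'<k. dfs_inv D0 tgt k' R' (M(4 * n + length st := u))"
proof -
  let ?st = "st @ [u]"
  have path: "(?st ! Suc j, ?st ! j) \<in> edges C" if "Suc j < length ?st" for j
  proof (cases "Suc j < length st")
    case True
    then show ?thesis using assms(4)[of j] by (simp add: nth_append)
  next
    case False
    then have j: "Suc j = length st" using that by simp
    then have "?st ! Suc j = u" "?st ! j = st ! j" by (simp_all add: nth_append)
    moreover have "last st = st ! j" using j assms(5) by (metis diff_Suc_1 last_conv_nth)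
    ultimately show ?thesis using u(1) by simp
  qed
  moreover have sub: "set ?st \<subseteq> {..<N}" using assms(3) u by auto
  ultimately have len: "length ?st \<le> N" by (rule path_length)
  have "set (butlast ?st) \<inter> D = {}"
  proof -
    have "set st = insert (last st) (set (butlast st))"
      using assms(5) by (metis append_butlast_last_id list.simps(15) rotate1.simps(2) set_rotate1)
    then show ?thesis using assms(7,8) by simp
  qed
  moreover have "mem D ?st (M(4 * n + length st := u))"
    using assms(12) N_le len by (auto simp: mem_def nth_append less_Suc_eq)
  ultimately show ?thesis
    unfolding dfs_inv_def k using assms path sub len
    by (intro exI[of _ "3 * card ({..<N} - D) + (N - length ?st)"] conjI exI[of _ D] exI[of _ ?st])
      (auto simp: nth_append)
qed

lemma dfs_pop:
  assumes "D0 \<subseteq> D" "D \<subseteq> {..<N}" "set st \<subseteq> {..<N}"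
    "\<And>j. Suc j < length st \<Longrightarrow> (st ! Suc j, st ! j) \<in> edges C"
    "st \<noteq> []" "st ! 0 = tgt" "set (butlast st) \<inter> D = {}" "last st \<in> D"
    "regs R'" "R' 6 = 4 * n + (length st - 1)" "R' 7 = length st - 1" "mem D st M"
    and k: "k = 3 * card ({..<N} - D) + 2 + (N - length st)"
  shows "\<exists>k'<k. dfs_inv D0 tgt k' R' M"
proof -
  let ?st = "butlast st"
  have len: "length st \<le> N" using path_length assms(3,4) by blast
  have "set ?st \<subseteq> set st" by (meson in_set_butlastD subsetI)
  moreover have "last ?st \<notin> D" if "?st \<noteq> []" using assms(7) last_in_set[OF that] by blast
  moreover have "tgt \<in> D" if "?st = []" using that assms(5,6,8) by (cases st) (auto split: if_splits)
  moreover have "set (butlast ?st) \<inter> D = {}" using assms(7) by (meson disjoint_iff in_set_butlastD)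
  moreover have "?st ! 0 = tgt" if "?st \<noteq> []" using that assms(6) by (metis length_greater_0_conv nth_butlast)
  moreover have "(?st ! Suc j, ?st ! j) \<in> edges C" if "Suc j < length ?st" for j
    using that assms(4)[of j] by (simp add: nth_butlast)
  moreover have "mem D ?st M" using assms(12) by (auto simp: mem_def nth_butlast)
  ultimately show ?thesis
    unfolding dfs_inv_def k using assms len
    by (intro exI[of _ "3 * card ({..<N} - D) + (N - length ?st)"] conjI exI[of _ D] exI[of _ ?st])
      auto
qed

lemma lwp_dfs_body:
  assumes "dfs_inv D0 tgt k R M" "R 7 \<noteq> 0"
  shows "lwp B dfs_body (\<lambda>R M. \<exists>k'<k. dfs_inv D0 tgt k' R M) R M"
proof -
  obtain D st where D: "D0 \<subseteq> D" "D \<subseteq> {..<N}" "set st \<subseteq> {..<N}"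
    and path: "\<And>j. Suc j < length st \<Longrightarrow> (st ! Suc j, st ! j) \<in> edges C"
    and top: "if st = [] then tgt \<in> D else st ! 0 = tgt \<and> set (butlast st) \<inter> D = {}"
    and R: "regs R" "R 6 = 4 * n + length st" "R 7 = length st" and M: "mem D st M"
    and k: "k = 3 * card ({..<N} - D) + (if st \<noteq> [] \<and> last st \<in> D then 2 else 0) + (N - length st)"
    using assms(1) unfolding dfs_inv_def by blast
  have st: "st \<noteq> []" using assms(2) R(3) by auto
  then have st0: "st ! 0 = tgt" "set (butlast st) \<inter> D = {}" using top by auto
  define i where "i = last st"
  have i: "i < N" using last_in_set[OF st] D(3) by (auto simp: i_def)
  have len: "length st \<le> N" using path_length path D(3) by blast
  obtain l where l: "length st = Suc l" using st by (cases st) auto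
  have Mi: "M (4 * n + l) = i" using M st l by (simp add: mem_def i_def last_conv_nth)
  have Rl: "R 6 = Suc (4 * n + l)" "R 7 = Suc l" using R l by simp_all
  have Mv: "M (3 * n + i) = (if i \<in> D then Suc (e (v i)) else 0)" using M i by (simp add: mem_def)
  have Ma: "M (2 * n + i) = adr i" using M i by (simp add: mem_def)
  have Mw: "M (adr i + j) = encode_gate e (C ! i) ! j" if "j < length (encode_gate e (C ! i))" for j
    using M w_gate[OF i that] adr_less[OF i that] by (simp add: mem_def)
  note Mw0 = Mw[of 0] and Mw1 = Mw[of "Suc 0"]
  have R': "R 0 = n" "R (Suc 0) = Suc 0" "R 3 = 2 * n" "R 4 = 3 * n" "R 5 = 4 * n"
    using R(1) by (simp_all add: regs_def)
  have bnd: "3 * n + i \<le> B" "2 * n + i \<le> B" "n + i \<le> B" "Suc (adr i) \<le> B" "Suc (4 * n + length st) \<le> B"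
    "Suc (length st) \<le> B"
  proof -
    have "adr i < n" using adr_less[OF i, of 0] by (cases "C ! i") auto
    then show "3 * n + i \<le> B" "2 * n + i \<le> B" "n + i \<le> B" "Suc (adr i) \<le> B"
      "Suc (4 * n + length st) \<le> B" "Suc (length st) \<le> B"
      using B i N_le len by auto
  qed
  let ?Q = "\<lambda>R M. \<exists>k'<k. dfs_inv D0 tgt k' R M"
  have assign: "?Q R'' (M(3 * n + i := Suc m))"
    if "i \<notin> D" "m = e (v i)" "regs R''" "R'' 6 = R 6" "R'' 7 = R 7" for R'' m
    unfolding that(2) i_def
    by (rule dfs_assign[OF D path st st0]) (use that k R M in \<open>auto simp: i_def\<close>)
  show ?thesis
  proof (cases "i \<in> D")
    case True
    have "?Q R'' M" if "regs R''" "R'' 6 = 4 * n + l" "R'' 7 = l" for R''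
    proof (rule dfs_pop[OF D path st st0])
      show "k = 3 * card ({..<N} - D) + 2 + (N - length st)" using True k st by (simp add: i_def)
    qed (use True that M l in \<open>simp_all add: i_def\<close>)
    then show ?thesis
      using True Rl R' Mi Mv bnd by (auto simp: dfs_body_def regs_def fun_upd_idem)
  next
    case False
    show ?thesis
    proof (cases "C ! i")
      case InGate
      have X: "M (n + i) = X i" "X i = e (v i)" using M i N_le v_InGate[OF i InGate] by (auto simp: mem_def)
      have "Suc (X i) \<le> B" using X_less[of i] B by (simp add: q_def)
      then show ?thesis
        using False Mw0 by (simp add: Rl R' Mi Mv Ma InGate bnd X dfs_body_def fun_upd_idem)
          (rule assign; simp add: regs_def Rl R')
    next
      case (ConstGate a)
      have "e a < q" using valid[OF i] ConstGate e_less by simp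
      then have "Suc (e a) \<le> B" using B by (simp add: q_def)
      then show ?thesis
        using False Mw0 Mw1 by (simp add: Rl R' Mi Mv Ma ConstGate bnd dfs_body_def fun_upd_idem)
          (rule assign; simp add: regs_def Rl R' v_ConstGate[OF i ConstGate])
    next
      case (OpGate f js)
      have f: "f < length (signature A)" "length js = signature A ! f" "\<forall>j\<in>set js. j < N"
        using valid[OF i] OpGate by auto
      let ?R = "R(2 := 4 * n + l, 11 := i, 10 := 3 * n + i, 8 := Suc (adr i), 9 := 0)"
      have tree: "lwp B (tree f (signature A ! f) []) ?Q ?R M"
      proof (rule lwp_tree[where us = js and code = "\<lambda>u. e (v u)"])
        show "M (?R 8 + Suc l) = js ! l" if "l < signature A ! f" for l
          using Mw[of "Suc (Suc l)"] OpGate that f by simp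
        show "?R 4 + u \<le> B \<and> (M (?R 4 + u) = 0 \<or> M (?R 4 + u) = Suc (e (v u)) \<and> e (v u) < q)"
          if "u \<in> set js" for u
        proof -
          have u: "u < N" using f(3) that by blast
          then have "M (3 * n + u) = (if u \<in> D then Suc (e (v u)) else 0)" using M by (simp add: mem_def)
          moreover have "e (v u) < q" "3 * n + u \<le> B" using e_less[OF v(1)[OF u]] u B N_le by auto
          ultimately show ?thesis using R' by simp
        qed
        show "?R 8 + signature A ! f \<le> B"
          using adr_less[OF i, of "Suc (signature A ! f)"] OpGate f B by simp
        show "?R 6 < B" "?R 7 < B" using bnd R by simp_all
        show "tab f ws < q" if ws: "length ws = length [] + signature A ! f" "set ws \<subseteq> {..<q}" for ws
        proof -
          have "set (map dec ws) \<subseteq> univ A" "length (map dec ws) = signature A ! f"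
            using ws dec_in by auto
          then have "oper A f (map dec ws) \<in> univ A" using alg f(1) unfolding is_algebra_def by blast
          then show ?thesis using e_less by (simp add: tab_def)
        qed
        show "q \<le> B" using B by (simp add: q_def)
        show "?Q R'' (M(?R 10 := Suc (tab f ([] @ map (\<lambda>u. e (v u)) js))))"
          if "persistent ?R R''" "R'' 6 = ?R 6" "R'' 7 = ?R 7" for R''
        proof -
          have "map dec (map (\<lambda>u. e (v u)) js) = map v js" using f(3) v(1) dec_e by auto
          then have val: "tab f ([] @ map (\<lambda>u. e (v u)) js) = e (v i)"
            unfolding tab_def append_Nil v_OpGate[OF i OpGate] by (rule arg_cong)
          have eq: "?R 10 = 3 * n + i" by simp
          have "regs R''" using that(1) R' by (simp add: persistent_def regs_def)
          then show ?thesis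
            unfolding eq by (rule assign[OF False val]) (use that(2,3) in simp_all)
        qed
        show "?Q R'' (M(?R 6 := u))"
          if "u \<in> set js" "M (?R 4 + u) = 0" "persistent ?R R''" "R'' 6 = Suc (?R 6)" "R'' 7 = Suc (?R 7)" for R'' u
        proof -
          have edge: "(u, last st) \<in> edges C" using that(1) OpGate i by (auto simp: edges_def i_def)
          have u: "u < N" using f(3) that(1) by blast
          then have "u \<notin> D" using that(2) M R' by (auto simp: mem_def split: if_splits)
          moreover have eq: "?R 6 = 4 * n + length st" using R by simp
          moreover have "regs R''" using that(3) R' by (simp add: persistent_def regs_def)
          ultimately show ?thesis
            unfolding eq
            by (intro dfs_push[OF D path st st0]) (use that(4,5) False R M k edge u st in \<open>simp_all add: i_def\<close>)
        qed
      qed (use R' f in auto)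
      let ?R' = "R(2 := 4 * n + l, 11 := i, 10 := 3 * n + i, 8 := Suc (adr i), 9 := f)"
      have "lwp B (sel 9 (map (\<lambda>f. tree f (signature A ! f) []) [0..<length (signature A)])) ?Q ?R' M"
      proof (rule lwp_sel)
        have "?R'(9 := 0) = ?R" by simp
        then show "lwp B (map (\<lambda>f. tree f (signature A ! f) []) [0..<length (signature A)] ! ?R' 9) ?Q (?R'(9 := 0)) M"
          using tree f(1) by simp
      qed (use R' f in auto)
      then show ?thesis
        using False Rl R' Mi Mv Ma Mw0 Mw1 OpGate bnd
        by (simp add: dfs_body_def fun_upd_idem fun_upd_twist)
    qed
  qed
qed

end

section \<open>Sampling, parsing and the total running time\<close>

context csat_run
begin

definition sampled :: "nat \<Rightarrow> store" where
  "sampled i a = (if a < n then w ! a else if a < n + i then X (a - n) else 0)"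

text \<open>Values are drawn before parsing and for all n cells, so the bits for cell i are drawn at
  times that do not depend on the instance. These times enter the definition of \<open>draw\<close>,
  hence the exact clock instead of a bound.\<close>

lemma wp_init_sample:
  assumes "\<And>R. regs R \<Longrightarrow> wp B bs main_rest Q R (sampled n) (8 + n * (2 * (q - 1) + 7))"
  shows "wp B bs main Q ((\<lambda>_. 0)(0 := n)) (\<lambda>i. if i < n then w ! i else 0) 0"
proof -
  let ?L = "2 * (q - 1) + 7"
  \<comment> \<open>The start takes 6 instructions and one no-operation. The loop test and the reset
    of register 9 bring the first flip to time 9. An iteration takes \<open>2 * (q - 1)\<close>
    steps for flips and 7 others: reset, store, two updates, no-operation, test and jump.\<close>
  let ?I = "\<lambda>k R M t. \<exists>i. i + k = n \<and> regs R \<and> R 7 = k \<and> R 10 = n + i \<and> M = sampled i \<and> t = 7 + i * ?L"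
  have loop: "wp B bs (While 7 sample_body) (wp B bs main_rest Q) R M t" if I: "?I n R M t" for R M t
  proof (rule wp_While[where I = ?I, OF I])
    fix k R M t assume "?I k R M t"
    then obtain i where i: "i + k = n" "regs R" "R 7 = k" "R 10 = n + i" "M = sampled i" "t = 7 + i * ?L"
      by blast
    show "wp B bs main_rest Q R M (Suc t)" if "R 7 = 0" using assms[of R] i that by simp
    show "wp B bs sample_body (\<lambda>R M t. \<exists>k'<k. ?I k' R M (Suc t)) R M (Suc t)" if "R 7 \<noteq> 0"
    proof -
      have k: "k \<noteq> 0" using that i by simp
      have "wp B bs (block (flips (q - 1) @ [Basic (Store 10 9), Basic (Add 10 10 1), Basic (Sub 7 7 1)]))
          (\<lambda>R M t. \<exists>k'<k. ?I k' R M (Suc t)) (R(9 := 0)) M (Suc (Suc t))"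
      proof (rule wp_flips)
        show "(R(9 := 0)) 9 + (q - 1) \<le> B" "1 \<le> B" using B by (simp_all add: q_def)
        fix R' assume R': "\<And>r. r \<noteq> 9 \<Longrightarrow> r \<noteq> 12 \<Longrightarrow> R' r = (R(9 := 0)) r"
          "R' 9 = (R(9 := 0)) 9 + (\<Sum>j<q - 1. of_bool (bs (Suc (Suc t) + 2 * j)))"
        have "Suc (Suc t) = 9 + i * ?L" using i(6) by simp
        then have R9: "R' 9 = X i" using R'(2) by (simp add: X_def draw_def)
        have R'': "R' (Suc 0) = Suc 0" "R' 10 = n + i" "R' 7 = k" "R' 0 = n" "R' 3 = 2 * n" "R' 4 = 3 * n" "R' 5 = 4 * n"
          using R'(1) i by (simp_all add: regs_def)
        have bnd: "Suc (n + i) \<le> B" using B i(1) by simp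
        have smp: "(sampled i)(n + i := X i) = sampled (Suc i)"
          by (auto simp: sampled_def)
        have regs: "regs (R'(10 := Suc (n + i), 7 := k - Suc 0))" using R'' by (simp add: regs_def)
        have "?I (k - 1) (R'(10 := Suc (n + i), 7 := k - Suc 0)) (sampled (Suc i)) (7 + Suc i * ?L)"
          by (rule exI[of _ "Suc i"]) (use regs i k in simp)
        moreover have "Suc (Suc (Suc (Suc (Suc (Suc (Suc t) + 2 * (q - 1)))))) = 7 + Suc i * ?L"
          using i(6) by simp
        ultimately have fin: "\<exists>k'<k. ?I k' (R'(10 := Suc (n + i), 7 := k - Suc 0)) (sampled (Suc i))
            (Suc (Suc (Suc (Suc (Suc (Suc (Suc t) + 2 * (q - 1)))))))"
          using k by (intro exI[of _ "k - 1"]) simp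
        show "wp B bs (block [Basic (Store 10 9), Basic (Add 10 10 1), Basic (Sub 7 7 1)])
          (\<lambda>R M t. \<exists>k'<k. ?I k' R M (Suc t)) R' M (Suc (Suc t) + 2 * (q - 1))"
          using fin bnd i(1) by (simp add: R'' R9 i(5) smp fun_upd_idem del: mult_Suc)
      qed
      then show ?thesis by (simp add: sample_body_def)
    qed
  qed
  let ?R = "(\<lambda>_. 0)(0 := n, Suc 0 := Suc 0, 3 := n + n, 4 := n + n + n, 5 := n + n + n + n, 7 := n, 10 := n)"
  have "wp B bs (While 7 sample_body) (wp B bs main_rest Q) ?R (\<lambda>i. if i < n then w ! i else 0)
      (Suc (Suc (Suc (Suc (Suc (Suc (Suc 0)))))))"
    by (rule loop, rule exI[of _ 0]) (auto simp: regs_def sampled_def)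
  moreover have "n + n \<le> B" "n + n + n \<le> B" "n + n + n + n \<le> B" "Suc 0 \<le> B" using B by simp_all
  ultimately show ?thesis
    by (simp add: main_def init_def fun_upd_idem del: wp.simps(4))
qed

text \<open>The last clause keeps the value table blank: zero means not evaluated, so the search
  needs no initialisation.\<close>

definition parsed :: "nat \<Rightarrow> store \<Rightarrow> bool" where
  "parsed i M \<longleftrightarrow> (\<forall>a<n. M a = w ! a) \<and> (\<forall>i<n. M (n + i) = X i) \<and> (\<forall>j<i. M (2 * n + j) = adr j) \<and>
     (\<forall>a\<ge>3 * n. M a = 0)"

definition parse_inv :: "nat \<Rightarrow> store \<Rightarrow> store \<Rightarrow> bool" where
  "parse_inv k R M \<longleftrightarrow> (\<exists>i. i + k = N \<and> regs R \<and> R 7 = k \<and> R 8 = adr i \<and> R 10 = 2 * n + i \<and> parsed i M)"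

lemma lwp_parse_body:
  assumes "parse_inv k R M" "R 7 \<noteq> 0"
  shows "lwp B parse_body (\<lambda>R M. \<exists>k'<k. parse_inv k' R M) R M"
proof -
  obtain i where i: "i + k = N" "R 7 = k" "R 8 = adr i" "R 10 = 2 * n + i" "parsed i M" and regs: "regs R"
    using assms(1) by (auto simp: parse_inv_def)
  have k: "k \<noteq> 0" using assms(2) i by simp
  then have iN: "i < N" using i(1) by simp
  have R: "R 0 = n" "R (Suc 0) = Suc 0" "R 3 = 2 * n" "R 4 = 3 * n" "R 5 = 4 * n"
    using regs by (simp_all add: regs_def)
  let ?M = "M(2 * n + i := adr i)"
  have pM: "parsed (Suc i) ?M"
    using i(5) iN N_le by (auto simp: parsed_def less_Suc_eq)
  have Mw: "M (adr i + j) = encode_gate e (C ! i) ! j" "adr i + j \<noteq> 2 * n + i"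
    if "j < length (encode_gate e (C ! i))" for j
    using i(5) w_gate[OF iN that] adr_less[OF iN that] by (simp_all add: parsed_def)
  note Mw0 = Mw[of 0] and Mw1 = Mw[of "Suc 0"]
  have ab: "adr (Suc i) \<le> n" using adr_mono[of "Suc i" N] iN adr_N by simp
  have fin: "\<exists>k'<k. parse_inv k' R' ?M"
    if "regs R'" "R' 7 = k - Suc 0" "R' 8 = adr (Suc i)" "R' 10 = Suc (2 * n + i)" for R'
    unfolding parse_inv_def
    by (rule exI[of _ "k - 1"]) (use that k i(1) pM in \<open>auto intro!: exI[of _ "Suc i"]\<close>)
  have bnd: "Suc (2 * n + i) \<le> B" "adr (Suc i) \<le> B" using B iN N_le ab by auto
  show ?thesis
  proof (cases "C ! i")
    case InGate
    then have a: "adr (Suc i) = Suc (adr i)" using adr_Suc[OF iN] by simp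
    show ?thesis
      using Mw0 InGate bnd by (simp add: parse_body_def R i a fun_upd_idem) (rule fin; simp add: regs_def R a)
  next
    case (ConstGate c)
    then have a: "adr (Suc i) = Suc (Suc (adr i))" using adr_Suc[OF iN] by simp
    show ?thesis
      using Mw0 ConstGate bnd by (simp add: parse_body_def R i a fun_upd_idem) (rule fin; simp add: regs_def R a)
  next
    case (OpGate f js)
    then have f: "f < length (signature A)" "length js = signature A ! f" using valid[OF iN] by auto
    then have a: "adr (Suc i) = adr i + Suc (Suc (signature A ! f))" using adr_Suc[OF iN] OpGate by simp
    let ?Q = "\<lambda>R M. R 8 + R 9 \<le> B \<and> R 10 + R 1 \<le> B \<and>
      (\<exists>k'<k. parse_inv k' (R(8 := R 8 + R 9, 10 := R 10 + R 1, 7 := R 7 - R 1)) M)"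
    let ?R = "R(9 := f, 12 := Suc (adr i))"
    have "lwp B (sel 9 (map (\<lambda>f. Basic (Const 9 (signature A ! f + 2))) [0..<length (signature A)])) ?Q ?R ?M"
    proof (rule lwp_sel)
      have "signature A ! f + 2 \<le> B" using arity_le[OF f(1)] B by simp
      moreover have "\<exists>k'<k. parse_inv k' (R(9 := signature A ! f + 2, 12 := Suc (adr i), 8 := adr i + (signature A ! f + 2),
          10 := Suc (2 * n + i), 7 := k - Suc 0)) ?M"
        by (rule fin; simp add: regs_def R a)
      ultimately show "lwp B (map (\<lambda>f. Basic (Const 9 (signature A ! f + 2))) [0..<length (signature A)] ! ?R 9) ?Q (?R(9 := 0)) ?M"
        using f(1) bnd a by (simp add: R i fun_upd_twist)
    qed (use f R in simp_all)
    then have "lwp B (sel 9 (map (\<lambda>f. Basic (Const 9 (signature A ! f + 2))) [0..<length (signature A)]))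
       (lwp B (block [Basic (Add 8 8 9)]) (lwp B (block [Basic (Add 10 10 1), Basic (Sub 7 7 1)]) (\<lambda>R M. \<exists>k'<k. parse_inv k' R M))) ?R ?M"
      by (rule lwp_mono) (simp add: fun_upd_idem)
    then show ?thesis
      using Mw0 Mw1 OpGate bnd a by (simp add: parse_body_def R i fun_upd_idem fun_upd_twist)
  qed
qed

lemma lwp_parse_start:
  assumes "regs R"
  shows "lwp B parse_start (parse_inv N) R (sampled n)"
proof -
  have "sampled n 0 = N" using N_le w_head by (simp add: sampled_def)
  moreover have "parse_inv N (R(2 := 0, 7 := N, 8 := 3, 10 := 2 * n)) (sampled n)"
    using assms by (auto simp: parse_inv_def regs_def parsed_def sampled_def adr_0 intro!: exI[of _ 0])
  ultimately show ?thesis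
    using assms B by (simp add: parse_start_def regs_def fun_upd_idem)
qed

lemma lwp_dfs_start:
  assumes "regs R" "mem D [] M" "D \<subseteq> {..<N}" "a < 3" "w ! a = tgt" "tgt < N"
  shows "lwp B (dfs_start a) (\<lambda>R M. \<exists>k\<le>4 * N + 2. dfs_inv D tgt k R M) R M"
proof -
  have Ma: "M a = tgt" using assms N_le by (simp add: mem_def)
  let ?R = "R(2 := tgt, 6 := Suc (4 * n), 7 := Suc 0)" and ?M = "M(4 * n := tgt)"
  \<comment> \<open>The second target may already have a value from the first search; then the top
    is flagged at once. The sum is at most 3 N + 2 + N.\<close>
  let ?k = "3 * card ({..<N} - D) + (if tgt \<in> D then 2 else 0) + (N - 1)"
  have "mem D [tgt] ?M" using assms(2,6) N_le by (auto simp: mem_def)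
  then have "dfs_inv D tgt ?k ?R ?M"
    unfolding dfs_inv_def using assms
    by (intro exI[of _ D] exI[of _ "[tgt]"]) (auto simp: regs_def)
  moreover have "?k \<le> 4 * N + 2"
    using card_mono[of "{..<N}" "{..<N} - D"] by auto
  ultimately have "\<exists>k\<le>4 * N + 2. dfs_inv D tgt k ?R ?M" by blast
  then show ?thesis
    using assms(1,4) B N_le by (simp add: dfs_start_def regs_def fun_upd_idem Ma)
qed

definition evaluated :: "nat set \<Rightarrow> store \<Rightarrow> store \<Rightarrow> bool" where
  "evaluated G R M \<longleftrightarrow> (\<exists>D. G \<subseteq> D \<and> D \<subseteq> {..<N} \<and> regs R \<and> mem D [] M)"

lemma tw_dfs:
  assumes "evaluated G R M" "a < 3" "w ! a = tgt" "tgt < N"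
  shows "tw B bs (Seq (dfs_start a) (While 7 dfs_body)) (evaluated (insert tgt G))
    (csize (dfs_start a) + (1 + (4 * N + 2) * (csize dfs_body + 2))) R M"
proof -
  obtain D where D: "G \<subseteq> D" "D \<subseteq> {..<N}" "regs R" "mem D [] M"
    using assms(1) by (auto simp: evaluated_def)
  show ?thesis
  proof (rule tw_Seq[OF lwp_tw[OF lwp_dfs_start[OF D(3,4,2) assms(2-4)]]])
    fix R M assume "\<exists>k\<le>4 * N + 2. dfs_inv D tgt k R M"
    then obtain k where k: "k \<le> 4 * N + 2" "dfs_inv D tgt k R M" by blast
    show "tw B bs (While 7 dfs_body) (evaluated (insert tgt G)) (1 + (4 * N + 2) * (csize dfs_body + 2)) R M"
    proof (rule tw_While[where J = "dfs_inv D tgt" and k = k])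
      show "dfs_inv D tgt k R M" "k \<le> 4 * N + 2" by (fact k)+
      show "evaluated (insert tgt G) R M" if "dfs_inv D tgt k R M" "R 7 = 0" for k R M
        using that D(1) unfolding dfs_inv_def evaluated_def by (fastforce split: if_splits)
    qed (simp_all add: lwp_dfs_body)
  qed
qed

lemma lwp_compare:
  assumes "evaluated {g2, g1} R M"
  shows "lwp B compare (\<lambda>R M. R 2 = 0 \<longleftrightarrow> v g1 = v g2) R M"
proof -
  obtain D where D: "g1 \<in> D" "g2 \<in> D" "regs R" "mem D [] M"
    using assms by (auto simp: evaluated_def)
  have M: "M (Suc 0) = g1" "M 2 = g2" "M (3 * n + g1) = Suc (e (v g1))" "M (3 * n + g2) = Suc (e (v g2))"
    using D g w_head N_le by (auto simp: mem_def)
  have e: "e (v g1) < q" "e (v g2) < q" using e_less v(1) g by auto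
  have "v g1 = v g2 \<longleftrightarrow> e (v g1) = e (v g2)"
    using dec_e v(1) g by metis
  then have "v g1 = v g2 \<longleftrightarrow> e (v g1) - e (v g2) + (e (v g2) - e (v g1)) = 0" by auto
  moreover have "3 * n + g1 \<le> B" "3 * n + g2 \<le> B" "2 \<le> B" "1 \<le> B"
    "e (v g1) - e (v g2) + (e (v g2) - e (v g1)) \<le> B"
    using B g N_le e by (auto simp: q_def)
  ultimately show ?thesis
    using D(3) M by (simp add: compare_def regs_def fun_upd_idem)
qed

definition rest_time :: nat where
  "rest_time = csize parse_start + (1 + N * (csize parse_body + 2)) +
     (csize (dfs_start 1) + (1 + (4 * N + 2) * (csize dfs_body + 2))) +
     (csize (dfs_start 2) + (1 + (4 * N + 2) * (csize dfs_body + 2))) + csize compare"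

lemma tw_main_rest:
  assumes "regs R"
  shows "tw B bs main_rest (\<lambda>R M. R 2 = 0 \<longleftrightarrow> v g1 = v g2) rest_time R (sampled n)"
proof -
  have 1: "tw B bs parse_start (parse_inv N) (csize parse_start) R (sampled n)"
    by (rule lwp_tw[OF lwp_parse_start[OF assms]])
  have 2: "tw B bs (While 7 parse_body) (evaluated {}) (1 + N * (csize parse_body + 2)) R M"
    if "parse_inv N R M" for R M
  proof (rule tw_While[where J = parse_inv and k = N])
    show "parse_inv N R M" by fact
    show "evaluated {} R M" if "parse_inv k R M" "R 7 = 0" for k R M
      using that by (auto simp: parse_inv_def evaluated_def parsed_def mem_def intro!: exI[of _ "{}"])
  qed (simp_all add: lwp_parse_body)
  have 3: "tw B bs (Seq (Seq (dfs_start 1) (While 7 dfs_body)) (Seq (Seq (dfs_start 2) (While 7 dfs_body)) compare))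
      (\<lambda>R M. R 2 = 0 \<longleftrightarrow> v g1 = v g2)
      ((csize (dfs_start 1) + (1 + (4 * N + 2) * (csize dfs_body + 2))) +
       ((csize (dfs_start 2) + (1 + (4 * N + 2) * (csize dfs_body + 2))) + csize compare)) R M"
    if "evaluated {} R M" for R M
    using that g w_head by (intro tw_Seq[OF tw_dfs] tw_Seq[OF tw_dfs] lwp_tw lwp_compare) auto
  have "tw B bs (Seq parse_start (Seq (While 7 parse_body)
      (Seq (Seq (dfs_start 1) (While 7 dfs_body)) (Seq (Seq (dfs_start 2) (While 7 dfs_body)) compare))))
      (\<lambda>R M. R 2 = 0 \<longleftrightarrow> v g1 = v g2)
      (csize parse_start + ((1 + N * (csize parse_body + 2)) +
       ((csize (dfs_start 1) + (1 + (4 * N + 2) * (csize dfs_body + 2))) +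
       ((csize (dfs_start 2) + (1 + (4 * N + 2) * (csize dfs_body + 2))) + csize compare)))) R (sampled n)"
    by (rule tw_Seq[OF 1 tw_Seq[OF 2 3]])
  \<comment> \<open>Regrouping sequences does not change weakest preconditions, so the bound holds
    for the nesting used in \<open>main_rest\<close>.\<close>
  then show ?thesis
    by (simp add: main_rest_def rest_time_def tw_def add.assoc)
qed

lemma program_halts:
  "\<exists>t \<le> 10 + n * (2 * (q - 1) + 7) + rest_time.
     drun program bs (init_config w) t = Halted (v g1 = v g2) \<and>
     (\<forall>s\<le>t. bounded_config B (drun program bs (init_config w) s))"
proof -
  let ?s = "8 + n * (2 * (q - 1) + 7)"
  define Q where "Q = (\<lambda>(R :: store) (M :: store) t. (R 2 = 0 \<longleftrightarrow> v g1 = v g2) \<and> t \<le> ?s + rest_time)"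
  have init: "init_config w = Running 0 ((\<lambda>_. 0)(0 := n)) (\<lambda>i. if i < n then w ! i else 0)"
    by (simp add: init_config_def lw)
  have w: "wp B bs main Q ((\<lambda>_. 0)(0 := n)) (\<lambda>i. if i < n then w ! i else 0) 0"
    unfolding Q_def by (rule wp_init_sample) (use tw_main_rest in \<open>auto simp: tw_def\<close>)
  have c: "code_at program 0 (compile 0 main)"
    by (auto simp: code_at_def program_def nth_append)
  have bounded: "bounded_config B (init_config w)"
    using w_bound B by (simp add: init)
  obtain R M t where Q: "(R 2 = 0 \<longleftrightarrow> v g1 = v g2) \<and> t \<le> ?s + rest_time"
    and r: "reach program bs B 0 (init_config w) t (Running (csize main) R M)"
    using wp_sound[OF w c bounded[unfolded init]] unfolding init add_0 by (auto simp: Q_def)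
  have P: "csize main < length program" "program ! csize main = JumpZero 2 (csize main + 2)"
    "Suc (csize main) < length program" "program ! Suc (csize main) = Halt False"
    "csize main + 2 < length program" "program ! (csize main + 2) = Halt True"
    by (auto simp: program_def nth_append)
  let ?l = "if R 2 = 0 then csize main + 2 else Suc (csize main)"
  note b = reach_bounded[OF r]
  \<comment> \<open>The final test and the halt account for the difference between 8 and 10 in the
    time bound.\<close>
  have "reach program bs B t (Running (csize main) R M) (Suc (Suc t)) (Halted (v g1 = v g2))"
  proof (rule reach.step[OF b], rule reach.step)
    show "bounded_config B (dstep program (bs t) (Running (csize main) R M))" using P b by simp
    show "reach program bs B (Suc (Suc t)) (dstep program (bs (Suc t)) (dstep program (bs t) (Running (csize main) R M)))
      (Suc (Suc t)) (Halted (v g1 = v g2))"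
      using P Q by (auto intro: reach.refl)
  qed
  from reach_drun[OF reach_trans[OF r this], of "init_config w"] Q show ?thesis
    by (intro exI[of _ "Suc (Suc t)"]) auto
qed

end

section \<open>The algorithm\<close>

context csat_machine
begin

text \<open>The number T bounds both the time and all numbers. The first conjunct ensures that the
  flips for all gates happen before T, where their bits are random.\<close>

lemma program_correct:
  "\<exists>K. \<forall>C g1 g2 bs. csat_instance A (C, g1, g2) \<longrightarrow>
     (let w = encode_csat e (C, g1, g2); T = K * length w in
       9 + length C * (2 * (q - 1) + 7) \<le> T \<and>
       (\<forall>t. bounded_config T (drun program bs (init_config w) t)) \<and>
       drun program bs (init_config w) T =
         Halted (\<exists>a. computes A C (\<lambda>i. dec (draw bs i)) g1 a \<and> computes A C (\<lambda>i. dec (draw bs i)) g2 a))"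
proof -
  let ?L = "2 * (q - 1) + 7"
  define c0 where "c0 = card (univ A) + sum_list (signature A) + length (signature A) + 10"
  define c1 where "c1 = csize parse_start + csize (dfs_start 1) + csize (dfs_start 2) + csize compare + 3"
  define c2 where "c2 = csize parse_body + 2"
  define c3 where "c3 = csize dfs_body + 2"
  \<comment> \<open>The part 5 + c0 serves the bound on numbers, the rest the running time; additive
    constants are absorbed because the input is not empty.\<close>
  define K where "K = 5 + c0 + 10 + ?L + c1 + c2 + 8 * c3"
  show ?thesis
  proof (intro exI[of _ K] allI impI)
    fix C :: "'a circuit" and g1 g2 :: nat and bs :: "nat \<Rightarrow> bool"
    assume inst: "csat_instance A (C, g1, g2)"
    define w where "w = encode_csat e (C, g1, g2)"
    define n where "n = length w"
    define T where "T = K * n"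
    have n1: "1 \<le> n" by (simp add: n_def w_def encode_csat_def)
    then have mult: "c \<le> c * n" for c by simp
    have T: "T = 5 * n + c0 * n + 10 * n + n * ?L + c1 * n + c2 * n + 8 * (c3 * n)"
      by (simp add: T_def K_def algebra_simps)
    interpret run: csat_run A e C g1 g2 bs T n
    proof
      show "csat_instance A (C, g1, g2)" by (rule inst)
      show "n = length (encode_csat e (C, g1, g2))" by (simp add: n_def w_def)
      have "5 * n + c0 \<le> T" using mult[of c0] unfolding T by linarith
      then show "5 * n + card (univ A) + sum_list (signature A) + length (signature A) + 10 \<le> T"
        by (simp add: c0_def)
    qed
    have N: "length C + 3 \<le> n" by (rule run.N_le)
    have "run.rest_time = c1 + length C * c2 + 2 * ((4 * length C + 2) * c3)"
      by (simp add: run.rest_time_def c1_def c2_def c3_def)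
    also have "\<dots> \<le> c1 * n + c2 * n + 2 * (4 * n * c3)"
    proof -
      have "length C * c2 \<le> n * c2" "(4 * length C + 2) * c3 \<le> 4 * n * c3"
        using N by (intro mult_le_mono1; simp)+
      then show ?thesis using mult[of c1] mult.commute[of n c2] by linarith
    qed
    finally have rest: "10 + n * ?L + run.rest_time \<le> T"
      using n1 mult[of 10] unfolding T by (simp add: algebra_simps)
    obtain t where t: "t \<le> T" "drun program bs (init_config w) t = Halted (run.v g1 = run.v g2)"
      "\<And>s. s \<le> t \<Longrightarrow> bounded_config T (drun program bs (init_config w) s)"
      using run.program_halts rest unfolding run.w_def w_def by (meson le_trans)
    have halted: "drun program bs (init_config w) s = Halted (run.v g1 = run.v g2)" if "t \<le> s" for s
      using that by (induction s rule: dec_induct) (simp_all add: t(2))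
    have x: "run.x = (\<lambda>i. dec (draw bs i))"
      by (simp add: run.x_def[abs_def] run.X_def)
    have "run.v g1 = run.v g2 \<longleftrightarrow> (\<exists>a. computes A C run.x g1 a \<and> computes A C run.x g2 a)"
      using run.v(2)[OF run.g(1)] run.v(2)[OF run.g(2)] computes_unique by metis
    then have "drun program bs (init_config w) T =
        Halted (\<exists>a. computes A C (\<lambda>i. dec (draw bs i)) g1 a \<and> computes A C (\<lambda>i. dec (draw bs i)) g2 a)"
      using halted[OF t(1)] by (simp add: x)
    moreover have "bounded_config T (drun program bs (init_config w) s)" for s
    proof (cases "s \<le> t")
      case False
      then show ?thesis using halted[of s] by simp
    qed (rule t(3))
    moreover have "9 + length C * ?L \<le> T"
    proof -
      have "length C * ?L \<le> n * ?L" using N by (intro mult_le_mono1) simp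
      then show ?thesis using rest by linarith
    qed
    ultimately show "let w = encode_csat e (C, g1, g2); T = K * length w in
       9 + length C * (2 * (q - 1) + 7) \<le> T \<and>
       (\<forall>t. bounded_config T (drun program bs (init_config w) t)) \<and>
       drun program bs (init_config w) T =
         Halted (\<exists>a. computes A C (\<lambda>i. dec (draw bs i)) g1 a \<and> computes A C (\<lambda>i. dec (draw bs i)) g2 a)"
      unfolding Let_def w_def[symmetric] n_def[symmetric] T_def[symmetric] by blast
  qed
qed

lemma sum_of_bool_less: "m \<le> l \<Longrightarrow> (\<Sum>j<l. of_bool (j < m)) = (m :: nat)"
proof -
  assume "m \<le> l"
  then have "{..<l} \<inter> {j. j < m} = {..<m}" by auto
  then show ?thesis by simp
qed

text \<open>Cell and index of a flip can be recovered from its time by division with remainder, so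
  the bits of different cells do not interfere. Setting exactly the first \<open>e (y i)\<close>
  bits of cell i to one produces the value \<open>y i\<close>.\<close>

lemma redraw:
  assumes y: "\<And>i. i \<in> I \<Longrightarrow> y i \<in> univ A"
    and Q: "Q = (\<lambda>(i, j). 9 + i * (2 * (q - 1) + 7) + 2 * j) ` (I \<times> {..<q - 1})"
  shows "\<exists>bs'. (\<forall>t. t \<notin> Q \<longrightarrow> bs' t = bs t) \<and>
    (\<forall>i. dec (draw bs' i) = (if i \<in> I then y i else dec (draw bs i)))"
proof -
  define L where "L = 2 * (q - 1) + 7"
  define bs' where "bs' t = (if t \<in> Q then (t - 9) mod L div 2 < e (y ((t - 9) div L)) else bs t)" for t
  have pos: "(9 + i * L + 2 * j - 9) div L = i" "(9 + i * L + 2 * j - 9) mod L div 2 = j" if "j < q - 1" for i j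
  proof -
    have "2 * j < L" using that by (simp add: L_def)
    moreover have "9 + i * L + 2 * j - 9 = 2 * j + i * L" by simp
    ultimately show "(9 + i * L + 2 * j - 9) div L = i" "(9 + i * L + 2 * j - 9) mod L div 2 = j"
      by simp_all
  qed
  have mem: "9 + i * L + 2 * j \<in> Q \<longleftrightarrow> i \<in> I" if "j < q - 1" for i j
  proof
    assume "9 + i * L + 2 * j \<in> Q"
    then obtain i' j' where "i' \<in> I" "j' < q - 1" "9 + i * L + 2 * j = 9 + i' * L + 2 * j'"
      by (auto simp: Q L_def)
    then show "i \<in> I" using pos(1)[OF that, of i] pos(1)[of j' i'] by metis
  qed (use that in \<open>auto simp: Q L_def\<close>)
  have "dec (draw bs' i) = (if i \<in> I then y i else dec (draw bs i))" for i
  proof (cases "i \<in> I")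
    case True
    have "draw bs' i = (\<Sum>j<q - 1. of_bool (j < e (y i)))"
      unfolding draw_def L_def[symmetric]
      by (rule sum.cong) (use True mem pos in \<open>auto simp: bs'_def\<close>)
    also have "\<dots> = e (y i)"
      using e_less[OF y[OF True]] by (intro sum_of_bool_less) simp
    finally show ?thesis using True dec_e[OF y[OF True]] by simp
  next
    case False
    have "draw bs' i = draw bs i"
      unfolding draw_def L_def[symmetric]
      by (rule sum.cong) (use False mem in \<open>auto simp: bs'_def\<close>)
    then show ?thesis using False by simp
  qed
  moreover have "\<forall>t. t \<notin> Q \<longrightarrow> bs' t = bs t" by (simp add: bs'_def)
  ultimately show ?thesis by blast
qed

end

section \<open>From circuits to polynomials\<close>

context finite_algebra
begin

lemma gate_pol:
  assumes C: "is_circuit A C" and "i < length C"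
  shows "\<exists>F\<in>pol. \<forall>x\<in>vals. computes A C x i (F x)"
proof -
  have valid: "valid_gate A (length C) (C ! i)" if "i < length C" for i
    using C that by (auto simp: is_circuit_def)
  have "edges C \<subseteq> {..<length C} \<times> {..<length C}"
    using valid by (fastforce simp: edges_def)
  then have "finite (edges C)" by (rule finite_subset) simp
  then have "wf (edges C)" using C by (simp add: finite_acyclic_wf is_circuit_def)
  then show ?thesis
    using assms(2)
  proof (induction i rule: wf_induct_rule)
    case (less i)
    show ?case
    proof (cases "C ! i")
      case InGate
      then show ?thesis using less.prems pol.var[of i] computes.InGate by fastforce
    next
      case (ConstGate a)
      then show ?thesis using less.prems valid[of i] pol.const[of a] computes.ConstGate by fastforce
    next
      case (OpGate f js)
      then have f: "f < length (signature A)" "length js = signature A ! f" "\<forall>j \<in> set js. j < length C"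
        using valid[OF less.prems] by auto
      have "\<forall>j \<in> set js. \<exists>F\<in>pol. \<forall>x\<in>vals. computes A C x j (F x)"
        using less.IH f OpGate less.prems by (auto simp: edges_def)
      then obtain F where F: "\<And>j. j \<in> set js \<Longrightarrow> F j \<in> pol \<and> (\<forall>x\<in>vals. computes A C x j (F j x))"
        by metis
      have "(\<lambda>\<rho>. oper A f (map (\<lambda>F. F \<rho>) (map F js))) \<in> pol"
        by (rule pol.op) (use f F in auto)
      moreover have "computes A C x i (oper A f (map (\<lambda>F. F x) (map F js)))" if "x \<in> vals" for x
        by (rule computes.OpGate[OF less.prems OpGate]) (use F that in \<open>auto simp: list_all2_conv_all_nth\<close>)
      ultimately show ?thesis by (intro bexI[of _ "\<lambda>\<rho>. oper A f (map (\<lambda>F. F \<rho>) (map F js))"]) simp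
    qed
  qed
qed

lemma congruence_one: "congruence A (one_con A)"
  unfolding congruence_def
proof (intro conjI allI impI, goal_cases)
  case 1
  show ?case by (auto simp: one_con_def equiv_def refl_on_def sym_def trans_def)
next
  case (2 f xs ys)
  then have "length ys = signature A ! f" by (metis list_all2_lengthD)
  moreover have "set xs \<subseteq> univ A \<and> set ys \<subseteq> univ A"
    using 2 by (fastforce simp: one_con_def list_all2_conv_all_nth in_set_conv_nth)
  ultimately show ?case using 2 alg by (auto simp: is_algebra_def one_con_def)
qed

end

theorem theorem1p2:
  fixes A :: "'a alg"
  assumes "is_algebra A"
    and "finite (univ A)"
    and "primepow (card (univ A))"
    and "supernilpotent A"
    and "in_congruence_modular_variety A"
  shows "\<exists>c > 0. \<forall>e. bij_betw e (univ A) {..<card (univ A)} \<longrightarrow>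
           (\<exists>P. linear_time_monte_carlo P c (csat_instance A) (csat_satisfiable A) (encode_csat e))"
proof -
  interpret finite_algebra A using assms by unfold_locales
  obtain k where k: "k \<ge> 1" "commutator A (replicate k (one_con A)) (one_con A) = zero_con A"
    using assms(4) by (auto simp: supernilpotent_def)
  \<comment> \<open>The commutator satisfies its own defining condition, and here it is the zero
    congruence.\<close>
  have "centralizes A (replicate k (one_con A)) (one_con A) (zero_con A)"
    using commutator_least(2)[OF assms(1), of "replicate k (one_con A)" "one_con A"] congruence_one k(2)
    by simp
  then interpret supernilpotent_algebra A k using k(1) by unfold_locales
  obtain D where D: "\<forall>F\<in>pol. \<forall>G\<in>pol. (\<exists>s\<in>vals. F s = G s) \<longrightarrow>
    (\<exists>I. finite I \<and> card I \<le> D \<and>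
      (\<forall>y\<in>vals. \<exists>y'\<in>vals. (\<forall>i. i \<notin> I \<longrightarrow> y' i = y i) \<and> F y' = G y'))"
    using solutions_dense[OF assms(5,3)] by blast
  \<comment> \<open>At most D cells are redrawn, each from q - 1 bits; the constant does not involve
    the numbering e.\<close>
  let ?c = "(1/2) ^ (D * (card (univ A) - 1)) :: real"
  have "\<exists>P. linear_time_monte_carlo P ?c (csat_instance A) (csat_satisfiable A) (encode_csat e)"
    if e: "bij_betw e (univ A) {..<card (univ A)}" for e
  proof -
    interpret csat_machine A e using assms e by unfold_locales
    let ?L = "2 * (q - 1) + 7" and ?x = "\<lambda>bs i. dec (draw bs i)"
    obtain K where K: "\<forall>C g1 g2 bs. csat_instance A (C, g1, g2) \<longrightarrow>
     (let w = encode_csat e (C, g1, g2); T = K * length w in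
       9 + length C * ?L \<le> T \<and>
       (\<forall>t. bounded_config T (drun program bs (init_config w) t)) \<and>
       drun program bs (init_config w) T = Halted (\<exists>a. computes A C (?x bs) g1 a \<and> computes A C (?x bs) g2 a))"
      using program_correct by (rule exE)
    have xv: "?x bs \<in> vals" for bs using dec_in draw_less by (auto simp: vals_def)
    have "linear_time_monte_carlo program ?c (csat_instance A) (csat_satisfiable A) (encode_csat e)"
      unfolding linear_time_monte_carlo_def
    proof (intro exI[of _ K] allI impI)
      fix I assume I: "csat_instance A I"
      obtain C g1 g2 where CI: "I = (C, g1, g2)" by (cases I)
      define w where "w = encode_csat e I"
      define T where "T = K * length w"
      define good where "good bs \<longleftrightarrow> (\<exists>a. computes A C (?x bs) g1 a \<and> computes A C (?x bs) g2 a)" for bs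
      have *: "9 + length C * ?L \<le> T \<and> (\<forall>t. bounded_config T (drun program bs (init_config w) t)) \<and>
          drun program bs (init_config w) T = Halted (good bs)" for bs
        using K[rule_format, OF I[unfolded CI], of bs] by (simp add: Let_def w_def T_def CI good_def)
      have T: "9 + length C * ?L \<le> T" and bounded: "bounded_config T (drun program bs (init_config w) t)"
        and halted: "drun program bs (init_config w) T = Halted (good bs)" for bs t
        using * by simp_all
      have run: "run program w T = map_pmf (\<lambda>bs. Halted (good bs)) (bits T)"
        by (simp add: run_drun halted)
      have pmf: "pmf (run program w T) (Halted True) = measure_pmf.prob (bits T) {bs. good bs}"
        unfolding run pmf_map by (rule arg_cong[where f = "measure_pmf.prob (bits T)"]) auto
      have yes: "?c \<le> pmf (run program w T) (Halted True)" if sat: "csat_satisfiable A I"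
      proof -
        have circ: "is_circuit A C" "g1 < length C" "g2 < length C"
          using I by (auto simp: CI csat_instance_def)
        obtain F G where F: "F \<in> pol" "\<And>x. x \<in> vals \<Longrightarrow> computes A C x g1 (F x)"
          and G: "G \<in> pol" "\<And>x. x \<in> vals \<Longrightarrow> computes A C x g2 (G x)"
          using gate_pol[OF circ(1,2)] gate_pol[OF circ(1,3)] by blast
        obtain s a where s: "range s \<subseteq> univ A" "computes A C s g1 a" "computes A C s g2 a"
          using sat by (auto simp: CI csat_satisfiable_def)
        then have sv: "s \<in> vals" by (simp add: vals_def)
        then have "F s = G s" using F(2) G(2) s(2,3) computes_unique by metis
        then have "\<exists>s\<in>vals. F s = G s" using sv by blast
        from D[THEN bspec, OF F(1), THEN bspec, OF G(1), THEN mp, OF this]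
        obtain J where J: "finite J" "card J \<le> D"
          "\<And>y. y \<in> vals \<Longrightarrow> \<exists>y'\<in>vals. (\<forall>i. i \<notin> J \<longrightarrow> y' i = y i) \<and> F y' = G y'"
          by blast
        \<comment> \<open>Positions that are not gates are dropped: the circuit ignores their
          values, and their flips could fall after T.\<close>
        define J' where "J' = J \<inter> {..<length C}"
        define Q where "Q = (\<lambda>(i, j). 9 + i * ?L + 2 * j) ` (J' \<times> {..<q - 1})"
        have "card Q \<le> card (J' \<times> {..<q - 1})"
          unfolding Q_def using J(1) by (intro card_image_le) (auto simp: J'_def)
        also have "\<dots> \<le> D * (q - 1)"
          using card_mono[of J J'] J(1,2) by (auto simp: card_cartesian_product J'_def)
        finally have cardQ: "card Q \<le> D * (card (univ A) - 1)" by (simp add: q_def)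
        have Q: "Q \<subseteq> {..<T}"
        proof
          fix t assume "t \<in> Q"
          then obtain i j where ij: "i < length C" "j < q - 1" "t = 9 + i * ?L + 2 * j"
            by (auto simp: Q_def J'_def)
          have "Suc i * ?L \<le> length C * ?L" using ij(1) by (intro mult_le_mono1) simp
          then have "t < 9 + length C * ?L" using ij(2,3) by simp
          then show "t \<in> {..<T}" using T by simp
        qed
        have "\<exists>bs'. (\<forall>t. t \<notin> Q \<longrightarrow> bs' t = bs t) \<and> good bs'" for bs
        proof -
          obtain y where y: "y \<in> vals" "\<forall>i. i \<notin> J \<longrightarrow> y i = ?x bs i" "F y = G y"
            using J(3)[OF xv] by blast
          obtain bs' where bs': "\<forall>t. t \<notin> Q \<longrightarrow> bs' t = bs t"
            "\<forall>i. ?x bs' i = (if i \<in> J' then y i else ?x bs i)"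
            using redraw[of J' y Q bs] y(1) vals_nth unfolding Q_def by blast
          have "?x bs' i = y i" if "i < length C" for i
            using that bs'(2) y(2) by (auto simp: J'_def)
          then have "good bs'"
            unfolding good_def using computes_cong[of A C y _ _ "?x bs'"] F(2)[OF y(1)] G(2)[OF y(1)] y(3) by metis
          then show ?thesis using bs'(1) by blast
        qed
        then have "(1/2) ^ card Q \<le> measure_pmf.prob (bits T) {bs. good bs}"
          by (intro bits_prob_ge Q)
        moreover have "?c \<le> (1/2) ^ card Q" using cardQ by (intro power_decreasing) auto
        ultimately show ?thesis unfolding pmf by linarith
      qed
      have no: "pmf (run program w T) (Halted True) = 0" if "\<not> csat_satisfiable A I"
      proof -
        have "\<not> good bs" for bs
          using that xv[of bs] unfolding good_def CI csat_satisfiable_def vals_def by blast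
        then have "{bs. good bs} = {}" by blast
        then show ?thesis unfolding pmf by (simp only: measure_empty)
      qed
      have b: "\<forall>t. \<forall>cfg\<in>set_pmf (run program w t). bounded_config T cfg"
        using bounded by (auto simp: run_drun)
      show "let w = encode_csat e I; T = K * length w in
           (\<forall>t. \<forall>cfg\<in>set_pmf (run program w t). bounded_config T cfg) \<and>
           set_pmf (run program w T) \<subseteq> range Halted \<and>
           (csat_satisfiable A I \<longrightarrow> ?c \<le> pmf (run program w T) (Halted True)) \<and>
           (\<not> csat_satisfiable A I \<longrightarrow> pmf (run program w T) (Halted True) = 0)"
        unfolding Let_def w_def[symmetric] T_def[symmetric] using yes no b by (auto simp: run)
    qed
    then show ?thesis by blast
  qed
  then show ?thesis by (intro exI[of _ ?c]) simp
qed

end
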